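(* For all $g,p$ with $2g-2+p>0$, $$\operatorname{diam}_W\big(\mathrm{Graph}(g,p)\big)\ \asymp\ (g+p)\log(g+p).$$
   Context: Here $g,p\ge0$ are integers, and $a\asymp b$ means $\frac1K b\le a\le K b$ for a uniform constant $K$ (independent of $g$ and $p$). $\mathrm{Graph}(g,p)$ is the set of connected graphs (loops and multiple edges allowed) of rank $g$ (first Betti number) with exactly $p$ valence-1 vertices, labeled bijectively by $p$ labels, and $2g-2+p$ valence-3 vertices, up to label-preserving isomorphism. An edge is interior if both its endpoints have valence three. A Whitehead move on an interior edge $e$ with distinct endpoints collapses $e$ to a valence-4 vertex and reopens it in one of the two other ways of splitting the four incident half-edges into two pairs. $d_W(\Gamma_1,\Gamma_2)$ is the minimal number of Whitehead moves transforming $\Gamma_1$ into $\Gamma_2$, and $\operatorname{diam}_W$ is the diameter with respect to $d_W$.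
   Formalization: The lower bound is not claimed for (g,p) = (0,3) and (1,1), where Graph(g,p) is a single point, so its diameter is 0 while (g+p)log(g+p) > 0; the upper bound is claimed for all g,p with 2g-2+p>0. *)

theory Defs
  imports Complex_Main "HOL-Library.Extended_Real"
begin

text \<open>
  Multigraphs (loops and multiple edges allowed) are given by half-edges: \<open>origin\<close> sends a
  half-edge to the vertex it is attached to, and the fixed-point-free involution \<open>opp\<close> sends it to
  the other half of its edge. The fields are only meaningful on the carriers \<open>verts\<close>, \<open>halfs\<close>;
  \<open>label\<close> only on the valence-1 vertices.
\<close>

record ('v, 'h) lgraph =
  verts :: "'v set"
  halfs :: "'h set"
  origin :: "'h \<Rightarrow> 'v"
  opp :: "'h \<Rightarrow> 'h"
  label :: "'v \<Rightarrow> nat"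

definition finite_graph :: "('v, 'h) lgraph \<Rightarrow> bool" where
  "finite_graph G \<longleftrightarrow> finite (verts G) \<and> finite (halfs G) \<and>
     (\<forall>h\<in>halfs G. origin G h \<in> verts G \<and> opp G h \<in> halfs G \<and>
        opp G h \<noteq> h \<and> opp G (opp G h) = h)"

definition edges :: "('v, 'h) lgraph \<Rightarrow> 'h set set" where
  "edges G = {{h, opp G h} | h. h \<in> halfs G}"

definition star :: "('v, 'h) lgraph \<Rightarrow> 'v \<Rightarrow> 'h set" where
  "star G v = {h \<in> halfs G. origin G h = v}"

text \<open>A loop contributes two half-edges, hence 2, to the valence of its vertex.\<close>

definition valence :: "('v, 'h) lgraph \<Rightarrow> 'v \<Rightarrow> nat" where
  "valence G v = card (star G v)"

definition leaves :: "('v, 'h) lgraph \<Rightarrow> 'v set" where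
  "leaves G = {v \<in> verts G. valence G v = 1}"

definition reach :: "('v, 'h) lgraph \<Rightarrow> ('v \<times> 'v) set" where
  "reach G = {(origin G h, origin G (opp G h)) | h. h \<in> halfs G}\<^sup>* \<inter> verts G \<times> verts G"

definition connected_graph :: "('v, 'h) lgraph \<Rightarrow> bool" where
  "connected_graph G \<longleftrightarrow> verts G \<noteq> {} \<and> (\<forall>u\<in>verts G. \<forall>v\<in>verts G. (u, v) \<in> reach G)"

definition betti :: "('v, 'h) lgraph \<Rightarrow> int" where
  "betti G = int (card (edges G)) - int (card (verts G)) + int (card (verts G // reach G))"

definition trivalent_graph :: "nat \<Rightarrow> nat \<Rightarrow> ('v, 'h) lgraph \<Rightarrow> bool" where
  "trivalent_graph g p G \<longleftrightarrow> finite_graph G \<and> connected_graph G \<and> betti G = int g \<and>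
     (\<forall>v\<in>verts G. valence G v = 1 \<or> valence G v = 3) \<and>
     int (card {v \<in> verts G. valence G v = 3}) = 2 * int g - 2 + int p \<and>
     bij_betw (label G) (leaves G) {1..p}"

definition isomorphic :: "('v, 'h) lgraph \<Rightarrow> ('w, 'k) lgraph \<Rightarrow> bool" where
  "isomorphic G G' \<longleftrightarrow> (\<exists>f \<phi>. bij_betw f (verts G) (verts G') \<and> bij_betw \<phi> (halfs G) (halfs G') \<and>
     (\<forall>h\<in>halfs G. origin G' (\<phi> h) = f (origin G h) \<and> opp G' (\<phi> h) = \<phi> (opp G h)) \<and>
     (\<forall>v\<in>leaves G. label G' (f v) = label G v))"

text \<open>Every finite graph is isomorphic to one whose vertices and half-edges are natural numbers.\<close>

type_synonym ngraph = "(nat, nat) lgraph"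

definition Graph :: "nat \<Rightarrow> nat \<Rightarrow> ngraph set set" where
  "Graph g p = {G. trivalent_graph g p G} //
     {(G, G'). trivalent_graph g p G \<and> trivalent_graph g p G' \<and> isomorphic G G'}"

text \<open>
  The edge of \<open>h\<close> joins \<open>u \<noteq> w\<close>. After collapsing it, the four half-edges
  \<open>A \<union> B\<close> are incident to one vertex; reopening it along the splitting
  \<open>{P, Q} \<noteq> {A, B}\<close> we reuse the names \<open>h, opp G h, u, w\<close> for the new edge and its endpoints.
\<close>

definition whitehead_move :: "('v, 'h) lgraph \<Rightarrow> ('v, 'h) lgraph \<Rightarrow> bool" where
  "whitehead_move G G' \<longleftrightarrow> (\<exists>h\<in>halfs G. \<exists>u w A B P Q.
     u = origin G h \<and> w = origin G (opp G h) \<and> u \<noteq> w \<and> valence G u = 3 \<and> valence G w = 3 \<and>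
     A = star G u - {h} \<and> B = star G w - {opp G h} \<and>
     P \<union> Q = A \<union> B \<and> P \<inter> Q = {} \<and> card P = 2 \<and> card Q = 2 \<and> {P, Q} \<noteq> {A, B} \<and>
     G' = G\<lparr>origin := \<lambda>x. if x \<in> P then u else if x \<in> Q then w else origin G x\<rparr>)"

definition moves :: "nat \<Rightarrow> nat \<Rightarrow> (ngraph set \<times> ngraph set) set" where
  "moves g p = {(X, Y). X \<in> Graph g p \<and> Y \<in> Graph g p \<and> (\<exists>G\<in>X. \<exists>G'\<in>Y. whitehead_move G G')}"

text \<open>The distance is \<open>\<infinity>\<close> if no sequence of moves exists.\<close>

definition d_W :: "nat \<Rightarrow> nat \<Rightarrow> ngraph set \<Rightarrow> ngraph set \<Rightarrow> enat" where
  "d_W g p X Y = (INF n\<in>{n. (X, Y) \<in> moves g p ^^ n}. enat n)"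

definition diam_W :: "nat \<Rightarrow> nat \<Rightarrow> enat" where
  "diam_W g p = (SUP X\<in>Graph g p. SUP Y\<in>Graph g p. d_W g p X Y)"

text \<open>
  If \<open>2 g - 2 + p = 1\<close>, i.e. \<open>(g, p)\<close> is \<open>(0, 3)\<close> or \<open>(1, 1)\<close>, then \<open>Graph g p\<close> is a single point
  while \<open>(g + p) ln (g + p) > 0\<close>, so no lower bound \<open>(g + p) ln (g + p) / K \<le> diam_W g p\<close>
  can hold there.
\<close>

lemma diam_W_eq_0:
  assumes "\<And>(G :: ngraph) (G' :: ngraph). trivalent_graph g p G \<Longrightarrow> trivalent_graph g p G' \<Longrightarrow> isomorphic G G'"
  shows "diam_W g p = 0"
proof -
  have *: "X = {G. trivalent_graph g p G}" if "X \<in> Graph g p" for X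
  proof -
    let ?R = "{(G, G'). trivalent_graph g p G \<and> trivalent_graph g p G' \<and> isomorphic G G'}"
    have "?R `` {G} = {G :: ngraph. trivalent_graph g p G}" if "trivalent_graph g p G" for G :: ngraph
      using that assms by blast
    then show ?thesis using that unfolding Graph_def quotient_def by blast
  qed
  have "d_W g p X Y = 0" if "X \<in> Graph g p" "Y \<in> Graph g p" for X Y
  proof -
    have "(X, Y) \<in> moves g p ^^ 0" using *[OF that(1)] *[OF that(2)] by simp
    then have "d_W g p X Y \<le> enat 0" unfolding d_W_def by (intro INF_lower) auto
    then show ?thesis by (simp add: zero_enat_def[symmetric])
  qed
  then have "diam_W g p \<le> 0" unfolding diam_W_def by (intro SUP_least) auto
  then show ?thesis by simp
qed

lemma leaf_opp:
  assumes G: "finite_graph G" "connected_graph G" and v: "v \<in> leaves G"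
    and x: "x \<in> verts G" "x \<notin> leaves G"
    and V: "verts G \<subseteq> insert x (leaves G)"
  obtains h where "star G v = {h}" "opp G h \<in> star G x"
proof -
  from v obtain h where h: "star G v = {h}"
    unfolding leaves_def valence_def by (auto simp: card_1_singleton_iff)
  have hH: "h \<in> halfs G" "origin G h = v" using h by (auto simp: star_def)
  let ?w = "origin G (opp G h)"
  have oH: "opp G h \<in> halfs G" "?w \<in> verts G" "opp G (opp G h) = h"
    using G(1) hH unfolding finite_graph_def by auto
  have "?w = x"
  proof (rule ccontr)
    assume "?w \<noteq> x"
    then have w: "?w \<in> leaves G" using V oH by auto
    then obtain k where k: "star G ?w = {k}"
      unfolding leaves_def valence_def by (auto simp: card_1_singleton_iff)
    then have k': "star G ?w = {opp G h}" using oH by (auto simp: star_def)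
    let ?R = "{(origin G h, origin G (opp G h)) | h. h \<in> halfs G}"
    have step: "b \<in> {v, ?w}" if "(a, b) \<in> ?R" "a \<in> {v, ?w}" for a b
    proof -
      from that obtain j where j: "j \<in> halfs G" "a = origin G j" "b = origin G (opp G j)" by auto
      have "j \<in> star G v \<union> star G ?w" using j that(2) by (auto simp: star_def)
      then have "j = h \<or> j = opp G h" using h k' by auto
      then show ?thesis using j oH hH by auto
    qed
    have "(v, x) \<in> ?R\<^sup>*" using G(2) v x by (auto simp: connected_graph_def reach_def leaves_def)
    then have "x \<in> {v, ?w}" by (induction rule: rtrancl_induct) (use step in blast)+
    then show False using v x w by auto
  qed
  then show ?thesis using that h oH by (auto simp: star_def)
qed

lemma trivalent_center:
  assumes "trivalent_graph g p G" "2 * int g - 2 + int p = 1"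
  obtains x where "x \<in> verts G" "x \<notin> leaves G" "verts G = insert x (leaves G)"
    "card (star G x) = 3" "halfs G = star G x \<union> (\<Union>v\<in>leaves G. star G v)"
proof -
  have "card {v \<in> verts G. valence G v = 3} = 1" using assms by (auto simp: trivalent_graph_def)
  then obtain x where x: "{v \<in> verts G. valence G v = 3} = {x}" by (auto simp: card_1_singleton_iff)
  have *: "x \<in> verts G" "x \<notin> leaves G" "valence G x = 3" using x by (auto simp: leaves_def)
  have V: "verts G = insert x (leaves G)"
    using x assms(1) unfolding trivalent_graph_def leaves_def by auto
  have "halfs G = star G x \<union> (\<Union>v\<in>leaves G. star G v)"
    using assms(1) V unfolding trivalent_graph_def finite_graph_def star_def by auto
  then show ?thesis using that * V by (auto simp: valence_def)
qed

lemma form_0_3: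
  assumes T: "trivalent_graph 0 3 G"
  shows "\<exists>x v1 v2 v3 a1 a2 a3 b1 b2 b3. verts G = {x, v1, v2, v3} \<and> distinct [x, v1, v2, v3] \<and>
    leaves G = {v1, v2, v3} \<and> label G v1 = 1 \<and> label G v2 = 2 \<and> label G v3 = 3 \<and>
    halfs G = {a1, a2, a3, b1, b2, b3} \<and> distinct [a1, a2, a3, b1, b2, b3] \<and>
    origin G a1 = v1 \<and> origin G a2 = v2 \<and> origin G a3 = v3 \<and>
    origin G b1 = x \<and> origin G b2 = x \<and> origin G b3 = x \<and>
    opp G a1 = b1 \<and> opp G a2 = b2 \<and> opp G a3 = b3 \<and> opp G b1 = a1 \<and> opp G b2 = a2 \<and> opp G b3 = a3"
proof -
  from T obtain x where x: "x \<in> verts G" "x \<notin> leaves G" "verts G = insert x (leaves G)"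
    "card (star G x) = 3" "halfs G = star G x \<union> (\<Union>v\<in>leaves G. star G v)"
    by (rule trivalent_center) auto
  have fg: "finite_graph G" "connected_graph G" and b: "bij_betw (label G) (leaves G) {1..3}"
    using T by (auto simp: trivalent_graph_def)
  have "\<exists>v\<in>leaves G. label G v = i" if "i \<in> {1..3}" for i
    using b that unfolding bij_betw_def by (metis imageE)
  then obtain v where v: "\<And>i. i \<in> {1..3} \<Longrightarrow> v i \<in> leaves G \<and> label G (v i) = i" by metis
  have L: "leaves G = {v 1, v 2, v 3}"
  proof
    show "leaves G \<subseteq> {v 1, v 2, v 3}"
    proof
      fix u assume u: "u \<in> leaves G"
      then have "label G u \<in> {1..3}" using b by (auto simp: bij_betw_def)
      moreover have "u = v (label G u)"
        using u v[OF calculation] b by (auto simp: bij_betw_def inj_on_def)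
      moreover have "label G u = 1 \<or> label G u = 2 \<or> label G u = 3" using calculation(1) by auto
      ultimately show "u \<in> {v 1, v 2, v 3}" by auto
    qed
  qed (use v in auto)
  have "\<exists>h. star G (v i) = {h} \<and> opp G h \<in> star G x" if "i \<in> {1..3}" for i
    using leaf_opp[OF fg _ x(1,2)] v[OF that] x(3) by (metis subset_refl)
  then obtain a where a: "\<And>i. i \<in> {1..3} \<Longrightarrow> star G (v i) = {a i} \<and> opp G (a i) \<in> star G x" by metis
  have a': "a i \<in> halfs G" "origin G (a i) = v i" "opp G (opp G (a i)) = a i"
    "origin G (opp G (a i)) = x" "opp G (a i) \<in> halfs G" if "i \<in> {1..3}" for i
    using a[OF that] fg(1) by (auto simp: star_def finite_graph_def)
  note I = v[of 1] v[of 2] v[of 3] a[of 1] a[of 2] a[of 3] a'[of 1] a'[of 2] a'[of 3]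
  have dv: "distinct [x, v 1, v 2, v 3]" using I x(2) by auto
  have da: "distinct [a 1, a 2, a 3, opp G (a 1), opp G (a 2), opp G (a 3)]"
  proof -
    have n: "opp G (a i) \<noteq> opp G (a j)" "a i \<noteq> a j" if "v i \<noteq> v j" "i \<in> {1..3}" "j \<in> {1..3}" for i j
      using a'[OF that(2)] a'[OF that(3)] that(1) by metis+
    have m: "a i \<noteq> opp G (a j)" if "i \<in> {1..3}" "j \<in> {1..3}" for i j
      using a'[OF that(1)] a'[OF that(2)] v[OF that(1)] x(2) by metis
    show ?thesis using dv by (simp add: n m m[symmetric] eq_commute)
  qed
  have "{opp G (a 1), opp G (a 2), opp G (a 3)} = star G x"
    using da I x(4) by (intro card_subset_eq) (auto intro: card_ge_0_finite)
  then have "halfs G = {a 1, a 2, a 3, opp G (a 1), opp G (a 2), opp G (a 3)}"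
    using x(5) L I by auto
  moreover have "verts G = {x, v 1, v 2, v 3}" using x(3) L by simp
  moreover have "label G (v 1) = 1" "label G (v 2) = 2" "label G (v 3) = 3" using v by auto
  moreover have "origin G (a 1) = v 1" "origin G (a 2) = v 2" "origin G (a 3) = v 3"
    "opp G (opp G (a 1)) = a 1" "opp G (opp G (a 2)) = a 2" "opp G (opp G (a 3)) = a 3"
    "origin G (opp G (a 1)) = x" "origin G (opp G (a 2)) = x" "origin G (opp G (a 3)) = x"
    using a' by auto
  ultimately show ?thesis using dv da L
    by - (rule exI[of _ x],
      rule exI[of _ "v 1"],
      rule exI[of _ "v 2"],
      rule exI[of _ "v 3"],
      rule exI[of _ "a 1"],
      rule exI[of _ "a 2"],
      rule exI[of _ "a 3"],
      rule exI[of _ "opp G (a 1)"],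
      rule exI[of _ "opp G (a 2)"],
      rule exI[of _ "opp G (a 3)"],
      intro conjI; (assumption | rule refl))
qed

lemma form_1_1:
  assumes T: "trivalent_graph 1 1 G"
  shows "\<exists>x v a b c d. verts G = {x, v} \<and> x \<noteq> v \<and> leaves G = {v} \<and> label G v = 1 \<and>
    halfs G = {a, b, c, d} \<and> distinct [a, b, c, d] \<and>
    origin G a = v \<and> origin G b = x \<and> origin G c = x \<and> origin G d = x \<and>
    opp G a = b \<and> opp G b = a \<and> opp G c = d \<and> opp G d = c"
proof -
  from T obtain x where x: "x \<in> verts G" "x \<notin> leaves G" "verts G = insert x (leaves G)"
    "card (star G x) = 3" "halfs G = star G x \<union> (\<Union>v\<in>leaves G. star G v)"
    by (rule trivalent_center) auto
  have fg: "finite_graph G" "connected_graph G" and bb: "bij_betw (label G) (leaves G) {1..1}"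
    using T by (auto simp: trivalent_graph_def)
  have "card (leaves G) = 1" using bij_betw_same_card[OF bb] by simp
  then obtain v where L: "leaves G = {v}" by (auto simp: card_1_singleton_iff)
  have lab: "label G v = 1" using bb L by (auto simp: bij_betw_def)
  obtain a where a: "star G v = {a}" "opp G a \<in> star G x"
    using leaf_opp[OF fg _ x(1,2), of v] L x(3) by (metis insertI1 subset_refl)
  let ?b = "opp G a"
  have "card (star G x - {?b}) = 2" using x(4) a(2) by (simp add: card_ge_0_finite)
  then obtain c d where cd: "star G x - {?b} = {c, d}" "c \<noteq> d" by (auto simp: card_2_iff)
  have S: "star G x = {?b, c, d}" "c \<noteq> ?b" "d \<noteq> ?b" using cd a(2) by auto
  have H: "halfs G = {a, ?b, c, d}" using x(5) L a(1) S(1) by auto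
  have o: "origin G a = v" "origin G ?b = x" "origin G c = x" "origin G d = x"
    using a S(1) unfolding star_def by auto
  have xv: "x \<noteq> v" using x(2) L by auto
  have F: "opp G h \<in> {a, ?b, c, d} \<and> opp G h \<noteq> h \<and> opp G (opp G h) = h" if "h \<in> {a, ?b, c, d}" for h
    using fg(1) that unfolding finite_graph_def H by blast
  have op: "opp G ?b = a" using F[of a] by simp
  have ac: "a \<noteq> c" "a \<noteq> d" using o xv by auto
  have op': "opp G c = d" "opp G d = c"
    using F[of c] F[of d] ac S(2,3) op by (metis insertE insertI1 insertI2 singletonD)+
  have "distinct [a, ?b, c, d]" using o xv S cd(2) by auto
  then show ?thesis using x(3) L lab H o xv op op'
    by - (rule exI[of _ x],
      rule exI[of _ v],
      rule exI[of _ a],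
      rule exI[of _ "opp G a"],
      rule exI[of _ c],
      rule exI[of _ d], simp)
qed

lemma list_bij:
  assumes "distinct xs" "distinct ys" "length xs = length ys"
  obtains f where "bij_betw f (set xs) (set ys)" "map f xs = ys"
proof -
  define f where "f = (\<lambda>x. the (map_of (zip xs ys) x))"
  have m: "map f xs = ys"
    by (rule nth_equalityI) (use assms in \<open>auto simp: f_def map_of_zip_nth\<close>)
  then have im: "f ` set xs = set ys" by (metis set_map)
  have "card (f ` set xs) = card (set xs)"
    unfolding im using assms by (simp add: distinct_card)
  then have "bij_betw f (set xs) (set ys)" using im by (simp add: bij_betw_def eq_card_imp_inj_on)
  then show ?thesis using m that by blast
qed

lemma diam_W_0_3: "diam_W 0 3 = 0"
proof (rule diam_W_eq_0)
  fix G G' :: ngraph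
  assume "trivalent_graph 0 3 G" "trivalent_graph 0 3 G'"
  from form_0_3[OF this(1)] form_0_3[OF this(2)] show "isomorphic G G'"
  proof (elim exE conjE, goal_cases)
    case (1 x x' v1 v1' v2 v2' v3 v3' a1 a1' a2 a2' a3 a3' b1 b1' b2 b2' b3 b3')
    obtain f where f: "bij_betw f (set [x, v1, v2, v3]) (set [x', v1', v2', v3'])"
      "map f [x, v1, v2, v3] = [x', v1', v2', v3']"
      by (rule list_bij[of "[x, v1, v2, v3]" "[x', v1', v2', v3']"]) (use 1 in \<open>simp (no_asm_simp) only: list.size | assumption\<close>)+
    obtain \<phi> where \<phi>: "bij_betw \<phi> (set [a1, a2, a3, b1, b2, b3]) (set [a1', a2', a3', b1', b2', b3'])"
      "map \<phi> [a1, a2, a3, b1, b2, b3] = [a1', a2', a3', b1', b2', b3']"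
      by (rule list_bij[of "[a1, a2, a3, b1, b2, b3]" "[a1', a2', a3', b1', b2', b3']"]) (use 1 in \<open>simp (no_asm_simp) only: list.size | assumption\<close>)+
    show ?case unfolding isomorphic_def
    proof (rule exI[of _ f], rule exI[of _ \<phi>], intro conjI)
      show "bij_betw f (verts G) (verts G')" using f(1) 1 by (simp only: list.set)
      show "bij_betw \<phi> (halfs G) (halfs G')" using \<phi>(1) 1 by (simp only: list.set)
      show "\<forall>v\<in>leaves G. label G' (f v) = label G v" using f(2) 1 by simp
      show "\<forall>h\<in>halfs G. origin G' (\<phi> h) = f (origin G h) \<and> opp G' (\<phi> h) = \<phi> (opp G h)"
        using f(2) \<phi>(2) 1 by simp
    qed
  qed
qed

lemma diam_W_1_1: "diam_W 1 1 = 0"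
proof (rule diam_W_eq_0)
  fix G G' :: ngraph
  assume "trivalent_graph 1 1 G" "trivalent_graph 1 1 G'"
  from form_1_1[OF this(1)] form_1_1[OF this(2)] show "isomorphic G G'"
  proof (elim exE conjE, goal_cases)
    case (1 x x' v v' a a' b b' c c' d d')
    obtain f where f: "bij_betw f (set [x, v]) (set [x', v'])" "map f [x, v] = [x', v']"
      by (rule list_bij[of "[x, v]" "[x', v']"]) (use 1 in simp_all)
    obtain \<phi> where \<phi>: "bij_betw \<phi> (set [a, b, c, d]) (set [a', b', c', d'])"
      "map \<phi> [a, b, c, d] = [a', b', c', d']"
      by (rule list_bij[of "[a, b, c, d]" "[a', b', c', d']"]) (use 1 in \<open>simp (no_asm_simp) only: list.size | assumption\<close>)+
    show ?case unfolding isomorphic_def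
      by (rule exI[of _ f], rule exI[of _ \<phi>]) (use 1 f \<phi> in simp)
  qed
qed

end

theory Submission
  imports Defs "HOL-Combinatorics.Multiset_Permutations"
begin

text \<open>
  Upper bound: cutting a graph along the edges outside a spanning tree of its trivalent vertices
  turns it into a binary tree with \<open>2 g + p\<close> labelled ends, and rotations of this tree are
  Whitehead moves. Every binary tree becomes a comb in linearly many rotations, and combs are
  sorted as in merge sort, because a comb and the join of two combs whose leaf lists it
  interleaves differ by linearly many rotations.

  Lower bound, following the short encodings of Sleator, Tarjan and Thurston: a sequence of moves is
  determined, up to commuting independent moves, by the local words that it writes at the vertices,
  so only \<open>C ^ (n + r)\<close> graphs are reachable from a given one by \<open>r\<close> moves. On the other
  hand a graph is a comb in at most \<open>C ^ n\<close> ways, while the combs with ends in arbitrary order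
  provide at least \<open>(n - 1)!\<close> labelled trees, where \<open>n = g + p\<close>.
\<close>

subsection \<open>Rotations of binary trees\<close>

text \<open>Counting sequences of moves naively allows about \<open>g + p\<close> choices per step,
  and against roughly \<open>(g + p)!\<close> graphs this yields only a linear lower bound. The
  logarithm survives because the global order of moves is discarded: only the order at each vertex
  is recorded, in an alphabet of constant size, and equal local records lead to the same graph.

  The other obstacle is that a graph carries only \<open>p\<close> labels. For the upper bound the
  halves of the \<open>g\<close> cut edges are numbered arbitrarily, up to the pairing
  \<open>mate\<close>, so that any two graphs become trees over one leaf set. For the lower bound
  this freedom is harmful, since up to \<open>2 ^ g * g!\<close> numberings describe one graph. The
  first halves of the cut edges are therefore frozen at the front of the comb or at its root, and
  only the other labels, at least \<open>g + p - 1\<close> of them, are permuted.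

  The count leaves an additive term linear in \<open>g + p\<close>. It is harmless once
  \<open>ln (g + p)\<close> is large; in the remaining bounded range it is enough that the diameter
  is at least 1, hence the explicit pair of non-isomorphic graphs near the end.\<close>

datatype 'a btree = Leaf 'a | Node "'a btree" "'a btree"

fun leaf_list :: "'a btree \<Rightarrow> 'a list" where
  "leaf_list (Leaf x) = [x]"
| "leaf_list (Node l r) = leaf_list l @ leaf_list r"

fun comb :: "'a list \<Rightarrow> 'a btree" where
  "comb [] = undefined"
| "comb [x] = Leaf x"
| "comb (x # y # zs) = Node (Leaf x) (comb (y # zs))"

lemma comb_Cons: "xs \<noteq> [] \<Longrightarrow> comb (x # xs) = Node (Leaf x) (comb xs)"
  by (cases xs) auto

lemma leaf_list_comb: "xs \<noteq> [] \<Longrightarrow> leaf_list (comb xs) = xs"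
  by (induction xs rule: comb.induct) auto

lemma leaf_list_nonempty [simp]: "leaf_list t \<noteq> []"
  by (induction t) auto

text \<open>The index counts rotations. Exchanging the two children is free because a vertex of a
  graph carries an unordered set of half-edges; with free exchange, congruence in the left child and
  one direction of rotation generate the rest.\<close>

inductive tree_moves :: "nat \<Rightarrow> 'a btree \<Rightarrow> 'a btree \<Rightarrow> bool" where
  tree_moves_refl: "tree_moves 0 t t"
| tree_moves_comm: "tree_moves 0 (Node a b) (Node b a)"
| tree_moves_rot: "tree_moves 1 (Node (Node a b) c) (Node a (Node b c))"
| tree_moves_trans: "tree_moves m t u \<Longrightarrow> tree_moves n u w \<Longrightarrow> tree_moves (m + n) t w"
| tree_moves_congL: "tree_moves n a a' \<Longrightarrow> tree_moves n (Node a b) (Node a' b)"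

lemma tree_moves_trans': "tree_moves m t u \<Longrightarrow> tree_moves n u w \<Longrightarrow> k = m + n \<Longrightarrow> tree_moves k t w"
  using tree_moves_trans by blast

lemma tree_moves_congR: "tree_moves n b b' \<Longrightarrow> tree_moves n (Node a b) (Node a b')"
  using tree_moves_trans'[OF tree_moves_comm tree_moves_trans'[OF tree_moves_congL tree_moves_comm]]
  by fastforce

lemma tree_moves_cong:
  "tree_moves m a a' \<Longrightarrow> tree_moves n b b' \<Longrightarrow> tree_moves (m + n) (Node a b) (Node a' b')"
  by (rule tree_moves_trans[OF tree_moves_congL tree_moves_congR])

lemma tree_moves_rot_inv: "tree_moves 1 (Node a (Node b c)) (Node (Node a b) c)"
proof -
  have "tree_moves 0 (Node a (Node b c)) (Node (Node c b) a)"
    using tree_moves_trans[OF tree_moves_comm tree_moves_congL[OF tree_moves_comm]] by simp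
  moreover have "tree_moves 1 (Node (Node c b) a) (Node c (Node b a))"
    by (rule tree_moves_rot)
  moreover have "tree_moves 0 (Node c (Node b a)) (Node (Node a b) c)"
    using tree_moves_trans[OF tree_moves_comm tree_moves_congL[OF tree_moves_comm]] by simp
  ultimately show ?thesis
    by (metis tree_moves_trans add.left_neutral add.right_neutral)
qed

lemma tree_moves_sym: "tree_moves n t u \<Longrightarrow> tree_moves n u t"
proof (induction rule: tree_moves.induct)
  case (tree_moves_trans m t u n w)
  then show ?case using tree_moves.tree_moves_trans by (metis add.commute)
qed (auto intro: tree_moves.intros tree_moves_rot_inv[simplified])

text \<open>The comb \<open>ys\<close> is an accumulator that makes the induction close: one
  rotation per inner node of \<open>t\<close> exposes its two children, and the right one is
  absorbed first. Inner nodes are one fewer than leaves, whence the strict bound.\<close>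

lemma tree_moves_flatten_onto:
  "ys \<noteq> [] \<Longrightarrow> \<exists>n < length (leaf_list t). tree_moves n (Node t (comb ys)) (comb (leaf_list t @ ys))"
proof (induction t arbitrary: ys)
  case (Leaf x)
  then show ?case by (auto simp: comb_Cons intro: tree_moves_refl)
next
  case (Node l r)
  obtain n where n: "n < length (leaf_list r)"
    "tree_moves n (Node r (comb ys)) (comb (leaf_list r @ ys))"
    using Node.IH(2) Node.prems by blast
  obtain m where m: "m < length (leaf_list l)"
    "tree_moves m (Node l (comb (leaf_list r @ ys))) (comb (leaf_list l @ leaf_list r @ ys))"
    using Node.IH(1)[of "leaf_list r @ ys"] by auto
  have "tree_moves (1 + (n + m)) (Node (Node l r) (comb ys)) (comb (leaf_list l @ leaf_list r @ ys))"
    by (rule tree_moves_trans[OF tree_moves_rot tree_moves_trans[OF tree_moves_congR[OF n(2)] m(2)]])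
  then show ?case using n(1) m(1) by (intro exI[of _ "1 + (n + m)"]) auto
qed

lemma tree_moves_flatten:
  "\<exists>n < length (leaf_list t). tree_moves n t (comb (leaf_list t))"
proof (induction t)
  case (Leaf x)
  then show ?case by (auto intro: tree_moves_refl)
next
  case (Node l r)
  then obtain n where n: "n < length (leaf_list r)" "tree_moves n r (comb (leaf_list r))"
    by blast
  obtain m where m: "m < length (leaf_list l)"
    "tree_moves m (Node l (comb (leaf_list r))) (comb (leaf_list l @ leaf_list r))"
    using tree_moves_flatten_onto[of "leaf_list r"] by auto
  show ?case
    using n m tree_moves_trans[OF tree_moves_congR[OF n(2)] m(2)]
    by (intro exI[of _ "n + m"]) auto
qed

text \<open>Each letter of \<open>zs\<close> is the first letter of one of the two combs, and a
  single rotation, after a free exchange if it sits in the second comb, lifts it above the rest.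
  When one comb is used up, what remains already is a comb.\<close>

lemma tree_moves_merge:
  "zs \<in> shuffles xs ys \<Longrightarrow> xs \<noteq> [] \<Longrightarrow> ys \<noteq> [] \<Longrightarrow>
    \<exists>n \<le> length zs. tree_moves n (Node (comb xs) (comb ys)) (comb zs)"
proof (induction zs arbitrary: xs ys)
  case Nil
  then show ?case by auto
next
  case (Cons z zs)
  have main: "\<exists>n \<le> length (z # zs). tree_moves n (Node (comb (z # xs)) (comb ys)) (comb (z # zs))"
    if zs: "zs \<in> shuffles xs ys" and ne: "ys \<noteq> []" for xs ys
  proof (cases "xs = []")
    case True
    then have "zs = ys" using zs by simp
    then have "Node (comb (z # xs)) (comb ys) = comb (z # zs)"
      using True ne by (simp add: comb_Cons)
    then show ?thesis using tree_moves_refl by (intro exI[of _ 0]) auto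
  next
    case False
    obtain n where n: "n \<le> length zs" "tree_moves n (Node (comb xs) (comb ys)) (comb zs)"
      using Cons.IH[OF zs False ne] by blast
    have "zs \<noteq> []" using zs ne by auto
    then show ?thesis
      using n False tree_moves_trans[OF tree_moves_rot tree_moves_congR[OF n(2)], of "Leaf z"]
      by (intro exI[of _ "1 + n"]) (simp add: comb_Cons)
  qed
  from Cons.prems(1) consider
      xs' where "xs = z # xs'" "zs \<in> shuffles xs' ys"
    | ys' where "ys = z # ys'" "zs \<in> shuffles xs ys'"
    by (cases xs; cases ys) auto
  then show ?case
  proof cases
    case (1 xs')
    then show ?thesis using main[OF 1(2) Cons.prems(3)] by simp
  next
    case (2 ys')
    then have "zs \<in> shuffles ys' xs" by (simp add: shuffles_commutes)
    from main[OF this Cons.prems(2)] obtain n where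
      "n \<le> length (z # zs)" "tree_moves n (Node (comb ys) (comb xs)) (comb (z # zs))"
      using 2 by auto
    then show ?thesis
      using tree_moves_trans[OF tree_moves_comm, of n] by (metis add.left_neutral)
  qed
qed

text \<open>Merge sort whose first half runs backwards: undoing a merge splits \<open>xs\<close>
  into the letters of the first and of the second part of \<open>ys\<close>, both parts are sorted
  recursively, and a merge joins them. Each level costs two linear passes, so the bound satisfies
  \<open>T (j + 1) = 2 * T j + 2 * 2 ^ (j + 1)\<close>.\<close>

lemma tree_moves_sort:
  assumes "length ys \<le> 2 ^ j" "ys \<noteq> []" "distinct ys" "distinct xs" "set xs = set ys"
  shows "\<exists>n \<le> 2 * j * 2 ^ j. tree_moves n (comb xs) (comb ys)"
  using assms
proof (induction j arbitrary: xs ys)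
  case 0
  then obtain y where y: "ys = [y]" by (cases ys) auto
  have "length xs = 1" using 0 y distinct_card[of xs] by simp
  then have "xs = ys" using 0 y by (cases xs) auto
  then show ?case by (auto intro: tree_moves_refl)
next
  case (Suc j)
  have len: "length xs = length ys" using Suc.prems by (metis distinct_card)
  show ?case
  proof (cases "length ys \<le> 2 ^ j")
    case True
    then obtain n where "n \<le> 2 * j * 2 ^ j" "tree_moves n (comb xs) (comb ys)"
      using Suc by blast
    moreover have "2 * j * 2 ^ j \<le> 2 * Suc j * 2 ^ Suc j" by (intro mult_le_mono) auto
    ultimately show ?thesis by (meson le_trans)
  next
    case False
    define as bs where "as = take (2 ^ j) ys" and "bs = drop (2 ^ j) ys"
    have ys: "ys = as @ bs" by (simp add: as_def bs_def)
    have la: "length as \<le> 2 ^ j" "as \<noteq> []" and lb: "length bs \<le> 2 ^ j" "bs \<noteq> []"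
      using False Suc.prems(1) by (auto simp: as_def bs_def)
    define P where "P x \<longleftrightarrow> x \<in> set as" for x
    have dis: "distinct as" "distinct bs" "set as \<inter> set bs = {}"
      using Suc.prems(3) unfolding ys by auto
    have setx: "set xs = set as \<union> set bs" using Suc.prems(5) unfolding ys by simp
    have A: "set (filter P xs) = set as" "set (filter (\<lambda>x. \<not> P x) xs) = set bs"
      using setx dis by (auto simp: P_def)
    have ne: "filter P xs \<noteq> []" "filter (\<lambda>x. \<not> P x) xs \<noteq> []"
      using A la lb by (metis set_empty)+
    obtain n1 where n1: "n1 \<le> length xs"
      "tree_moves n1 (Node (comb (filter P xs)) (comb (filter (\<lambda>x. \<not> P x) xs))) (comb xs)"
      using tree_moves_merge[OF partition_in_shuffles ne] by blast
    obtain n2 where n2: "n2 \<le> 2 * j * 2 ^ j" "tree_moves n2 (comb (filter P xs)) (comb as)"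
      using Suc.IH[OF la dis(1) _ A(1)] Suc.prems(4) by auto
    obtain n3 where n3: "n3 \<le> 2 * j * 2 ^ j" "tree_moves n3 (comb (filter (\<lambda>x. \<not> P x) xs)) (comb bs)"
      using Suc.IH[OF lb dis(2) _ A(2)] Suc.prems(4) by auto
    \<comment> \<open>The concatenation \<open>as @ bs\<close> is one particular shuffle, so
      \<open>tree_moves_merge\<close> also performs the final joining.\<close>
    have "filter P ys = as" "filter (\<lambda>x. \<not> P x) ys = bs"
      using dis unfolding ys by (auto simp: P_def filter_empty_conv filter_id_conv)
    then have "ys \<in> shuffles as bs" by (metis partition_in_shuffles)
    from tree_moves_merge[OF this la(2) lb(2)] obtain n4 where
      n4: "n4 \<le> length ys" "tree_moves n4 (Node (comb as) (comb bs)) (comb ys)" by blast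
    have "tree_moves (n1 + (n2 + n3 + n4)) (comb xs) (comb ys)"
      by (rule tree_moves_trans[OF tree_moves_sym[OF n1(2)]
            tree_moves_trans[OF tree_moves_cong[OF n2(2) n3(2)] n4(2)]])
    moreover have "n1 + (n2 + n3 + n4) \<le> 2 * (2 * 2 ^ j) + 2 * (2 * j * 2 ^ j)"
      using n1 n2 n3 n4 len Suc.prems(1) by simp
    moreover have "2 * (2 * 2 ^ j) + 2 * (2 * j * 2 ^ j) = 2 * Suc j * 2 ^ Suc j"
      by (simp add: algebra_simps)
    ultimately show ?thesis by metis
  qed
qed

lemma tree_moves_same_leaves:
  assumes "distinct (leaf_list t)" "distinct (leaf_list u)" "set (leaf_list t) = set (leaf_list u)"
    and "length (leaf_list t) \<le> 2 ^ j"
  shows "\<exists>n \<le> 2 * (j + 1) * 2 ^ j. tree_moves n t u"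
proof -
  have len: "length (leaf_list t) = length (leaf_list u)" using assms by (metis distinct_card)
  obtain n1 where n1: "n1 < length (leaf_list t)" "tree_moves n1 t (comb (leaf_list t))"
    using tree_moves_flatten by blast
  obtain n2 where n2: "n2 < length (leaf_list u)" "tree_moves n2 u (comb (leaf_list u))"
    using tree_moves_flatten by blast
  obtain n3 where n3: "n3 \<le> 2 * j * 2 ^ j" "tree_moves n3 (comb (leaf_list t)) (comb (leaf_list u))"
    using tree_moves_sort[of "leaf_list u" j "leaf_list t"] assms len by auto
  have "tree_moves (n1 + (n3 + n2)) t u"
    by (rule tree_moves_trans[OF n1(2) tree_moves_trans[OF n3(2) tree_moves_sym[OF n2(2)]]])
  moreover have "n1 + (n3 + n2) \<le> 2 * (j + 1) * 2 ^ j"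
    using n1 n2 n3 len assms(4) by (simp add: algebra_simps)
  ultimately show ?thesis by blast
qed

subsection \<open>Elementary facts on graphs\<close>

lemma finite_graphD:
  assumes "finite_graph G" "h \<in> halfs G"
  shows "origin G h \<in> verts G" "opp G h \<in> halfs G" "opp G h \<noteq> h" "opp G (opp G h) = h"
  using assms by (auto simp: finite_graph_def)

lemma finite_star: "finite_graph G \<Longrightarrow> finite (star G v)"
  by (simp add: finite_graph_def star_def)

lemma mem_star [simp]: "x \<in> star G v \<longleftrightarrow> x \<in> halfs G \<and> origin G x = v"
  by (simp add: star_def)

lemma trivalentD:
  assumes "trivalent_graph g p G"
  shows "finite_graph G" "connected_graph G" "betti G = int g"
    "v \<in> verts G \<Longrightarrow> valence G v = 1 \<or> valence G v = 3"
    "int (card {v \<in> verts G. valence G v = 3}) = 2 * int g - 2 + int p"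
    "bij_betw (label G) (leaves G) {1..p}"
  using assms unfolding trivalent_graph_def by blast+

lemma betti_connected:
  assumes "connected_graph G"
  shows "betti G = int (card (edges G)) - int (card (verts G)) + 1"
proof -
  have ne: "verts G \<noteq> {}" and r: "\<And>u v. u \<in> verts G \<Longrightarrow> v \<in> verts G \<Longrightarrow> (u, v) \<in> reach G"
    using assms by (auto simp: connected_graph_def)
  have "reach G `` {u} = verts G" if "u \<in> verts G" for u
    using r that unfolding reach_def by blast
  then have "verts G // reach G = {verts G}"
    using ne unfolding quotient_def by auto
  then show ?thesis by (simp add: betti_def)
qed

text \<open>The form in which connectedness is used: a spanning tree that cannot grow, or an edge
  between two leaves, would give a closed vertex set that misses a trivalent vertex.\<close>

lemma connected_closed_eq:
  assumes "finite_graph G" "connected_graph G" "C \<subseteq> verts G" "C \<noteq> {}"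
    and closed: "\<And>h. h \<in> halfs G \<Longrightarrow> origin G h \<in> C \<Longrightarrow> origin G (opp G h) \<in> C"
  shows "C = verts G"
proof -
  obtain c where c: "c \<in> C" using assms(4) by blast
  let ?R = "{(origin G h, origin G (opp G h)) | h. h \<in> halfs G}"
  have "v \<in> C" if "v \<in> verts G" for v
  proof -
    have "(c, v) \<in> ?R\<^sup>*" using assms(2,3) c that by (auto simp: connected_graph_def reach_def)
    then show ?thesis by (induction rule: rtrancl_induct) (use c closed in auto)
  qed
  then show ?thesis using assms(3) by blast
qed

subsection \<open>Whitehead moves as swaps of half-edges\<close>

definition swap :: "('v, 'h) lgraph \<Rightarrow> 'h \<Rightarrow> 'h \<Rightarrow> ('v, 'h) lgraph" where
  "swap G s t = G\<lparr>origin := \<lambda>x. origin G (transpose s t x)\<rparr>"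

lemma swap_simps [simp]:
  "verts (swap G s t) = verts G" "halfs (swap G s t) = halfs G" "opp (swap G s t) = opp G"
  "label (swap G s t) = label G" "origin (swap G s t) x = origin G (transpose s t x)"
  by (simp_all add: swap_def)

definition pivot :: "('v, 'h) lgraph \<Rightarrow> 'h \<Rightarrow> 'h \<Rightarrow> 'h \<Rightarrow> bool" where
  "pivot G h s t \<longleftrightarrow> h \<in> halfs G \<and> s \<in> halfs G \<and> t \<in> halfs G \<and>
     origin G s = origin G h \<and> s \<noteq> h \<and> origin G t = origin G (opp G h) \<and> t \<noteq> opp G h \<and>
     origin G h \<noteq> origin G (opp G h) \<and>
     valence G (origin G h) = 3 \<and> valence G (origin G (opp G h)) = 3"

lemma card_2_memE:
  assumes "x \<in> A" "card A = 2"
  obtains y where "A = {x, y}" "y \<noteq> x"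
proof -
  obtain a b where ab: "A = {a, b}" "a \<noteq> b" using assms(2) by (auto simp: card_2_iff)
  then have "x = a \<or> x = b" using assms(1) by simp
  then show ?thesis using ab that[of a] that[of b] by blast
qed

text \<open>Two pairs \<open>{P, Q}\<close> other than \<open>{A, B}\<close> must separate the
  half-edges of \<open>A\<close> and also those of \<open>B\<close>, so exactly one half-edge of
  each end changes sides. Seen as a transposition of two half-edges, the move fixes the carriers,
  \<open>opp\<close> and \<open>label\<close>, and invariants are easy to follow.\<close>

lemma whitehead_move_iff:
  assumes G: "finite_graph G"
  shows "whitehead_move G G' \<longleftrightarrow> (\<exists>h s t. pivot G h s t \<and> G' = swap G s t)"
proof
  assume W: "whitehead_move G G'"
  obtain h u w A B P Q where h: "h \<in> halfs G"
    and u: "u = origin G h" and w: "w = origin G (opp G h)" and uw: "u \<noteq> w"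
    and val: "valence G u = 3" "valence G w = 3"
    and A: "A = star G u - {h}" and B: "B = star G w - {opp G h}"
    and PQ: "P \<union> Q = A \<union> B" "P \<inter> Q = {}" "card P = 2" "card Q = 2" "{P, Q} \<noteq> {A, B}"
    and G': "G' = G\<lparr>origin := \<lambda>x. if x \<in> P then u else if x \<in> Q then w else origin G x\<rparr>"
    using W[unfolded whitehead_move_def] by (elim bexE exE conjE) (rule that; assumption)
  note o = finite_graphD[OF G h]
  have cA: "card A = 2" "card B = 2"
    using val o h unfolding A B valence_def u w by auto
  have AB: "A \<inter> B = {}" using uw unfolding A B by auto
  have oA: "\<And>x. x \<in> A \<Longrightarrow> origin G x = u \<and> x \<in> halfs G"
    and oB: "\<And>x. x \<in> B \<Longrightarrow> origin G x = w \<and> x \<in> halfs G"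
    unfolding A B by auto
  have fin: "finite A" "finite B" "finite P" "finite Q"
    using cA PQ by (metis card.infinite zero_neq_numeral)+
  have "\<not> A \<subseteq> P"
  proof
    assume "A \<subseteq> P"
    then have "A = P" using cA PQ fin by (simp add: card_subset_eq)
    then have "Q = B" using PQ(1,2) AB by blast
    then show False using \<open>A = P\<close> PQ(5) by blast
  qed
  moreover have "\<not> B \<subseteq> P"
  proof
    assume "B \<subseteq> P"
    then have "B = P" using cA PQ fin by (simp add: card_subset_eq)
    then have "Q = A" using PQ(1,2) AB by blast
    then show False using \<open>B = P\<close> PQ(5) by blast
  qed
  ultimately obtain s b where s: "s \<in> A" "s \<notin> P" and b: "b \<in> B" "b \<notin> P" by blast
  obtain a where a: "A = {s, a}" "a \<noteq> s"
    by (rule card_2_memE[OF s(1) cA(1)])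
  obtain t where t: "B = {b, t}" "t \<noteq> b"
    by (rule card_2_memE[OF b(1) cA(2)])
  have "{s, b} \<subseteq> Q" using s b PQ(1) by blast
  moreover have "s \<noteq> b" using s b AB by auto
  ultimately have Q: "Q = {s, b}"
    using PQ(4) fin by (metis card_2_iff card_subset_eq)
  have P: "P = {a, t}" using PQ(1,2) Q a t AB s b by blast
  have "pivot G h s t"
    unfolding pivot_def using h oA[of s] oB[of t] s t uw val u w A B by auto
  moreover have "G' = swap G s t"
    unfolding G' swap_def P Q
    using oA[of s] oA[of a] oB[of t] oB[of b] a t s b AB
    by (intro lgraph.fold_congs refl ext arg_cong[where f = "\<lambda>f. G\<lparr>origin := f\<rparr>"]) (auto simp: transpose_def)
  ultimately show "\<exists>h s t. pivot G h s t \<and> G' = swap G s t" by blast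
next
  assume "\<exists>h s t. pivot G h s t \<and> G' = swap G s t"
  then obtain h s t where p: "pivot G h s t" and G': "G' = swap G s t" by blast
  let ?u = "origin G h" and ?w = "origin G (opp G h)"
  let ?A = "star G ?u - {h}" and ?B = "star G ?w - {opp G h}"
  note p' = p[unfolded pivot_def]
  note o = finite_graphD[OF G, of h]
  have cA: "card ?A = 2" "card ?B = 2"
    using p' o unfolding valence_def by auto
  have s: "s \<in> ?A" and t: "t \<in> ?B" using p' by auto
  obtain a where a: "?A = {s, a}" "a \<noteq> s"
    by (rule card_2_memE[OF s cA(1)])
  obtain b where b: "?B = {t, b}" "b \<noteq> t"
    by (rule card_2_memE[OF t cA(2)])
  have ma: "a \<in> ?A" "b \<in> ?B" using a b by auto
  have d: "s \<noteq> t" "s \<noteq> b" "a \<noteq> t" "a \<noteq> b" using s t ma p' by auto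
  have "G' = G\<lparr>origin := \<lambda>x. if x \<in> {a, t} then ?u else if x \<in> {s, b} then ?w else origin G x\<rparr>"
    unfolding G' swap_def using s t ma a(2) b(2) d
    by (intro arg_cong[where f = "\<lambda>f. G\<lparr>origin := f\<rparr>"] ext) (auto simp: transpose_def)
  moreover have "{a, t} \<union> {s, b} = ?A \<union> ?B" unfolding a(1) b(1) by auto
  moreover have "{{a, t}, {s, b}} \<noteq> {?A, ?B}"
    unfolding a(1) b(1) using a(2) b(2) d by (auto simp: doubleton_eq_iff)
  moreover have "{a, t} \<inter> {s, b} = {}" "card {a, t} = 2" "card {s, b} = 2"
    using a(2) b(2) d by auto
  moreover have "h \<in> halfs G" "?u \<noteq> ?w" "valence G ?u = 3" "valence G ?w = 3"
    using p' by auto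
  ultimately show "whitehead_move G G'"
    unfolding whitehead_move_def
    by (intro bexI[of _ h] exI[of _ "origin G h"] exI[of _ "origin G (opp G h)"] exI[of _ ?A]
        exI[of _ ?B] exI[of _ "{a, t}"] exI[of _ "{s, b}"] conjI) (assumption | rule refl)+
qed

lemma star_swap:
  assumes "s \<in> halfs G" "t \<in> halfs G"
  shows "star (swap G s t) v = transpose s t ` star G v"
proof -
  have "x \<in> halfs G \<longleftrightarrow> transpose s t x \<in> halfs G" for x
    using assms by (auto simp: transpose_def)
  then show ?thesis by (intro set_eqI) (simp add: in_transpose_image_iff)
qed

lemma valence_swap:
  "s \<in> halfs G \<Longrightarrow> t \<in> halfs G \<Longrightarrow> valence (swap G s t) v = valence G v"
  unfolding valence_def by (simp add: star_swap card_image)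

lemma finite_graph_swap:
  assumes "finite_graph G" "s \<in> halfs G" "t \<in> halfs G"
  shows "finite_graph (swap G s t)"
  using assms unfolding finite_graph_def by (auto simp: transpose_def)

lemma pivot_swap:
  assumes "pivot G h s t"
  shows "origin (swap G s t) x = (if x = s then origin G (opp G h) else if x = t then origin G h else origin G x)"
  using assms by (auto simp: pivot_def transpose_def)

text \<open>The pivot edge keeps its ends, and the old and new origins of any half-edge are equal or
  are the two ends of this edge. An old adjacency is thus a path of at most three new ones.\<close>

lemma connected_graph_swap:
  assumes fin: "finite_graph G" and con: "connected_graph G" and p: "pivot G h s t"
  shows "connected_graph (swap G s t)"
proof -
  let ?G = "swap G s t" and ?u = "origin G h" and ?w = "origin G (opp G h)"
  let ?R = "{(origin G k, origin G (opp G k)) | k. k \<in> halfs G}"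
  define R' where "R' = {(origin ?G k, origin ?G (opp G k)) | k. k \<in> halfs G}"
  note p' = p[unfolded pivot_def]
  have os: "origin G s = ?u" and ot: "origin G t = ?w" using p' by auto
  have ne: "h \<noteq> s" "h \<noteq> t" "opp G h \<noteq> s" "opp G h \<noteq> t" using p' os ot by metis+
  have hh: "origin ?G h = ?u" "origin ?G (opp G h) = ?w"
    using ne by (simp_all only: pivot_swap[OF p] if_False)
  have h': "opp G h \<in> halfs G" "opp G (opp G h) = h" using finite_graphD[OF fin] p' by auto
  have R'I: "(origin ?G k, origin ?G (opp G k)) \<in> R'" if "k \<in> halfs G" for k
    using that unfolding R'_def by blast
  have uw: "(?u, ?w) \<in> R'" using R'I[of h] p' unfolding hh by blast
  have wu: "(?w, ?u) \<in> R'" using R'I[OF h'(1)] unfolding h'(2) hh .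
  have near: "(origin G x, origin ?G x) \<in> R'\<^sup>* \<and> (origin ?G x, origin G x) \<in> R'\<^sup>*" for x
  proof -
    consider "x = s" | "x = t" "x \<noteq> s" | "x \<noteq> s" "x \<noteq> t" by blast
    then show ?thesis
    proof cases
      case 1
      then have "origin ?G x = ?w" "origin G x = ?u" by (simp_all only: pivot_swap[OF p] os simp_thms if_True)
      then show ?thesis using uw wu by (metis r_into_rtrancl)
    next
      case 2
      then have "origin ?G x = ?u" "origin G x = ?w"
        by (simp_all only: pivot_swap[OF p] ot simp_thms if_True if_False)
      then show ?thesis using uw wu by (metis r_into_rtrancl)
    next
      case 3
      then show ?thesis by (simp only: pivot_swap[OF p] if_False rtrancl.rtrancl_refl)
    qed
  qed
  have "(origin G k, origin G (opp G k)) \<in> R'\<^sup>*" if "k \<in> halfs G" for k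
    by (rule rtrancl_trans[OF conjunct1[OF near] rtrancl_trans[OF r_into_rtrancl[OF R'I[OF that]]
          conjunct2[OF near]]])
  then have "?R \<subseteq> R'\<^sup>*" by auto
  then have "?R\<^sup>* \<subseteq> R'\<^sup>*" by (rule rtrancl_subset_rtrancl)
  then show ?thesis using con unfolding connected_graph_def reach_def R'_def by auto
qed

lemma trivalent_graph_swap:
  assumes T: "trivalent_graph g p G" and piv: "pivot G h s t"
  shows "trivalent_graph g p (swap G s t)"
proof -
  have st: "s \<in> halfs G" "t \<in> halfs G" using piv by (auto simp: pivot_def)
  note T' = trivalentD[OF T]
  have con: "connected_graph (swap G s t)" by (rule connected_graph_swap[OF T'(1,2) piv])
  have "edges (swap G s t) = edges G" by (simp add: edges_def)
  then have "betti (swap G s t) = int g"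
    using T'(3) by (simp add: betti_connected con T'(2))
  moreover have "leaves (swap G s t) = leaves G" by (simp add: leaves_def valence_swap[OF st])
  ultimately show ?thesis
    unfolding trivalent_graph_def using con finite_graph_swap[OF T'(1) st] T
    by (simp add: valence_swap[OF st] trivalent_graph_def)
qed

lemma trivalent_graph_whitehead:
  "trivalent_graph g p G \<Longrightarrow> whitehead_move G G' \<Longrightarrow> trivalent_graph g p G'"
  using trivalent_graph_swap by (metis trivalentD(1) whitehead_move_iff)

lemma trivalent_graph_whitehead_relpowp:
  "(whitehead_move ^^ n) G G' \<Longrightarrow> trivalent_graph g p G \<Longrightarrow> trivalent_graph g p G'"
  by (induction n arbitrary: G') (auto intro: trivalent_graph_whitehead)

subsection \<open>Isomorphisms\<close>

definition iso_by :: "('v \<Rightarrow> 'w) \<Rightarrow> ('h \<Rightarrow> 'k) \<Rightarrow> ('v, 'h) lgraph \<Rightarrow> ('w, 'k) lgraph \<Rightarrow> bool" where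
  "iso_by f \<phi> G G' \<longleftrightarrow> bij_betw f (verts G) (verts G') \<and> bij_betw \<phi> (halfs G) (halfs G') \<and>
     (\<forall>h\<in>halfs G. origin G' (\<phi> h) = f (origin G h) \<and> opp G' (\<phi> h) = \<phi> (opp G h)) \<and>
     (\<forall>v\<in>leaves G. label G' (f v) = label G v)"

lemma isomorphic_iff: "isomorphic G G' \<longleftrightarrow> (\<exists>f \<phi>. iso_by f \<phi> G G')"
  by (simp add: isomorphic_def iso_by_def)

lemma iso_by_star:
  assumes "finite_graph G" "iso_by f \<phi> G G'" "v \<in> verts G"
  shows "star G' (f v) = \<phi> ` star G v"
proof -
  have "\<phi> x \<in> star G' (f v) \<longleftrightarrow> x \<in> star G v" if "x \<in> halfs G" for x
    using assms that finite_graphD(1)[OF assms(1) that]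
    by (auto simp: iso_by_def bij_betw_def inj_on_def)
  moreover have "star G' (f v) \<subseteq> \<phi> ` halfs G"
    using assms by (auto simp: iso_by_def bij_betw_def)
  ultimately show ?thesis by (auto simp: subset_iff image_iff) (metis mem_star)+
qed

lemma iso_by_valence:
  assumes "finite_graph G" "iso_by f \<phi> G G'" "v \<in> verts G"
  shows "valence G' (f v) = valence G v"
proof -
  have "inj_on \<phi> (star G v)"
    using assms(2) by (auto simp: iso_by_def bij_betw_def inj_on_def)
  then show ?thesis unfolding valence_def iso_by_star[OF assms] by (rule card_image)
qed

lemma iso_by_leaves:
  assumes "finite_graph G" "iso_by f \<phi> G G'" "v \<in> verts G"
  shows "f v \<in> leaves G' \<longleftrightarrow> v \<in> leaves G"
  using assms iso_by_valence[OF assms] by (auto simp: leaves_def iso_by_def bij_betw_def)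

lemma iso_by_inv:
  assumes G: "finite_graph G" and i: "iso_by f \<phi> G G'"
  shows "iso_by (inv_into (verts G) f) (inv_into (halfs G) \<phi>) G' G"
proof -
  note i' = i[unfolded iso_by_def]
  have bf: "bij_betw f (verts G) (verts G')" and bp: "bij_betw \<phi> (halfs G) (halfs G')"
    using i' by auto
  have 1: "origin G (inv_into (halfs G) \<phi> h) = inv_into (verts G) f (origin G' h) \<and>
      opp G (inv_into (halfs G) \<phi> h) = inv_into (halfs G) \<phi> (opp G' h)" if h: "h \<in> halfs G'" for h
  proof -
    obtain k where k: "k \<in> halfs G" "h = \<phi> k" using h bp by (auto simp: bij_betw_def)
    note o = finite_graphD[OF G k(1)]
    have "origin G' h = f (origin G k)" "opp G' h = \<phi> (opp G k)" using i' k by auto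
    then show ?thesis
      using k o bf bp by (simp add: bij_betw_inv_into_left)
  qed
  have 2: "label G (inv_into (verts G) f v) = label G' v" if v: "v \<in> leaves G'" for v
  proof -
    have "v \<in> verts G'" using v by (simp add: leaves_def)
    then obtain u where u: "u \<in> verts G" "v = f u" using bf by (auto simp: bij_betw_def)
    then have "u \<in> leaves G" using iso_by_leaves[OF G i u(1)] v by simp
    then have "label G' v = label G u" using i' u(2) by blast
    then show ?thesis using u bf by (simp add: bij_betw_inv_into_left)
  qed
  show ?thesis unfolding iso_by_def
    using 1 2 bij_betw_inv_into[OF bf] bij_betw_inv_into[OF bp] by blast
qed

lemma iso_by_comp:
  assumes G: "finite_graph G" and i: "iso_by f \<phi> G G'" and j: "iso_by f' \<phi>' G' G''"
  shows "iso_by (f' \<circ> f) (\<phi>' \<circ> \<phi>) G G''"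
proof -
  have "label G'' (f' (f v)) = label G v" if "v \<in> leaves G" for v
    using iso_by_leaves[OF G i, of v] that i j by (auto simp: iso_by_def leaves_def)
  moreover have "\<phi> h \<in> halfs G'" if "h \<in> halfs G" for h
    using that i by (auto simp: iso_by_def bij_betw_def)
  ultimately show ?thesis
    using i j unfolding iso_by_def by (auto intro: bij_betw_trans)
qed

lemma isomorphic_refl: "isomorphic G G"
  unfolding isomorphic_iff iso_by_def by (rule exI[of _ id], rule exI[of _ id]) simp

lemma isomorphic_sym: "finite_graph G \<Longrightarrow> isomorphic G G' \<Longrightarrow> isomorphic G' G"
  unfolding isomorphic_iff using iso_by_inv by blast

lemma isomorphic_trans:
  "finite_graph G \<Longrightarrow> isomorphic G G' \<Longrightarrow> isomorphic G' G'' \<Longrightarrow> isomorphic G G''"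
  unfolding isomorphic_iff using iso_by_comp by blast

lemma iso_by_pivot:
  assumes G: "finite_graph G" and i: "iso_by f \<phi> G G'" and p: "pivot G h s t"
  shows "pivot G' (\<phi> h) (\<phi> s) (\<phi> t)" "iso_by f \<phi> (swap G s t) (swap G' (\<phi> s) (\<phi> t))"
proof -
  note i' = i[unfolded iso_by_def] and p' = p[unfolded pivot_def]
  have mem: "\<phi> x \<in> halfs G'" if "x \<in> halfs G" for x using that i' by (auto simp: bij_betw_def)
  have inj: "\<phi> x = \<phi> y \<longleftrightarrow> x = y" if "x \<in> halfs G" "y \<in> halfs G" for x y
    using that i' by (auto simp: bij_betw_def inj_on_def)
  have injf: "f x = f y \<longleftrightarrow> x = y" if "x \<in> verts G" "y \<in> verts G" for x y
    using that i' by (auto simp: bij_betw_def inj_on_def)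
  have o: "\<And>x. x \<in> halfs G \<Longrightarrow> origin G' (\<phi> x) = f (origin G x)"
    "\<And>x. x \<in> halfs G \<Longrightarrow> opp G' (\<phi> x) = \<phi> (opp G x)" using i' by auto
  note oh = finite_graphD[OF G, of h]
  have V: "origin G h \<in> verts G" "origin G (opp G h) \<in> verts G"
    using finite_graphD[OF G] p' by auto
  note v = iso_by_valence[OF G i]
  show "pivot G' (\<phi> h) (\<phi> s) (\<phi> t)"
    unfolding pivot_def using p' oh V by (simp add: o mem inj injf v)
  have tr: "transpose (\<phi> s) (\<phi> t) (\<phi> x) = \<phi> (transpose s t x)" if "x \<in> halfs G" for x
    using that p' inj by (auto simp: transpose_def)
  have trm: "transpose s t x \<in> halfs G" if "x \<in> halfs G" for x
    using that p' by (auto simp: transpose_def)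
  have "leaves (swap G s t) = leaves G" using p' by (simp add: leaves_def valence_swap)
  then show "iso_by f \<phi> (swap G s t) (swap G' (\<phi> s) (\<phi> t))"
    unfolding iso_by_def using i' by (simp add: tr trm o)
qed

lemma isomorphic_whitehead:
  assumes "finite_graph G" "isomorphic G G'" "whitehead_move G H" "finite_graph G'"
  shows "\<exists>H'. whitehead_move G' H' \<and> isomorphic H H'"
proof -
  obtain f \<phi> where i: "iso_by f \<phi> G G'" using assms(2) by (auto simp: isomorphic_iff)
  obtain h s t where p: "pivot G h s t" and H: "H = swap G s t"
    using assms(3) whitehead_move_iff[OF assms(1)] by blast
  show ?thesis
    using iso_by_pivot[OF assms(1) i p] whitehead_move_iff[OF assms(4)]
    unfolding isomorphic_iff H by blast
qed

subsection \<open>Distances between isomorphism classes\<close>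

definition iso_rel :: "nat \<Rightarrow> nat \<Rightarrow> (ngraph \<times> ngraph) set" where
  "iso_rel g p = {(G, G'). trivalent_graph g p G \<and> trivalent_graph g p G' \<and> isomorphic G G'}"

lemma equiv_iso_rel: "equiv {G. trivalent_graph g p G} (iso_rel g p)"
proof (rule equivI)
  show "iso_rel g p \<subseteq> {G. trivalent_graph g p G} \<times> {G. trivalent_graph g p G}"
    by (auto simp: iso_rel_def)
  show "refl_on {G. trivalent_graph g p G} (iso_rel g p)"
    by (auto simp: iso_rel_def refl_on_def isomorphic_refl)
  show "sym (iso_rel g p)"
    by (auto simp: iso_rel_def sym_def trivalentD intro: isomorphic_sym)
  show "trans (iso_rel g p)"
    unfolding iso_rel_def trans_def using isomorphic_trans trivalentD(1) by blast
qed

lemma Graph_eq: "Graph g p = {G. trivalent_graph g p G} // iso_rel g p"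
  by (simp add: Graph_def iso_rel_def)

lemma GraphE:
  assumes "X \<in> Graph g p"
  obtains G where "trivalent_graph g p G" "X = iso_rel g p `` {G}" "G \<in> X"
  using assms unfolding Graph_eq
  by (elim quotientE) (metis equiv_class_self equiv_iso_rel mem_Collect_eq)

lemma mem_GraphD:
  assumes "X \<in> Graph g p" "G \<in> X"
  shows "trivalent_graph g p G" "X = iso_rel g p `` {G}"
  using assms unfolding Graph_eq
  by (metis (no_types, lifting) Union_quotient UnionI equiv_iso_rel mem_Collect_eq)
     (metis Graph_eq Image_singleton_iff assms equiv_class_eq equiv_iso_rel GraphE)

lemma mem_Graph_iff:
  assumes "X \<in> Graph g p" "G \<in> X" "trivalent_graph g p G'"
  shows "G' \<in> X \<longleftrightarrow> isomorphic G G'"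
  using mem_GraphD[OF assms(1,2)] assms(3) by (auto simp: iso_rel_def)

text \<open>Moves between classes are defined through arbitrary representatives, so successive steps
  need not fit together. Transporting each one along an isomorphism yields an honest sequence from
  the prescribed \<open>G\<close>, at the price of an uncontrolled representative at the
  end.\<close>

lemma moves_relpow_lift:
  assumes "(X, Y) \<in> moves g p ^^ n" "G \<in> X" "X \<in> Graph g p"
  shows "\<exists>G' \<in> Y. (whitehead_move ^^ n) G G' \<and> Y \<in> Graph g p"
  using assms(1)
proof (induction n arbitrary: Y)
  case 0
  then show ?case using assms by auto
next
  case (Suc n)
  then obtain Z where Z: "(X, Z) \<in> moves g p ^^ n" "(Z, Y) \<in> moves g p" by auto
  from Suc.IH[OF Z(1)] obtain H where H: "H \<in> Z" "(whitehead_move ^^ n) G H" by blast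
  from Z(2) obtain K K' where K: "K \<in> Z" "K' \<in> Y" "whitehead_move K K'" "Z \<in> Graph g p" "Y \<in> Graph g p"
    by (auto simp: moves_def)
  have T: "trivalent_graph g p H" "trivalent_graph g p K" "trivalent_graph g p K'"
    using mem_GraphD(1) H(1) K by blast+
  have "isomorphic K H" using mem_Graph_iff[OF K(4,1) T(1)] H(1) by simp
  from isomorphic_whitehead[OF _ this K(3)] obtain H' where
    H': "whitehead_move H H'" "isomorphic K' H'" using T trivalentD(1) by blast
  have "H' \<in> Y"
    using mem_Graph_iff[OF K(5,2)] H' trivalent_graph_whitehead[OF T(1)] by blast
  then show ?case using H(2) H'(1) K(5) by auto
qed

lemma moves_relpow_of_whitehead:
  assumes "(whitehead_move ^^ n) G G'" "trivalent_graph g p G"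
  shows "(iso_rel g p `` {G}, iso_rel g p `` {G'}) \<in> moves g p ^^ n"
  using assms(1)
proof (induction n arbitrary: G')
  case 0
  then show ?case by simp
next
  case (Suc n)
  then obtain H where H: "(whitehead_move ^^ n) G H" "whitehead_move H G'" by auto
  have T: "trivalent_graph g p H" "trivalent_graph g p G'"
    using trivalent_graph_whitehead_relpowp[OF H(1) assms(2)] trivalent_graph_whitehead H(2) by blast+
  have "(iso_rel g p `` {H}, iso_rel g p `` {G'}) \<in> moves g p"
    unfolding moves_def Graph_eq
    using T H(2) equiv_class_self[OF equiv_iso_rel, of H g p] equiv_class_self[OF equiv_iso_rel, of G' g p]
    by (auto intro!: quotientI)
  then show ?case using Suc.IH[OF H(1)] by auto
qed

lemma d_W_le_iff:
  "d_W g p X Y \<le> enat k \<longleftrightarrow> (\<exists>n \<le> k. (X, Y) \<in> moves g p ^^ n)"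
proof
  assume *: "d_W g p X Y \<le> enat k"
  let ?S = "enat ` {n. (X, Y) \<in> moves g p ^^ n}"
  \<comment> \<open>The infimum of the empty set is infinite, so a finite bound forces some sequence
    of moves to exist, and the least length attains the infimum.\<close>
  have "?S \<noteq> {}" using * unfolding d_W_def by (metis Inf_enat_def enat_ord_code(5))
  then have "Inf ?S \<in> ?S" unfolding Inf_enat_def by (auto intro: LeastI)
  then show "\<exists>n \<le> k. (X, Y) \<in> moves g p ^^ n" using * unfolding d_W_def by force
next
  assume "\<exists>n \<le> k. (X, Y) \<in> moves g p ^^ n"
  then obtain n where "n \<le> k" "(X, Y) \<in> moves g p ^^ n" by blast
  then show "d_W g p X Y \<le> enat k" unfolding d_W_def by (meson INF_lower2 enat_ord_simps(1) mem_Collect_eq)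
qed

subsection \<open>Trees inside a graph\<close>

text \<open>
  A tree with root half-edge \<open>h\<close> is the part of a spanning tree that is seen when the edge of
  \<open>h\<close> is crossed from \<open>h\<close>: either nothing, if the edge is cut (\<open>Lf h\<close>), or the vertex of
  \<open>opp G h\<close> with the trees at its two other half-edges (\<open>Nd h l r\<close>). Several half-edges of
  one vertex may be slots, and both halves of a cut edge occur as slots of the whole tree.
\<close>

datatype 'h dtree = Lf 'h | Nd 'h "'h dtree" "'h dtree"

fun rt :: "'h dtree \<Rightarrow> 'h" where
  "rt (Lf h) = h"
| "rt (Nd h l r) = h"

fun slots :: "'h dtree \<Rightarrow> 'h list" where
  "slots (Lf h) = [h]"
| "slots (Nd h l r) = slots l @ slots r"

fun shape :: "('h \<Rightarrow> 'a) \<Rightarrow> 'h dtree \<Rightarrow> 'a btree" where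
  "shape \<mu> (Lf h) = Leaf (\<mu> h)"
| "shape \<mu> (Nd h l r) = Node (shape \<mu> l) (shape \<mu> r)"

fun valid :: "('v, 'h) lgraph \<Rightarrow> 'h dtree \<Rightarrow> bool" where
  "valid G (Lf h) \<longleftrightarrow> h \<in> halfs G"
| "valid G (Nd h l r) \<longleftrightarrow> h \<in> halfs G \<and>
     star G (origin G (opp G h)) = {opp G h, rt l, rt r} \<and> distinct [opp G h, rt l, rt r] \<and>
     valid G l \<and> valid G r"

fun node_verts :: "('v, 'h) lgraph \<Rightarrow> 'h dtree \<Rightarrow> 'v list" where
  "node_verts G (Lf h) = []"
| "node_verts G (Nd h l r) = origin G (opp G h) # node_verts G l @ node_verts G r"

text \<open>Preorder with three consecutive entries per vertex, so entry \<open>i\<close> sits at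
  entry \<open>i div 3\<close> of \<open>node_verts\<close>. Equal positions in two trees of one
  shape later define an isomorphism.\<close>

fun node_halfs :: "('v, 'h) lgraph \<Rightarrow> 'h dtree \<Rightarrow> 'h list" where
  "node_halfs G (Lf h) = []"
| "node_halfs G (Nd h l r) = opp G h # rt l # rt r # node_halfs G l @ node_halfs G r"

fun edge_halfs :: "('v, 'h) lgraph \<Rightarrow> 'h dtree \<Rightarrow> 'h list" where
  "edge_halfs G (Lf h) = []"
| "edge_halfs G (Nd h l r) = h # opp G h # edge_halfs G l @ edge_halfs G r"

lemma leaf_list_shape: "leaf_list (shape l D) = map l (slots D)"
  by (induction D) auto

lemma length_slots: "length (slots D) = Suc (length (node_verts G D))"
  by (induction D) auto

lemma valid_rt: "valid G D \<Longrightarrow> rt D \<in> halfs G"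
  by (cases D) auto

text \<open>Double counting: half-edges at the tree vertices are slots or halves of tree edges, and
  the root half-edge supplies the outer half of the first edge. Multisets keep the identity exact
  even where a half-edge occurs twice.\<close>

lemma mset_node_halfs:
  "add_mset (rt D) (mset (node_halfs G D)) = mset (slots D) + mset (edge_halfs G D)"
proof (induction D)
  case (Nd h l r)
  have "add_mset (rt (Nd h l r)) (mset (node_halfs G (Nd h l r))) =
      {#h, opp G h#} + add_mset (rt l) (mset (node_halfs G l)) + add_mset (rt r) (mset (node_halfs G r))"
    by simp
  also have "\<dots> = mset (slots (Nd h l r)) + mset (edge_halfs G (Nd h l r))"
    unfolding Nd.IH by simp
  finally show ?case .
qed simp

lemma set_node_halfs:
  "valid G D \<Longrightarrow> set (node_halfs G D) = {x \<in> halfs G. origin G x \<in> set (node_verts G D)}"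
proof (induction D)
  case (Nd h l r)
  have "set (node_halfs G (Nd h l r)) =
      star G (origin G (opp G h)) \<union> (set (node_halfs G l) \<union> set (node_halfs G r))"
    using Nd.prems by simp
  also have "\<dots> = {x \<in> halfs G. origin G x \<in> set (node_verts G (Nd h l r))}"
    using Nd by (auto simp: star_def)
  finally show ?case .
qed simp

lemma map_origin_node_halfs:
  "valid G D \<Longrightarrow> map (origin G) (node_halfs G D) = concat (map (replicate 3) (node_verts G D))"
proof (induction D)
  case (Nd h l r)
  have "rt l \<in> star G (origin G (opp G h))" "rt r \<in> star G (origin G (opp G h))"
    using Nd.prems by (simp_all del: mem_star)
  then show ?case using Nd by (simp add: numeral_3_eq_3)
qed simp

lemma length_node_halfs: "length (node_halfs G D) = 3 * length (node_verts G D)"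
  by (induction D) auto

lemma nth_concat_replicate:
  "i < k * length xs \<Longrightarrow> concat (map (replicate k) xs) ! i = xs ! (i div k)"
proof (induction xs arbitrary: i)
  case (Cons x xs)
  show ?case
  proof (cases "i < k")
    case True
    then show ?thesis by (simp add: nth_append)
  next
    case False
    then have "i - k < k * length xs" "k > 0" using Cons.prems by (auto intro: gr0I)
    moreover from this have "i div k = Suc ((i - k) div k)" using False by (simp add: le_div_geq)
    ultimately show ?thesis using Cons.IH[of "i - k"] False by (simp add: nth_append)
  qed
qed simp

lemma origin_nth_node_halfs:
  assumes "valid G D" "i < length (node_halfs G D)"
  shows "origin G (node_halfs G D ! i) = node_verts G D ! (i div 3)"
  using assms nth_concat_replicate[of i 3 "node_verts G D"]
  by (metis length_node_halfs map_origin_node_halfs nth_map)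

lemma distinct_node_halfs:
  "valid G D \<Longrightarrow> distinct (node_verts G D) \<Longrightarrow> distinct (node_halfs G D)"
proof (induction D)
  case (Nd h l r)
  let ?v = "origin G (opp G h)"
  have st: "origin G (rt l) = ?v" "origin G (rt r) = ?v"
    using Nd.prems(1) unfolding valid.simps by (metis insertI1 insertI2 mem_star)+
  have "set (node_halfs G l) \<inter> set (node_halfs G r) = {}"
    "x \<notin> set (node_halfs G l) \<union> set (node_halfs G r)" if "origin G x = ?v" for x
    using Nd.prems that by (auto simp: set_node_halfs)
  then show ?case using Nd st by auto
qed simp

lemma edge_halfs_opp:
  "finite_graph G \<Longrightarrow> valid G D \<Longrightarrow> x \<in> set (edge_halfs G D) \<Longrightarrow> opp G x \<in> set (edge_halfs G D)"
  by (induction D) (auto simp: finite_graphD)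

text \<open>Validity reads a graph only through the stars of the tree's own vertices. This locality
  is what lets moves inside one subtree leave its sibling intact.\<close>

lemma valid_frame:
  assumes "valid G D" "\<And>v. v \<in> set (node_verts G D) \<Longrightarrow> star G' v = star G v"
    and "halfs G' = halfs G" "opp G' = opp G" "finite_graph G"
  shows "valid G' D \<and> node_verts G' D = node_verts G D"
  using assms(1,2)
proof (induction D)
  case (Lf h)
  then show ?case using assms by simp
next
  case (Nd h l r)
  let ?v = "origin G (opp G h)"
  have "opp G h \<in> star G ?v" using Nd.prems finite_graphD[OF assms(5)] by simp
  also have "star G ?v = star G' ?v" using Nd.prems(2) by simp
  finally have "origin G' (opp G h) = ?v" by simp
  then show ?case using Nd assms by simp
qed

text \<open>The clauses are what an induction over \<open>tree_moves\<close> has to carry: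
  half-edges keep their names, and the root and the multiset of slots stay, so a rewritten subtree
  can be put back in place; all stars outside the subtree stay, so its sibling and its parent vertex
  are unaffected.\<close>

definition realizable :: "('h \<Rightarrow> 'a) \<Rightarrow> nat \<Rightarrow> ('v, 'h) lgraph \<Rightarrow> 'h dtree \<Rightarrow> 'a btree \<Rightarrow> bool" where
  "realizable \<mu> n G D u \<longleftrightarrow> (\<exists>G' D' k. k \<le> n \<and> (whitehead_move ^^ k) G G' \<and>
     verts G' = verts G \<and> halfs G' = halfs G \<and> opp G' = opp G \<and> label G' = label G \<and>
     valid G' D' \<and> distinct (node_verts G' D') \<and> set (node_verts G' D') = set (node_verts G D) \<and>
     rt D' = rt D \<and> mset (slots D') = mset (slots D) \<and> shape \<mu> D' = u \<and>
     (\<forall>v. v \<notin> set (node_verts G D) \<longrightarrow> star G' v = star G v))"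

text \<open>A rotation is the Whitehead move at the edge of \<open>k\<close> that exchanges the
  roots of \<open>l\<close> and \<open>c\<close>: the upper vertex trades \<open>c\<close> for
  \<open>l\<close>, the lower one \<open>l\<close> for \<open>c\<close>. The two vertices differ
  because \<open>node_verts\<close> is distinct, so the edge is no loop.\<close>

lemma realizable_rot:
  assumes T: "trivalent_graph g p G" and val: "valid G (Nd h (Nd k l r) c)"
    and dis: "distinct (node_verts G (Nd h (Nd k l r) c))"
  shows "realizable \<mu> 1 G (Nd h (Nd k l r) c) (shape \<mu> (Nd h l (Nd k r c)))"
proof -
  note fin = trivalentD(1)[OF T]
  let ?v = "origin G (opp G h)" and ?w = "origin G (opp G k)"
  let ?s = "rt c" and ?t = "rt l"
  let ?G = "swap G ?s ?t" and ?D = "Nd h l (Nd k r c)"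
  have sv: "star G ?v = {opp G h, k, ?s}" "distinct [opp G h, k, ?s]"
    and sw: "star G ?w = {opp G k, ?t, rt r}" "distinct [opp G k, ?t, rt r]"
    and vlrc: "valid G l" "valid G r" "valid G c" and hk: "h \<in> halfs G" "k \<in> halfs G"
    using val by auto
  have vw: "?v \<noteq> ?w" using dis by auto
  have mem: "\<And>x. x \<in> {opp G h, k, ?s} \<Longrightarrow> x \<in> halfs G \<and> origin G x = ?v"
    using sv(1) by (metis mem_star)
  have mem': "\<And>x. x \<in> {opp G k, ?t, rt r} \<Longrightarrow> x \<in> halfs G \<and> origin G x = ?w"
    using sw(1) by (metis mem_star)
  have m: "opp G h \<in> halfs G" "k \<in> halfs G" "?s \<in> halfs G" "opp G k \<in> halfs G" "?t \<in> halfs G" "rt r \<in> halfs G"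
    "origin G k = ?v" "origin G ?s = ?v" "origin G ?t = ?w" "origin G (rt r) = ?w"
    using mem mem' by blast+
  have ne: "opp G h \<noteq> ?t" "k \<noteq> ?t" "?s \<noteq> ?t" "opp G k \<noteq> ?s" "rt r \<noteq> ?s"
    using m vw by metis+
  have "card (star G ?v) = 3" "card (star G ?w) = 3"
    unfolding sv(1) sw(1) using sv(2) sw(2) by auto
  then have piv: "pivot G k ?s ?t"
    unfolding pivot_def valence_def using m vw sv(2) sw(2) by auto
  have st: "star ?G x = transpose ?s ?t ` star G x" for x by (rule star_swap) (use m in auto)
  have sv': "star ?G ?v = {opp G h, k, ?t}"
    unfolding st sv(1) using sv(2) ne by auto
  have sw': "star ?G ?w = {opp G k, rt r, ?s}"
    unfolding st sw(1) using sw(2) ne by (auto simp: insert_commute)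
  have so: "star ?G x = star G x" if "x \<noteq> ?v" "x \<noteq> ?w" for x
  proof -
    have "?s \<notin> star G x" "?t \<notin> star G x" using that m by auto
    then have "transpose ?s ?t y = y" if "y \<in> star G x" for y
      using that by (metis transpose_apply_other)
    then show ?thesis unfolding st by auto
  qed
  have fr: "valid ?G d \<and> node_verts ?G d = node_verts G d" if "d \<in> {l, r, c}" for d
  proof (rule valid_frame[OF _ _ _ _ fin])
    show "valid G d" using that vlrc by auto
    show "star ?G x = star G x" if "x \<in> set (node_verts G d)" for x
      using so[of x] that dis \<open>d \<in> {l, r, c}\<close> by auto
  qed auto
  have oh: "origin ?G (opp G h) = ?v" and ok: "origin ?G (opp G k) = ?w"
    using sv(2) sw(2) ne by (auto simp: pivot_swap[OF piv])
  have "valid ?G ?D"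
    using hk sv(2) sw(2) ne fr sv' sw' oh ok vlrc by (auto simp del: swap_simps(5))
  moreover have nv: "node_verts ?G ?D = ?v # node_verts G l @ ?w # node_verts G r @ node_verts G c"
    using fr oh ok by (simp del: swap_simps(5))
  have "distinct (node_verts ?G ?D)" unfolding nv using dis by auto
  moreover have "set (node_verts ?G ?D) = set (node_verts G (Nd h (Nd k l r) c))"
    unfolding nv by auto
  moreover have "whitehead_move G ?G" using piv whitehead_move_iff[OF fin] by blast
  moreover have "mset (slots ?D) = mset (slots (Nd h (Nd k l r) c))" by simp
  moreover have "\<forall>x. x \<notin> set (node_verts G (Nd h (Nd k l r) c)) \<longrightarrow> star ?G x = star G x"
    using so by auto
  ultimately show ?thesis
    unfolding realizable_def
    by (intro exI[of _ ?G] exI[of _ ?D] exI[of _ 1] conjI)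
       (assumption | rule swap_simps order_refl refl | simp only: rt.simps relpowp_1)+
qed

lemma realizable_tree_moves:
  assumes "tree_moves n t u" "trivalent_graph g p G" "valid G D" "distinct (node_verts G D)"
    and "shape \<mu> D = t"
  shows "realizable \<mu> n G D u"
  using assms
proof (induction arbitrary: G D rule: tree_moves.induct)
  case (tree_moves_refl t)
  then show ?case unfolding realizable_def
    by (intro exI[of _ G] exI[of _ D] exI[of _ 0]) auto
next
  case (tree_moves_comm a b)
  then obtain h l r where D: "D = Nd h l r" by (cases D) auto
  \<comment> \<open>Zero moves: \<open>valid\<close> compares the star with a set, so the tree with
    exchanged children is valid in the same graph.\<close>
  show ?case unfolding realizable_def
    by (intro exI[of _ G] exI[of _ "Nd h r l"] exI[of _ 0])
       (use tree_moves_comm D in \<open>auto simp: insert_commute\<close>)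
next
  case (tree_moves_rot a b c)
  from tree_moves_rot.prems(4) obtain h l r d where D: "D = Nd h l d" "shape \<mu> l = Node a b" "shape \<mu> d = c"
    by (cases D) auto
  then obtain k l' r' where l: "l = Nd k l' r'" "shape \<mu> l' = a" "shape \<mu> r' = b"
    by (cases l) auto
  show ?case
    using realizable_rot[OF tree_moves_rot.prems(1), of h k l' r' d \<mu>] tree_moves_rot.prems D l by simp
next
  case (tree_moves_trans m t u n w)
  from tree_moves_trans.IH(1)[OF tree_moves_trans.prems] obtain G' D' k where
    1: "k \<le> m" "(whitehead_move ^^ k) G G'"
     "verts G' = verts G" "halfs G' = halfs G" "opp G' = opp G" "label G' = label G"
     "valid G' D'" "distinct (node_verts G' D')" "set (node_verts G' D') = set (node_verts G D)"
     "rt D' = rt D" "mset (slots D') = mset (slots D)" "shape \<mu> D' = u"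
     "\<forall>v. v \<notin> set (node_verts G D) \<longrightarrow> star G' v = star G v"
    unfolding realizable_def by (elim exE conjE) (rule that; assumption)
  have T': "trivalent_graph g p G'"
    using trivalent_graph_whitehead_relpowp[OF 1(2) tree_moves_trans.prems(1)] .
  from tree_moves_trans.IH(2)[OF T' 1(7,8,12)] obtain G'' D'' j where
    2: "j \<le> n" "(whitehead_move ^^ j) G' G''"
     "verts G'' = verts G'" "halfs G'' = halfs G'" "opp G'' = opp G'" "label G'' = label G'"
     "valid G'' D''" "distinct (node_verts G'' D'')" "set (node_verts G'' D'') = set (node_verts G' D')"
     "rt D'' = rt D'" "mset (slots D'') = mset (slots D')" "shape \<mu> D'' = w"
     "\<forall>v. v \<notin> set (node_verts G' D') \<longrightarrow> star G'' v = star G' v"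
    unfolding realizable_def by (elim exE conjE) (rule that; assumption)
  have "(whitehead_move ^^ (k + j)) G G''" using 1(2) 2(2) by (metis relcomppI relpowp_add)
  then show ?case unfolding realizable_def
    by (intro exI[of _ G''] exI[of _ D''] exI[of _ "k + j"]) (use 1 2 in simp)
next
  case (tree_moves_congL n a a' b)
  from tree_moves_congL.prems(4) obtain h l r where D: "D = Nd h l r" "shape \<mu> l = a" "shape \<mu> r = b"
    by (cases D) auto
  note fin = trivalentD(1)[OF tree_moves_congL.prems(1)]
  have vl: "valid G l" "valid G r" and dl: "distinct (node_verts G l)"
    using tree_moves_congL.prems(2,3) D by auto
  from tree_moves_congL.IH[OF tree_moves_congL.prems(1) vl(1) dl D(2)] obtain G' l' k where
    1: "k \<le> n" "(whitehead_move ^^ k) G G'"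
     "verts G' = verts G" "halfs G' = halfs G" "opp G' = opp G" "label G' = label G"
     "valid G' l'" "distinct (node_verts G' l')" "set (node_verts G' l') = set (node_verts G l)"
     "rt l' = rt l" "mset (slots l') = mset (slots l)" "shape \<mu> l' = a'"
     "\<forall>v. v \<notin> set (node_verts G l) \<longrightarrow> star G' v = star G v"
    unfolding realizable_def by (elim exE conjE) (rule that; assumption)
  let ?v = "origin G (opp G h)"
  have dis: "?v \<notin> set (node_verts G l)" "set (node_verts G l) \<inter> set (node_verts G r) = {}"
    using tree_moves_congL.prems(3) D by auto
  have fr: "valid G' r \<and> node_verts G' r = node_verts G r"
    by (rule valid_frame[OF vl(2) _ 1(4,5) fin]) (use 1(13) dis in auto)
  have sv: "star G' ?v = star G ?v" using 1(13) dis by blast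
  have "opp G h \<in> star G ?v" using tree_moves_congL.prems(2) D finite_graphD[OF fin] by simp
  then have "opp G h \<in> star G' ?v" using sv by blast
  then have ov: "origin G' (opp G h) = ?v" by simp
  have "valid G' (Nd h l' r)"
    using tree_moves_congL.prems(2) D 1 fr sv ov by simp
  moreover have "node_verts G' (Nd h l' r) = ?v # node_verts G' l' @ node_verts G r"
    using fr ov 1(5) by simp
  ultimately show ?case unfolding realizable_def
    by (intro exI[of _ G'] exI[of _ "Nd h l' r"] exI[of _ k])
       (use 1 tree_moves_congL.prems(3) D in auto)
qed

subsection \<open>Labelled spanning trees\<close>

definition trivalent_verts :: "('v, 'h) lgraph \<Rightarrow> 'v set" where
  "trivalent_verts G = {v \<in> verts G. valence G v = 3}"

text \<open>The tree is entered by crossing the edge of \<open>s\<close>, so \<open>s\<close> lies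
  at its top vertex and acts as one more slot; this is why \<open>s # slots D\<close> occurs
  throughout. Only trivalent vertices are spanned, the leaves hang at slots.\<close>

definition spanning :: "('v, 'h) lgraph \<Rightarrow> 'h \<Rightarrow> 'h dtree \<Rightarrow> bool" where
  "spanning G s D \<longleftrightarrow> valid G D \<and> rt D = opp G s \<and> s \<in> halfs G \<and>
     distinct (node_verts G D) \<and> set (node_verts G D) = trivalent_verts G"

text \<open>
  Slots leading to leaves carry the labels \<open>1, \<dots>, p\<close> of these, the two halves of a cut edge
  carry labels \<open>p + 2 i + 1, p + 2 i + 2\<close>.
\<close>

definition mate :: "nat \<Rightarrow> nat \<Rightarrow> nat" where
  "mate p y = (if odd (y - p) then y + 1 else y - 1)"

definition slot_labelling :: "nat \<Rightarrow> nat \<Rightarrow> ('v, 'h) lgraph \<Rightarrow> 'h set \<Rightarrow> ('h \<Rightarrow> nat) \<Rightarrow> bool" where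
  "slot_labelling g p G S \<mu> \<longleftrightarrow> bij_betw \<mu> S {1..p + 2 * g} \<and>
     (\<forall>x\<in>S. if \<mu> x \<le> p then origin G (opp G x) \<in> leaves G \<and> label G (origin G (opp G x)) = \<mu> x
            else opp G x \<in> S \<and> \<mu> (opp G x) = mate p (\<mu> x))"

text \<open>Normalising the label of \<open>s\<close> to 1 fixes the root, so that the trees of all
  graphs of one type have the same leaf set \<open>{2..p + 2 * g}\<close>.\<close>

definition presents :: "nat \<Rightarrow> nat \<Rightarrow> ('v, 'h) lgraph \<Rightarrow> 'h \<Rightarrow> 'h dtree \<Rightarrow> ('h \<Rightarrow> nat) \<Rightarrow> bool" where
  "presents g p G s D \<mu> \<longleftrightarrow>
     spanning G s D \<and> slot_labelling g p G (set (s # slots D)) \<mu> \<and> \<mu> s = 1"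

lemma leaf_not_trivalent: "v \<in> leaves G \<Longrightarrow> v \<notin> trivalent_verts G"
  by (auto simp: leaves_def trivalent_verts_def)

lemma leaf_half_unique:
  assumes "v \<in> leaves G" "x \<in> halfs G" "y \<in> halfs G" "origin G x = v" "origin G y = v"
  shows "x = y"
proof -
  obtain k where "star G v = {k}"
    using assms(1) unfolding leaves_def valence_def by (auto simp: card_1_singleton_iff)
  then show ?thesis using assms by (metis mem_star singletonD)
qed

lemma trivalent_cases:
  "trivalent_graph g p G \<Longrightarrow> v \<in> verts G \<Longrightarrow> v \<in> leaves G \<or> v \<in> trivalent_verts G"
  by (auto simp: leaves_def trivalent_verts_def dest: trivalentD(4))

lemma card_trivalent_verts:
  "trivalent_graph g p G \<Longrightarrow> int (card (trivalent_verts G)) = 2 * int g - 2 + int p"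
  unfolding trivalent_verts_def by (rule trivalentD(5))

subsection \<open>A graph is determined by its labelled spanning tree\<close>

text \<open>Zipping two enumerations of half-edges produces a relation rather than a function, hence
  this interface. The map on vertices is induced: \<open>orig\<close> makes it well defined and
  injective, and as every vertex carries a half-edge, it is defined everywhere and onto.\<close>

lemma isomorphic_of_rel:
  fixes G :: "('v, 'h) lgraph" and G' :: "('w, 'k) lgraph"
  assumes fin: "finite_graph G" "finite_graph G'"
    and sub: "E \<subseteq> halfs G \<times> halfs G'"
    and tot: "\<And>x. x \<in> halfs G \<Longrightarrow> \<exists>x'. (x, x') \<in> E" "\<And>x'. x' \<in> halfs G' \<Longrightarrow> \<exists>x. (x, x') \<in> E"
    and eq: "\<And>x x' y y'. (x, x') \<in> E \<Longrightarrow> (y, y') \<in> E \<Longrightarrow> x = y \<longleftrightarrow> x' = y'"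
    and orig: "\<And>x x' y y'. (x, x') \<in> E \<Longrightarrow> (y, y') \<in> E \<Longrightarrow>
        origin G x = origin G y \<longleftrightarrow> origin G' x' = origin G' y'"
    and op: "\<And>x x'. (x, x') \<in> E \<Longrightarrow> (opp G x, opp G' x') \<in> E"
    and ne: "\<And>v. v \<in> verts G \<Longrightarrow> star G v \<noteq> {}" "\<And>v. v \<in> verts G' \<Longrightarrow> star G' v \<noteq> {}"
    and lab: "\<And>x x'. (x, x') \<in> E \<Longrightarrow> origin G x \<in> leaves G \<Longrightarrow>
        label G' (origin G' x') = label G (origin G x)"
  shows "isomorphic G G'"
proof -
  obtain \<phi> where phi: "\<And>x. x \<in> halfs G \<Longrightarrow> (x, \<phi> x) \<in> E" using tot(1) by metis
  obtain k where k: "\<And>v. v \<in> verts G \<Longrightarrow> k v \<in> halfs G \<and> origin G (k v) = v"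
  proof (rule that[of "\<lambda>v. SOME h. h \<in> star G v"])
    fix v assume "v \<in> verts G"
    then have "(SOME h. h \<in> star G v) \<in> star G v" using ne(1) by (intro some_in_eq[THEN iffD2])
    then show "(SOME h. h \<in> star G v) \<in> halfs G \<and> origin G (SOME h. h \<in> star G v) = v" by simp
  qed
  define f where "f v = origin G' (\<phi> (k v))" for v
  have mem: "\<phi> x \<in> halfs G'" if "x \<in> halfs G" for x using phi[OF that] sub by blast
  have f: "f (origin G x) = origin G' (\<phi> x)" if x: "x \<in> halfs G" for x
  proof -
    have v: "origin G x \<in> verts G" using finite_graphD[OF fin(1) x] by simp
    show ?thesis unfolding f_def using orig[OF phi phi[OF x], of "k (origin G x)"] k[OF v] by simp
  qed
  have surj: "\<exists>x\<in>halfs G. \<phi> x = x'" if x': "x' \<in> halfs G'" for x'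
  proof -
    obtain x where x: "(x, x') \<in> E" using tot(2) x' by blast
    then have "x \<in> halfs G" using sub by blast
    then show ?thesis using eq[OF x phi] by blast
  qed
  have "bij_betw \<phi> (halfs G) (halfs G')"
    unfolding bij_betw_def inj_on_def using eq[OF phi phi] surj mem by (auto simp: image_iff) metis
  moreover have "bij_betw f (verts G) (verts G')"
    unfolding bij_betw_def
  proof
    show "inj_on f (verts G)"
    proof (rule inj_onI)
      fix u v assume uv: "u \<in> verts G" "v \<in> verts G" "f u = f v"
      then show "u = v" using orig[OF phi phi, of "k u" "k v"] k[OF uv(1)] k[OF uv(2)] by (simp add: f_def)
    qed
    show "f ` verts G = verts G'"
    proof
      show "f ` verts G \<subseteq> verts G'" using k mem finite_graphD(1)[OF fin(2)] by (auto simp: f_def)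
      show "verts G' \<subseteq> f ` verts G"
      proof
        fix v assume "v \<in> verts G'"
        then obtain y where y: "y \<in> halfs G'" "origin G' y = v" using ne(2) by (metis all_not_in_conv mem_star)
        then obtain x where "x \<in> halfs G" "\<phi> x = y" using surj by blast
        then show "v \<in> f ` verts G" using f y(2) finite_graphD(1)[OF fin(1)] by (metis imageI)
      qed
    qed
  qed
  moreover have "opp G' (\<phi> x) = \<phi> (opp G x)" if x: "x \<in> halfs G" for x
    using eq[OF op[OF phi[OF x]] phi[OF finite_graphD(2)[OF fin(1) x]]] by simp
  moreover have "label G' (f v) = label G v" if "v \<in> leaves G" for v
  proof -
    have v: "v \<in> verts G" using that by (simp add: leaves_def)
    show ?thesis unfolding f_def using lab[OF phi, of "k v"] k[OF v] that by simp
  qed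
  ultimately show ?thesis
    unfolding isomorphic_def using f by (intro exI[of _ f] exI[of _ \<phi>]) simp
qed

lemma shape_eq_lengths:
  assumes "shape \<mu> D = shape \<mu>' D'"
  shows "map \<mu> (slots D) = map \<mu>' (slots D')" "length (slots D) = length (slots D')"
    "length (node_halfs G D) = length (node_halfs G' D')"
proof -
  show 1: "map \<mu> (slots D) = map \<mu>' (slots D')" using assms by (metis leaf_list_shape)
  show 2: "length (slots D) = length (slots D')" using 1 by (metis length_map)
  show "length (node_halfs G D) = length (node_halfs G' D')"
    using 2 length_slots[of D G] length_slots[of D' G'] by (simp add: length_node_halfs)
qed

lemma zip_total:
  assumes "length xs = length ys"
  shows "x \<in> set xs \<Longrightarrow> \<exists>y. (x, y) \<in> set (zip xs ys)"
    "y \<in> set ys \<Longrightarrow> \<exists>x. (x, y) \<in> set (zip xs ys)"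
  using assms by (auto simp: in_set_conv_nth set_zip)

text \<open>Equal shapes put slots at matching positions among the half-edges. A bare slot
  \<open>Lf h\<close> has no vertex of its own, so its root pair has to be added; one level up it is
  absorbed as the root of a child.\<close>

lemma zip_slots_subset:
  assumes "shape \<mu> D = shape \<mu>' D'" "(x, x') \<in> set (zip (slots D) (slots D'))"
  shows "(x, x') \<in> set (zip (rt D # node_halfs G D) (rt D' # node_halfs G' D')) \<and>
    (D \<noteq> Lf (rt D) \<longrightarrow> (x, x') \<in> set (zip (node_halfs G D) (node_halfs G' D')))"
  using assms
proof (induction D arbitrary: D')
  case (Lf h)
  then obtain h' where "D' = Lf h'" by (cases D') auto
  then show ?case using Lf by simp
next
  case (Nd h l r)
  then obtain h' l' r' where D': "D' = Nd h' l' r'" by (cases D') auto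
  have sh: "shape \<mu> l = shape \<mu>' l'" "shape \<mu> r = shape \<mu>' r'" using Nd.prems D' by auto
  have "(x, x') \<in> set (zip (slots l) (slots l')) \<union> set (zip (slots r) (slots r'))"
    using Nd.prems(2) D' shape_eq_lengths(2)[OF sh(1)] by simp
  then have "(x, x') \<in> set (zip (rt l # node_halfs G l) (rt l' # node_halfs G' l')) \<union>
      set (zip (rt r # node_halfs G r) (rt r' # node_halfs G' r'))"
    using Nd.IH sh by blast
  then show ?case using D' shape_eq_lengths(3)[OF sh(1), of G G'] by auto
qed

text \<open>Across an inner tree edge, matched half-edges have matched partners. The exceptions are
  the top half-edge, whose edge leaves the tree at the root, and the slots, whose edges are cut; for
  these the labels have to decide.\<close>

lemma zip_node_halfs_opp:
  assumes "finite_graph G" "finite_graph G'" "valid G D" "valid G' D'"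
    and "shape \<mu> D = shape \<mu>' D'" "(x, x') \<in> set (zip (node_halfs G D) (node_halfs G' D'))"
  shows "(x, x') = (opp G (rt D), opp G' (rt D')) \<or> (x, x') \<in> set (zip (slots D) (slots D')) \<or>
    (opp G x, opp G' x') \<in> set (zip (node_halfs G D) (node_halfs G' D'))"
  using assms(3-)
proof (induction D arbitrary: D')
  case (Nd h l r)
  then obtain h' l' r' where D': "D' = Nd h' l' r'" by (cases D') auto
  have sh: "shape \<mu> l = shape \<mu>' l'" "shape \<mu> r = shape \<mu>' r'" using Nd.prems D' by auto
  have val: "valid G l" "valid G r" "valid G' l'" "valid G' r'" using Nd.prems D' by auto
  let ?Z = "set (zip (node_halfs G (Nd h l r)) (node_halfs G' D'))"
  have Z: "?Z = {(opp G h, opp G' h'), (rt l, rt l'), (rt r, rt r')} \<union>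
      set (zip (node_halfs G l) (node_halfs G' l')) \<union> set (zip (node_halfs G r) (node_halfs G' r'))"
    using D' shape_eq_lengths(3)[OF sh(1), of G G'] by auto
  have S: "set (zip (slots (Nd h l r)) (slots D')) =
      set (zip (slots l) (slots l')) \<union> set (zip (slots r) (slots r'))"
    using D' shape_eq_lengths(2)[OF sh(1)] by simp
  have root: "(rt d, rt d') \<in> set (zip (slots d) (slots d')) \<or>
      (opp G (rt d), opp G' (rt d')) \<in> set (zip (node_halfs G d) (node_halfs G' d'))"
    if "shape \<mu> d = shape \<mu>' d'" for d d'
    using that by (cases d; cases d') auto
  have invol: "opp G (opp G (rt d)) = rt d" "opp G' (opp G' (rt d')) = rt d'"
    if "valid G d" "valid G' d'" for d d'
    using that finite_graphD(4)[OF assms(1)] finite_graphD(4)[OF assms(2)] valid_rt by metis+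
  from Nd.prems(4)[unfolded Z] consider "(x, x') = (opp G h, opp G' h')"
    | "(x, x') = (rt l, rt l')" | "(x, x') = (rt r, rt r')"
    | "(x, x') \<in> set (zip (node_halfs G l) (node_halfs G' l'))"
    | "(x, x') \<in> set (zip (node_halfs G r) (node_halfs G' r'))" by blast
  then show ?case
  proof cases
    case 1
    then show ?thesis using D' by simp
  next
    case 2
    then show ?thesis using root[OF sh(1)] unfolding S Z by auto
  next
    case 3
    then show ?thesis using root[OF sh(2)] unfolding S Z by auto
  next
    case 4
    from Nd.IH(1)[OF val(1,3) sh(1) 4] show ?thesis unfolding S Z using invol[OF val(1,3)] by auto
  next
    case 5
    from Nd.IH(2)[OF val(2,4) sh(2) 5] show ?thesis unfolding S Z using invol[OF val(2,4)] by auto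
  qed
qed simp

lemma spanning_Nd:
  assumes "spanning G s D" "trivalent_verts G \<noteq> {}" "finite_graph G"
  obtains l r where "D = Nd (opp G s) l r" "hd (node_halfs G D) = s"
    "mset (node_halfs G D) = mset (s # slots D) + mset (edge_halfs G l @ edge_halfs G r)"
proof -
  obtain h l r where D: "D = Nd h l r"
    using assms by (cases D) (auto simp: spanning_def)
  have h: "h = opp G s" "opp G (opp G s) = s"
    using assms D finite_graphD[OF assms(3)] by (auto simp: spanning_def)
  \<comment> \<open>The root edge contributes \<open>opp G s\<close> and \<open>s\<close>;
    cancelling the root half-edge \<open>opp G s\<close> leaves \<open>s\<close> among the
    slots.\<close>
  have "mset (node_halfs G D) = mset (s # slots D) + mset (edge_halfs G l @ edge_halfs G r)"
    using mset_node_halfs[of D G] D h by simp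
  then show ?thesis using that[of l r] D h by simp
qed

lemma spanning_set_node_halfs:
  assumes "spanning G s D"
  shows "set (node_halfs G D) = {x \<in> halfs G. origin G x \<in> trivalent_verts G}"
  using assms set_node_halfs by (auto simp: spanning_def)

text \<open>The half-edges at tree vertices are the disjoint union of slots and halves of inner
  edges, and \<open>opp\<close> preserves the latter; so the partner of a slot is again a slot
  unless it lies outside the tree. A binary tree has one more end than inner nodes, and the root
  adds another.\<close>

lemma spanning_slots:
  assumes "spanning G s D" "trivalent_verts G \<noteq> {}" "finite_graph G"
  shows "distinct (s # slots D)" "length (s # slots D) = card (trivalent_verts G) + 2"
    "x \<in> set (s # slots D) \<Longrightarrow> x \<in> set (node_halfs G D)"
    "x \<in> set (node_halfs G D) \<Longrightarrow> opp G x \<in> set (node_halfs G D) \<or> x \<in> set (s # slots D)"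
    "x \<in> set (s # slots D) \<Longrightarrow> opp G x \<in> set (node_halfs G D) \<Longrightarrow> opp G x \<in> set (s # slots D)"
proof -
  obtain l r where D: "D = Nd (opp G s) l r" "hd (node_halfs G D) = s"
    "mset (node_halfs G D) = mset (s # slots D) + mset (edge_halfs G l @ edge_halfs G r)"
    by (rule spanning_Nd[OF assms])
  have dn: "distinct (node_halfs G D)" and val: "valid G l" "valid G r"
    using assms(1) D(1) distinct_node_halfs[of G D] by (auto simp: spanning_def)
  have "mset (node_halfs G D) = mset ((s # slots D) @ edge_halfs G l @ edge_halfs G r)"
    using D(3) by simp
  then have d: "distinct ((s # slots D) @ edge_halfs G l @ edge_halfs G r)"
    and set: "set (node_halfs G D) = set (s # slots D) \<union> (set (edge_halfs G l) \<union> set (edge_halfs G r))"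
    using dn by (metis mset_eq_imp_distinct_iff, metis mset_eq_setD set_append)
  show "distinct (s # slots D)" using d by simp
  show "length (s # slots D) = card (trivalent_verts G) + 2"
    using assms(1) length_slots[of D G] by (simp add: spanning_def flip: distinct_card)
  show "x \<in> set (s # slots D) \<Longrightarrow> x \<in> set (node_halfs G D)" using set by blast
  have cl: "opp G y \<in> set (edge_halfs G l) \<union> set (edge_halfs G r)"
    if "y \<in> set (edge_halfs G l) \<union> set (edge_halfs G r)" for y
    using that edge_halfs_opp[OF assms(3)] val by blast
  show "x \<in> set (node_halfs G D) \<Longrightarrow> opp G x \<in> set (node_halfs G D) \<or> x \<in> set (s # slots D)"
    using set cl by blast
  show "opp G x \<in> set (s # slots D)" if x: "x \<in> set (s # slots D)" "opp G x \<in> set (node_halfs G D)"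
  proof (rule ccontr)
    assume "opp G x \<notin> set (s # slots D)"
    then have "opp G (opp G x) \<in> set (edge_halfs G l) \<union> set (edge_halfs G r)"
      using set x(2) cl by blast
    moreover have "x \<in> halfs G"
      using set x(1) spanning_set_node_halfs[OF assms(1)] by blast
    ultimately have "x \<in> set (edge_halfs G l) \<union> set (edge_halfs G r)"
      using finite_graphD(4)[OF assms(3)] by simp
    then show False using d x(1) by auto
  qed
qed

lemma presents_leaf_half:
  assumes T: "trivalent_graph g p G" and P: "presents g p G s D \<mu>"
    and h: "h \<in> halfs G" "origin G h \<in> leaves G"
    and ne: "trivalent_verts G \<noteq> {}"
  shows "\<exists>x \<in> set (s # slots D). \<mu> x \<le> p \<and> h = opp G x"
proof -
  note P' = P[unfolded presents_def slot_labelling_def]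
  have labb: "bij_betw (label G) (leaves G) {1..p}" using trivalentD(6)[OF T] .
  then have lb: "label G (origin G h) \<in> {1..p}" using h by (auto simp: bij_betw_def)
  then have "label G (origin G h) \<in> {1..p + 2 * g}" by auto
  then have "label G (origin G h) \<in> \<mu> ` set (s # slots D)"
    using P' by (metis bij_betw_def)
  then obtain x where x: "x \<in> set (s # slots D)" "\<mu> x = label G (origin G h)" by force
  have "x \<in> halfs G"
    using spanning_slots(3)[OF _ ne trivalentD(1)[OF T] x(1)] spanning_set_node_halfs[of G s D] P' by blast
  then have ox: "opp G x \<in> halfs G" using finite_graphD(2)[OF trivalentD(1)[OF T]] by blast
  have R: "if \<mu> y \<le> p then origin G (opp G y) \<in> leaves G \<and> label G (origin G (opp G y)) = \<mu> y
            else opp G y \<in> set (s # slots D) \<and> \<mu> (opp G y) = mate p (\<mu> y)" if "y \<in> set (s # slots D)" for y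
    using P that by (auto simp: presents_def slot_labelling_def)
  have "\<mu> x \<le> p" using x(2) lb by simp
  then have ol: "origin G (opp G x) \<in> leaves G" "label G (origin G (opp G x)) = \<mu> x"
    using R[OF x(1)] by simp_all
  have "label G (origin G (opp G x)) = label G (origin G h)" using ol(2) x(2) by simp
  then have "origin G (opp G x) = origin G h"
    by (rule inj_onD[OF bij_betw_imp_inj_on[OF labb] _ ol(1) h(2)])
  then have "h = opp G x" using leaf_half_unique[OF h(2,1) ox] by simp
  then show ?thesis using x(1) \<open>\<mu> x \<le> p\<close> by blast
qed

lemma star_nonempty:
  assumes "trivalent_graph g p G" "v \<in> verts G"
  shows "star G v \<noteq> {}"
  using trivalentD(4)[OF assms] unfolding valence_def by (auto simp del: mem_star)

text \<open>Half-edges at trivalent vertices are matched by position (\<open>N\<close>), those at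
  leaves as partners of slots with label at most \<open>p\<close> (added in \<open>E\<close>).
  Positions respect vertices and tree edges, labels respect cut edges and leaves; so the labelled
  shape reconstructs the graph.\<close>

lemma presents_isomorphic:
  fixes G :: "('v, 'h) lgraph" and G' :: "('w, 'k) lgraph"
  assumes T: "trivalent_graph g p G" "trivalent_graph g p G'" and pos: "2 * int g - 2 + int p > 0"
    and P: "presents g p G s D \<mu>" and P': "presents g p G' s' D' \<mu>'"
    and sh: "shape \<mu> D = shape \<mu>' D'"
  shows "isomorphic G G'"
proof -
  note fin = trivalentD(1)[OF T(1)] trivalentD(1)[OF T(2)]
  have ne: "trivalent_verts G \<noteq> {}" "trivalent_verts G' \<noteq> {}"
    using card_trivalent_verts[OF T(1)] card_trivalent_verts[OF T(2)] pos by auto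
  define L L' where "L = s # slots D" and "L' = s' # slots D'"
  have sp: "spanning G s D" "spanning G' s' D'" and val: "valid G D" "valid G' D'"
    and rt: "rt D = opp G s" "rt D' = opp G' s'"
    and dv: "distinct (node_verts G D)" "distinct (node_verts G' D')"
    and mu: "\<mu> s = 1" "\<mu>' s' = 1" and bij: "bij_betw \<mu> (set L) {1..p + 2 * g}" "bij_betw \<mu>' (set L') {1..p + 2 * g}"
    using P P' by (auto simp: presents_def spanning_def slot_labelling_def L_def L'_def)
  have rule: "if \<mu> x \<le> p then origin G (opp G x) \<in> leaves G \<and> label G (origin G (opp G x)) = \<mu> x
            else opp G x \<in> set L \<and> \<mu> (opp G x) = mate p (\<mu> x)" if "x \<in> set L" for x
    using P that by (auto simp: presents_def slot_labelling_def L_def)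
  have rule': "if \<mu>' x \<le> p then origin G' (opp G' x) \<in> leaves G' \<and> label G' (origin G' (opp G' x)) = \<mu>' x
            else opp G' x \<in> set L' \<and> \<mu>' (opp G' x) = mate p (\<mu>' x)" if "x \<in> set L'" for x
    using P' that by (auto simp: presents_def slot_labelling_def L'_def)
  obtain l r l' r' where D: "D = Nd (opp G s) l r" and D': "D' = Nd (opp G' s') l' r'"
    using spanning_Nd[OF sp(1) ne(1) fin(1)] spanning_Nd[OF sp(2) ne(2) fin(2)] by metis
  have ss: "opp G (opp G s) = s" "opp G' (opp G' s') = s'"
    using sp finite_graphD(4)[OF fin(1)] finite_graphD(4)[OF fin(2)] by (auto simp: spanning_def)
  define N where "N = set (zip (node_halfs G D) (node_halfs G' D'))"
  define Z where "Z = set (zip L L')"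
  have len: "length (node_halfs G D) = length (node_halfs G' D')" "length L = length L'"
    using shape_eq_lengths(2)[OF sh] shape_eq_lengths(3)[OF sh, of G G'] by (simp_all add: L_def L'_def)
  have muL: "map \<mu> L = map \<mu>' L'" using shape_eq_lengths(1)[OF sh] mu by (simp add: L_def L'_def)
  have Zmu: "\<mu> x = \<mu>' x'" "x \<in> set L" "x' \<in> set L'" if z: "(x, x') \<in> Z" for x x'
  proof -
    obtain i where i: "i < length L" "x = L ! i" "x' = L' ! i" using z len by (auto simp: Z_def set_zip)
    then show "\<mu> x = \<mu>' x'" "x \<in> set L" "x' \<in> set L'" using muL len by (auto) (metis nth_map)
  qed
  have Zex: "\<exists>x'. (x, x') \<in> Z" if "x \<in> set L" for x
    using zip_total(1)[OF len(2) that] by (simp add: Z_def)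
  have Zex': "\<exists>x. (x, x') \<in> Z" if "x' \<in> set L'" for x'
    using zip_total(2)[OF len(2) that] by (simp add: Z_def)
  have inj: "x = y \<longleftrightarrow> \<mu> x = \<mu> y" if "x \<in> set L" "y \<in> set L" for x y
    using that bij(1) by (auto simp: bij_betw_def inj_on_def)
  have inj': "x = y \<longleftrightarrow> \<mu>' x = \<mu>' y" if "x \<in> set L'" "y \<in> set L'" for x y
    using that bij(2) by (auto simp: bij_betw_def inj_on_def)
  have Zeq: "x = y \<longleftrightarrow> x' = y'" if "(x, x') \<in> Z" "(y, y') \<in> Z" for x x' y y'
    using Zmu[OF that(1)] Zmu[OF that(2)] inj inj' by metis
  have ZN: "(x, x') \<in> N" if z: "(x, x') \<in> Z" for x x'
  proof -
    consider "x = s" "x' = s'" | "(x, x') \<in> set (zip (slots D) (slots D'))"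
      using z by (auto simp: Z_def L_def L'_def)
    then show ?thesis
    proof cases
      case 1
      then show ?thesis using D D' ss by (simp add: N_def)
    next
      case 2
      then show ?thesis using zip_slots_subset[OF sh 2, of G G'] D by (simp add: N_def)
    qed
  qed
  have Nh: "x \<in> halfs G" "x' \<in> halfs G'" "origin G x \<in> trivalent_verts G" "origin G' x' \<in> trivalent_verts G'"
    if "(x, x') \<in> N" for x x'
    using that set_zip_leftD[of x x'] set_zip_rightD[of x x']
      spanning_set_node_halfs[OF sp(1)] spanning_set_node_halfs[OF sp(2)] unfolding N_def by blast+
  define E where "E = N \<union> {(opp G x, opp G' x') | x x'. (x, x') \<in> Z \<and> \<mu> x \<le> p}"
  have leafE: "opp G x \<in> halfs G" "opp G' x' \<in> halfs G'" "opp G (opp G x) = x" "opp G' (opp G' x') = x'"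
      "origin G (opp G x) \<in> leaves G" "origin G' (opp G' x') \<in> leaves G'"
      "label G (origin G (opp G x)) = \<mu> x" "label G' (origin G' (opp G' x')) = \<mu> x"
    if "(x, x') \<in> Z" "\<mu> x \<le> p" for x x'
    using Nh[OF ZN[OF that(1)]] finite_graphD[OF fin(1)] finite_graphD[OF fin(2)] rule[of x] rule'[of x']
      Zmu[OF that(1)] that(2) by auto
  have ZE: "(opp G x, opp G' x') \<in> E" if z: "(x, x') \<in> Z" for x x'
  proof (cases "\<mu> x \<le> p")
    case True
    then show ?thesis using z by (auto simp: E_def)
  next
    case False
    have 1: "opp G x \<in> set L" "\<mu> (opp G x) = mate p (\<mu> x)" using rule[of x] False Zmu[OF z] by auto
    have 2: "opp G' x' \<in> set L'" "\<mu>' (opp G' x') = mate p (\<mu> x)" using rule'[of x'] False Zmu[OF z] by auto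
    \<comment> \<open>The edge is cut: the slot matched with \<open>opp G x\<close> carries the
      label \<open>mate p (\<mu> x)\<close>, and so does \<open>opp G' x'\<close>; labels are
      injective on slots.\<close>
    obtain z' where z': "(opp G x, z') \<in> Z" using Zex[OF 1(1)] by blast
    have "z' = opp G' x'" using inj'[OF Zmu(3)[OF z'] 2(1)] Zmu(1)[OF z'] 1 2 by simp
    then show ?thesis using ZN[OF z'] by (simp add: E_def)
  qed
  have Ecases: "(x, x') \<in> N \<or> (\<exists>y y'. (y, y') \<in> Z \<and> \<mu> y \<le> p \<and> x = opp G y \<and> x' = opp G' y')"
    if "(x, x') \<in> E" for x x' using that by (auto simp: E_def)
  have Nidx: "\<exists>i < length (node_halfs G D). x = node_halfs G D ! i \<and> x' = node_halfs G' D' ! i"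
    if "(x, x') \<in> N" for x x' using that len(1) by (auto simp: N_def set_zip)
  have N2: "(x = y \<longleftrightarrow> x' = y') \<and> (origin G x = origin G y \<longleftrightarrow> origin G' x' = origin G' y')"
    if xy: "(x, x') \<in> N" "(y, y') \<in> N" for x x' y y'
  proof -
    obtain i j where i: "i < length (node_halfs G D)" "x = node_halfs G D ! i" "x' = node_halfs G' D' ! i"
      and j: "j < length (node_halfs G D)" "y = node_halfs G D ! j" "y' = node_halfs G' D' ! j"
      using Nidx[OF xy(1)] Nidx[OF xy(2)] by blast
    have dn: "distinct (node_halfs G D)" "distinct (node_halfs G' D')"
      using distinct_node_halfs val dv by blast+
    have b: "i div 3 < length (node_verts G D)" "j div 3 < length (node_verts G D)"
      "length (node_verts G' D') = length (node_verts G D)"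
      using i j len(1) by (auto simp: length_node_halfs)
    have "origin G x = origin G y \<longleftrightarrow> i div 3 = j div 3"
      using origin_nth_node_halfs[OF val(1)] i j b dv(1) by (simp add: nth_eq_iff_index_eq)
    moreover have "origin G' x' = origin G' y' \<longleftrightarrow> i div 3 = j div 3"
      using origin_nth_node_halfs[OF val(2)] i j b dv(2) len(1) by (simp add: nth_eq_iff_index_eq)
    moreover have "x = y \<longleftrightarrow> i = j" "x' = y' \<longleftrightarrow> i = j"
      using dn i j len(1) by (simp_all add: nth_eq_iff_index_eq)
    ultimately show ?thesis by blast
  qed
  have inter: "trivalent_verts G \<inter> leaves G = {}" "trivalent_verts G' \<inter> leaves G' = {}"
    by (auto dest: leaf_not_trivalent)
  have L2: "(opp G x = opp G y \<longleftrightarrow> opp G' x' = opp G' y') \<and>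
      (origin G (opp G x) = origin G (opp G y) \<longleftrightarrow> origin G' (opp G' x') = origin G' (opp G' y'))"
    if xy: "(x, x') \<in> Z" "\<mu> x \<le> p" "(y, y') \<in> Z" "\<mu> y \<le> p" for x x' y y'
  proof -
    note lx = leafE[OF xy(1,2)] and ly = leafE[OF xy(3,4)]
    have li: "inj_on (label G) (leaves G)" "inj_on (label G') (leaves G')"
      using trivalentD(6)[OF T(1)] trivalentD(6)[OF T(2)] by (auto simp: bij_betw_def)
    have "origin G (opp G x) = origin G (opp G y) \<longleftrightarrow> \<mu> x = \<mu> y"
      using inj_on_eq_iff[OF li(1) lx(5) ly(5)] lx ly by simp
    moreover have "origin G' (opp G' x') = origin G' (opp G' y') \<longleftrightarrow> \<mu> x = \<mu> y"
      using inj_on_eq_iff[OF li(2) lx(6) ly(6)] lx ly by simp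
    moreover have "opp G x = opp G y \<longleftrightarrow> x = y" "opp G' x' = opp G' y' \<longleftrightarrow> x' = y'"
      using lx ly by metis+
    ultimately show ?thesis using Zeq[OF xy(1,3)] by blast
  qed
  have mixed: "x \<noteq> opp G y \<and> x' \<noteq> opp G' y' \<and> origin G x \<noteq> origin G (opp G y) \<and>
      origin G' x' \<noteq> origin G' (opp G' y')"
    if "(x, x') \<in> N" "(y, y') \<in> Z" "\<mu> y \<le> p" for x x' y y'
  proof -
    have "origin G x \<noteq> origin G (opp G y)"
      using Nh(3)[OF that(1)] leafE(5)[OF that(2,3)] inter(1) by (metis IntI empty_iff)
    moreover have "origin G' x' \<noteq> origin G' (opp G' y')"
      using Nh(4)[OF that(1)] leafE(6)[OF that(2,3)] inter(2) by (metis IntI empty_iff)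
    ultimately show ?thesis by auto
  qed
  have E2: "(x = y \<longleftrightarrow> x' = y') \<and> (origin G x = origin G y \<longleftrightarrow> origin G' x' = origin G' y')"
    if xy: "(x, x') \<in> E" "(y, y') \<in> E" for x x' y y'
    using Ecases[OF xy(1)]
  proof
    assume x: "(x, x') \<in> N"
    show ?thesis using Ecases[OF xy(2)] N2[OF x] mixed[OF x] by blast
  next
    assume "\<exists>a a'. (a, a') \<in> Z \<and> \<mu> a \<le> p \<and> x = opp G a \<and> x' = opp G' a'"
    then obtain a a' where a: "(a, a') \<in> Z" "\<mu> a \<le> p" "x = opp G a" "x' = opp G' a'" by blast
    show ?thesis using Ecases[OF xy(2)]
    proof
      assume "(y, y') \<in> N"
      from mixed[OF this a(1,2)] show ?thesis unfolding a by metis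
    next
      assume "\<exists>b b'. (b, b') \<in> Z \<and> \<mu> b \<le> p \<and> y = opp G b \<and> y' = opp G' b'"
      then show ?thesis using L2[OF a(1,2)] unfolding a by blast
    qed
  qed
  show ?thesis
  proof (rule isomorphic_of_rel[OF fin, of E])
    have "x \<in> halfs G \<and> x' \<in> halfs G'" if "(x, x') \<in> E" for x x'
      using Ecases[OF that] Nh(1,2) leafE(1,2) by blast
    then show "E \<subseteq> halfs G \<times> halfs G'" by auto
    show "\<exists>x'. (x, x') \<in> E" if x: "x \<in> halfs G" for x
    proof (cases "origin G x \<in> leaves G")
      case True
      obtain y where y: "y \<in> set L" "\<mu> y \<le> p" "x = opp G y"
        using presents_leaf_half[OF T(1) P x True ne(1)] unfolding L_def by blast
      then show ?thesis using Zex[OF y(1)] by (auto simp: E_def)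
    next
      case False
      then have "x \<in> set (node_halfs G D)"
        using trivalent_cases[OF T(1) finite_graphD(1)[OF fin(1) x]] x spanning_set_node_halfs[OF sp(1)] by blast
      then show ?thesis using zip_total(1)[OF len(1)] unfolding E_def N_def by blast
    qed
    show "\<exists>x. (x, x') \<in> E" if x: "x' \<in> halfs G'" for x'
    proof (cases "origin G' x' \<in> leaves G'")
      case True
      obtain y where y: "y \<in> set L'" "\<mu>' y \<le> p" "x' = opp G' y"
        using presents_leaf_half[OF T(2) P' x True ne(2)] unfolding L'_def by blast
      then obtain z where "(z, y) \<in> Z" using Zex' by blast
      then show ?thesis using ZE y(3) by blast
    next
      case False
      then have "x' \<in> set (node_halfs G' D')"
        using trivalent_cases[OF T(2) finite_graphD(1)[OF fin(2) x]] x spanning_set_node_halfs[OF sp(2)] by blast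
      then show ?thesis using zip_total(2)[OF len(1)] unfolding E_def N_def by blast
    qed
    show "x = y \<longleftrightarrow> x' = y'" "origin G x = origin G y \<longleftrightarrow> origin G' x' = origin G' y'"
      if "(x, x') \<in> E" "(y, y') \<in> E" for x x' y y' using E2[OF that] by auto
    show "(opp G x, opp G' x') \<in> E" if x: "(x, x') \<in> E" for x x'
      using Ecases[OF x]
    proof
      assume n: "(x, x') \<in> N"
      have "(x, x') = (s, s') \<or> (x, x') \<in> set (zip (slots D) (slots D')) \<or> (opp G x, opp G' x') \<in> N"
        using zip_node_halfs_opp[OF fin val sh n[unfolded N_def]] rt ss by (simp add: N_def)
      then have "(x, x') \<in> Z \<or> (opp G x, opp G' x') \<in> N"
        by (auto simp: Z_def L_def L'_def)
      then show ?thesis using ZE by (auto simp: E_def)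
    next
      assume "\<exists>a a'. (a, a') \<in> Z \<and> \<mu> a \<le> p \<and> x = opp G a \<and> x' = opp G' a'"
      then show ?thesis using leafE(3,4) ZN by (auto simp: E_def)
    qed
    show "star G v \<noteq> {}" if "v \<in> verts G" for v by (rule star_nonempty[OF T(1) that])
    show "star G' v \<noteq> {}" if "v \<in> verts G'" for v by (rule star_nonempty[OF T(2) that])
    show "label G' (origin G' x') = label G (origin G x)" if "(x, x') \<in> E" "origin G x \<in> leaves G" for x x'
    proof -
      have "(x, x') \<notin> N" using Nh(3)[of x x'] that(2) inter by blast
      then show ?thesis using Ecases[OF that(1)] leafE(7,8) by force
    qed
  qed
qed

subsection \<open>Every graph has a labelled spanning tree\<close>

text \<open>Two trees back to back across one edge. In a single rooted tree the root would be a
  special place for growing; here \<open>span_pair_sym\<close> exchanges the sides, and moving the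
  separating edge is rerooting.\<close>

definition span_pair :: "('v, 'h) lgraph \<Rightarrow> 'h dtree \<Rightarrow> 'h dtree \<Rightarrow> 'v set \<Rightarrow> bool" where
  "span_pair G D E W \<longleftrightarrow> valid G D \<and> valid G E \<and> rt E = opp G (rt D) \<and>
     distinct (node_verts G D @ node_verts G E) \<and> set (node_verts G D @ node_verts G E) = W"

lemma span_pair_sym:
  assumes "finite_graph G" "span_pair G D E W"
  shows "span_pair G E D W"
proof -
  have "opp G (opp G (rt D)) = rt D"
    using assms valid_rt finite_graphD(4)[OF assms(1)] by (auto simp: span_pair_def)
  then show ?thesis using assms(2) by (auto simp: span_pair_def)
qed

lemma grow_slot:
  assumes "finite_graph G" "star G w = {opp G b, c, d}" "distinct [opp G b, c, d]" "w = origin G (opp G b)"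
    and "valid G D" "b \<in> set (slots D)" "distinct (node_verts G D)" "w \<notin> set (node_verts G D)"
  shows "\<exists>D'. valid G D' \<and> rt D' = rt D \<and> distinct (node_verts G D') \<and>
    set (node_verts G D') = insert w (set (node_verts G D))"
  using assms(5-)
proof (induction D)
  case (Lf h)
  have "c \<in> star G w" "d \<in> star G w" unfolding assms(2) by auto
  then show ?case
    using Lf assms by (intro exI[of _ "Nd b (Lf c) (Lf d)"]) auto
next
  case (Nd h l r)
  show ?case
  proof (cases "b \<in> set (slots l)")
    case True
    then obtain l' where l': "valid G l'" "rt l' = rt l" "distinct (node_verts G l')"
      "set (node_verts G l') = insert w (set (node_verts G l))" using Nd by auto
    show ?thesis using Nd.prems l' by (intro exI[of _ "Nd h l' r"]) auto
  next
    case False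
    then obtain r' where r': "valid G r'" "rt r' = rt r" "distinct (node_verts G r')"
      "set (node_verts G r') = insert w (set (node_verts G r))" using Nd by auto
    show ?thesis using Nd.prems r' by (intro exI[of _ "Nd h l r'"]) auto
  qed
qed

lemma span_pair_grow_left:
  assumes "finite_graph G" "star G w = {opp G b, c, d}" "distinct [opp G b, c, d]" "w = origin G (opp G b)"
    and sp: "span_pair G D E W" and "b \<in> set (slots D)" "w \<notin> W"
  shows "\<exists>D'. span_pair G D' E (insert w W)"
proof -
  have "valid G D" "distinct (node_verts G D)" "w \<notin> set (node_verts G D)"
    using sp assms(7) by (auto simp: span_pair_def)
  from grow_slot[OF assms(1-4) this(1) assms(6) this(2,3)] obtain D' where
    "valid G D'" "rt D' = rt D" "distinct (node_verts G D')"
    "set (node_verts G D') = insert w (set (node_verts G D))" by blast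
  then have "span_pair G D' E (insert w W)"
    using sp assms(7) by (auto simp: span_pair_def)
  then show ?thesis by blast
qed

lemma node_halfs_cases:
  assumes fin: "finite_graph G" and val: "valid G D" and x: "x \<in> set (node_halfs G D)"
  shows "x = opp G (rt D) \<or> x \<in> set (slots D) \<or> origin G (opp G x) \<in> set (node_verts G D)"
proof -
  have "set_mset (add_mset (rt D) (mset (node_halfs G D))) = set_mset (mset (slots D) + mset (edge_halfs G D))"
    by (simp only: mset_node_halfs)
  then have set: "insert (rt D) (set (node_halfs G D)) = set (slots D) \<union> set (edge_halfs G D)" by simp
  have xh: "x \<in> halfs G" using x set_node_halfs[OF val] by blast
  show ?thesis
  proof (cases "x \<in> set (slots D)")
    case False
    then have "opp G x \<in> set (edge_halfs G D)" using x set edge_halfs_opp[OF fin val] by blast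
    then have "opp G x = rt D \<or> opp G x \<in> set (node_halfs G D)" using set by blast
    moreover have "x = opp G (rt D)" if "opp G x = rt D"
      using finite_graphD(4)[OF fin xh] that by simp
    ultimately show ?thesis using set_node_halfs[OF val] by blast
  qed simp
qed

text \<open>By connectedness some edge leads from \<open>W\<close> to a trivalent vertex outside.
  Its half at \<open>W\<close> cannot belong to an inner edge, so it is a slot of one tree, or the
  common root with an empty tree on the other side.\<close>

lemma span_pair_grow:
  assumes T: "trivalent_graph g p G" and sp: "span_pair G D E W"
    and W: "W \<noteq> {}" "W \<subset> trivalent_verts G"
  shows "\<exists>D' E' w. span_pair G D' E' (insert w W) \<and> w \<in> trivalent_verts G \<and> w \<notin> W"
proof -
  note fin = trivalentD(1)[OF T]
  have "\<exists>h \<in> halfs G. origin G h \<in> W \<and> origin G (opp G h) \<in> trivalent_verts G - W"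
  proof (rule ccontr)
    assume "\<not> ?thesis"
    then have no: "origin G (opp G h) \<in> W \<or> origin G (opp G h) \<in> leaves G"
      if "h \<in> halfs G" "origin G h \<in> W" for h
      using that trivalent_cases[OF T] finite_graphD[OF fin] by blast
    \<comment> \<open>Leaves next to \<open>W\<close> are included because edges from
      \<open>W\<close> may lead to them; being of valence one, they lead back only into
      \<open>W\<close>.\<close>
    define C where "C = W \<union> {v \<in> leaves G. \<exists>k\<in>halfs G. origin G k \<in> W \<and> origin G (opp G k) = v}"
    have "C = verts G"
    proof (rule connected_closed_eq[OF trivalentD(1,2)[OF T]])
      show "C \<subseteq> verts G" using W by (auto simp: C_def trivalent_verts_def leaves_def)
      show "C \<noteq> {}" using W by (auto simp: C_def)
      fix h assume h: "h \<in> halfs G" "origin G h \<in> C"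
      show "origin G (opp G h) \<in> C"
      proof (cases "origin G h \<in> W")
        case True
        then show ?thesis using no[OF h(1) True] h by (auto simp: C_def)
      next
        case False
        then obtain k where k: "origin G h \<in> leaves G" "k \<in> halfs G" "origin G k \<in> W"
          "origin G (opp G k) = origin G h" using h by (auto simp: C_def)
        have "h = opp G k"
          using leaf_half_unique[OF k(1) h(1) finite_graphD(2)[OF fin k(2)]] k(4) by simp
        then have "opp G h = k" using finite_graphD(4)[OF fin k(2)] by simp
        then show ?thesis using k(3) by (simp add: C_def)
      qed
    qed
    then have "trivalent_verts G \<subseteq> C" by (auto simp: trivalent_verts_def)
    then have "trivalent_verts G \<subseteq> W" using leaf_not_trivalent by (fastforce simp: C_def)
    then show False using W by blast
  qed
  then obtain h where h: "h \<in> halfs G" "origin G h \<in> W"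
    and w: "origin G (opp G h) \<in> trivalent_verts G" "origin G (opp G h) \<notin> W" by blast
  let ?w = "origin G (opp G h)"
  have "card (star G ?w) = 3" using w(1) by (simp add: trivalent_verts_def valence_def)
  moreover have "opp G h \<in> star G ?w" using finite_graphD[OF fin h(1)] by simp
  ultimately have "card (star G ?w - {opp G h}) = 2" by simp
  then obtain c d where cd: "star G ?w - {opp G h} = {c, d}" "c \<noteq> d" by (auto simp: card_2_iff)
  have st: "star G ?w = {opp G h, c, d}" "distinct [opp G h, c, d]"
  proof -
    show "star G ?w = {opp G h, c, d}"
      using cd(1) insert_Diff[OF \<open>opp G h \<in> star G ?w\<close>] by simp
    have "opp G h \<notin> {c, d}" unfolding cd(1)[symmetric] by blast
    then show "distinct [opp G h, c, d]" using cd(2) by auto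
  qed
  have left: "\<exists>D' E'. span_pair G D' E' (insert ?w W)"
    if sp: "span_pair G D E W" and v: "origin G h \<in> set (node_verts G D)" for D E
  proof -
    have val: "valid G D" "valid G E" and rt: "rt E = opp G (rt D)"
      and sub: "set (node_verts G D) \<subseteq> W" "set (node_verts G E) \<subseteq> W"
      using sp by (auto simp: span_pair_def)
    have "h \<in> set (node_halfs G D)" using v h set_node_halfs[OF val(1)] by blast
    from node_halfs_cases[OF fin val(1) this] consider
      "h = rt E" | "h \<in> set (slots D)" using sub w rt by auto
    then show ?thesis
    proof cases
      case 1
      \<comment> \<open>A node with root \<open>h\<close> would have the vertex
        \<open>origin G (opp G h)\<close>, which is not yet in \<open>W\<close>.\<close>
      then have "E = Lf h" using w sub by (cases E) auto
      then have "h \<in> set (slots E)" by simp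
      from span_pair_grow_left[OF fin st refl span_pair_sym[OF fin sp] this w(2)]
      show ?thesis by blast
    next
      case 2
      from span_pair_grow_left[OF fin st refl sp this w(2)] show ?thesis by blast
    qed
  qed
  have "origin G h \<in> set (node_verts G D) \<or> origin G h \<in> set (node_verts G E)"
    using h sp by (auto simp: span_pair_def)
  then show ?thesis using left[OF sp] left[OF span_pair_sym[OF fin sp]] w by blast
qed

lemma span_pair_exists:
  assumes T: "trivalent_graph g p G" and ne: "trivalent_verts G \<noteq> {}"
  shows "\<exists>D E. span_pair G D E (trivalent_verts G)"
proof -
  note fin = trivalentD(1)[OF T]
  have finV: "finite (trivalent_verts G)"
    using fin by (auto simp: trivalent_verts_def finite_graph_def)
  obtain v where v: "v \<in> trivalent_verts G" using ne by blast
  then have "card (star G v) = 3" by (simp add: trivalent_verts_def valence_def)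
  then obtain a b c where abc: "star G v = {a, b, c}" "a \<noteq> b" "a \<noteq> c" "b \<noteq> c"
    by (auto simp: card_3_iff)
  have "a \<in> star G v" "b \<in> star G v" "c \<in> star G v" unfolding abc by auto
  then have m: "a \<in> halfs G" "b \<in> halfs G" "c \<in> halfs G" "origin G a = v" by (simp_all only: mem_star)
  then have "span_pair G (Lf a) (Nd (opp G a) (Lf b) (Lf c)) {v}"
    using abc finite_graphD[OF fin m(1)] by (simp add: span_pair_def)
  moreover have "\<exists>D E. span_pair G D E (trivalent_verts G)"
    if "span_pair G D E W" "W \<noteq> {}" "W \<subseteq> trivalent_verts G" for D E W
    using that
  proof (induction "card (trivalent_verts G - W)" arbitrary: D E W rule: less_induct)
    case less
    show ?case
    proof (cases "W = trivalent_verts G")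
      case True
      then show ?thesis using less.prems by blast
    next
      case False
      then have "W \<subset> trivalent_verts G" using less.prems by blast
      from span_pair_grow[OF T less.prems(1,2) this] obtain D' E' w where
        w: "span_pair G D' E' (insert w W)" "w \<in> trivalent_verts G" "w \<notin> W" by blast
      have "card (trivalent_verts G - insert w W) < card (trivalent_verts G - W)"
        by (rule psubset_card_mono) (use finV w in auto)
      then show ?thesis using less.hyps[OF _ w(1)] w(2) less.prems by blast
    qed
  qed
  ultimately show ?thesis using v by blast
qed

text \<open>The separating edge walks down to \<open>x\<close>: stepping from \<open>h\<close> into
  the child \<open>l\<close> hangs the sibling \<open>r\<close> and the opposite tree
  \<open>E\<close> on a new node on the other side. Vertices and slots are only redistributed, until
  one side is just \<open>x\<close>.\<close>

lemma span_pair_reroot: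
  assumes fin: "finite_graph G" and "span_pair G D E W" "x \<in> set (slots D)"
  shows "\<exists>D'. valid G D' \<and> rt D' = opp G x \<and> distinct (node_verts G D') \<and>
    set (node_verts G D') = W \<and> mset (x # slots D') = mset (slots D @ slots E)"
  using assms(2-)
proof (induction D arbitrary: E)
  case (Lf h)
  then show ?case by (intro exI[of _ E]) (auto simp: span_pair_def)
next
  case (Nd h l r)
  let ?v = "origin G (opp G h)"
  have st: "star G ?v = {opp G h, rt l, rt r}" "distinct [opp G h, rt l, rt r]"
    and val: "valid G l" "valid G r" "valid G E" and E: "rt E = opp G h" and h: "h \<in> halfs G"
    using Nd.prems(1) by (auto simp: span_pair_def)
  have "rt l \<in> star G ?v" "rt r \<in> star G ?v" unfolding st(1) by auto
  then have o: "rt l \<in> halfs G" "rt r \<in> halfs G" "origin G (rt l) = ?v" "origin G (rt r) = ?v" by auto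
  have oo: "opp G (opp G (rt l)) = rt l" "opp G (opp G (rt r)) = rt r"
    "opp G (rt l) \<in> halfs G" "opp G (rt r) \<in> halfs G"
    using finite_graphD[OF fin] o by auto
  have "span_pair G l (Nd (opp G (rt l)) r E) W"
    using Nd.prems(1) st val E o oo by (auto simp: span_pair_def insert_commute)
  moreover have "span_pair G r (Nd (opp G (rt r)) l E) W"
    using Nd.prems(1) st val E o oo by (auto simp: span_pair_def insert_commute)
  moreover have "x \<in> set (slots l) \<or> x \<in> set (slots r)" using Nd.prems(2) by simp
  ultimately show ?case
  proof (elim disjE)
    assume "span_pair G l (Nd (opp G (rt l)) r E) W" "x \<in> set (slots l)"
    from Nd.IH(1)[OF this] show ?thesis by simp
  next
    assume "span_pair G r (Nd (opp G (rt r)) l E) W" "x \<in> set (slots r)"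
    from Nd.IH(2)[OF this] show ?thesis by (simp add: ac_simps)
  qed
qed

lemma spanning_exists:
  assumes T: "trivalent_graph g p G" and ne: "trivalent_verts G \<noteq> {}"
  shows "\<exists>s D. spanning G s D"
proof -
  obtain D E where sp: "span_pair G D E (trivalent_verts G)" using span_pair_exists[OF assms] by blast
  obtain x where x: "x \<in> set (slots D)" 
    using length_slots[of D G] by (cases "slots D") auto
  obtain D' where D': "valid G D'" "rt D' = opp G x" "distinct (node_verts G D')"
    "set (node_verts G D') = trivalent_verts G"
    using span_pair_reroot[OF trivalentD(1)[OF T] sp x] by blast
  have "D' = Nd (rt D') (case D' of Nd h l r \<Rightarrow> l) (case D' of Nd h l r \<Rightarrow> r)"
    using D' ne by (cases D') auto
  then have "opp G (opp G x) \<in> set (node_halfs G D')" using D'(2) by (metis list.set_intros(1) node_halfs.simps(2))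
  moreover have "x \<in> halfs G"
  proof -
    have "x \<in> halfs G" if "valid G D" "x \<in> set (slots D)" for D
      using that by (induction D) auto
    then show ?thesis using sp x by (auto simp: span_pair_def)
  qed
  ultimately show ?thesis using D' by (auto simp: spanning_def)
qed

lemma spanning_reroot:
  assumes T: "trivalent_graph g p G" and sp: "spanning G s D" and y: "y \<in> set (s # slots D)"
  shows "\<exists>D'. spanning G y D' \<and> mset (y # slots D') = mset (s # slots D)"
proof (cases "y = s")
  case True
  then show ?thesis using sp by blast
next
  case False
  then have y': "y \<in> set (slots D)" using y by simp
  note fin = trivalentD(1)[OF T]
  have "span_pair G D (Lf s) (trivalent_verts G)"
    using sp finite_graphD(4)[OF fin] by (auto simp: span_pair_def spanning_def)
  from span_pair_reroot[OF fin this y'] obtain D' where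
    D': "valid G D'" "rt D' = opp G y" "distinct (node_verts G D')"
    "set (node_verts G D') = trivalent_verts G" "mset (y # slots D') = mset (slots D @ slots (Lf s))" by blast
  moreover have "y \<in> halfs G"
  proof -
    have "y \<in> halfs G" if "valid G D" "y \<in> set (slots D)" for D
      using that by (induction D) auto
    then show ?thesis using sp y' by (auto simp: spanning_def)
  qed
  ultimately show ?thesis by (auto simp: spanning_def)
qed

lemma pair_labelling:
  assumes "finite B" "card B = 2 * g" "\<And>y. y \<in> B \<Longrightarrow> f y \<in> B \<and> f y \<noteq> y \<and> f (f y) = y"
  shows "\<exists>\<nu>. bij_betw \<nu> B {p + 1..p + 2 * g} \<and> (\<forall>y\<in>B. \<nu> (f y) = mate p (\<nu> y))"
  using assms
proof (induction g arbitrary: B)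
  case 0
  then have "B = {}" by simp
  then show ?case by (simp add: bij_betw_def)
next
  case (Suc g)
  obtain y where y: "y \<in> B" using Suc.prems by fastforce
  let ?B = "B - {y, f y}"
  have fy: "f y \<in> B" "f y \<noteq> y" "f (f y) = y" using Suc.prems(3)[OF y] by auto
  have "card ?B = 2 * g" 
    using Suc.prems(1,2) y fy card_Diff_subset[of "{y, f y}" B] by simp
  moreover have "f z \<in> ?B \<and> f z \<noteq> z \<and> f (f z) = z" if "z \<in> ?B" for z
    using Suc.prems(3)[of z] that fy by auto
  ultimately obtain \<nu> where nu: "bij_betw \<nu> ?B {p + 1..p + 2 * g}" "\<forall>z\<in>?B. \<nu> (f z) = mate p (\<nu> z)"
    using Suc.IH[of ?B] Suc.prems(1) by blast
  define \<nu>' where "\<nu>' = \<nu>(y := p + 2 * g + 1, f y := p + 2 * g + 2)"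
  have ag: "\<nu>' z = \<nu> z" if "z \<in> ?B" for z using that by (simp add: \<nu>'_def)
  have "bij_betw \<nu>' ?B {p + 1..p + 2 * g}"
    using nu(1) ag by (subst bij_betw_cong[of _ _ \<nu>]) auto
  moreover have "bij_betw \<nu>' {y, f y} {p + 2 * g + 1, p + 2 * g + 2}"
    using fy by (auto simp: \<nu>'_def bij_betw_def)
  ultimately have "bij_betw \<nu>' (?B \<union> {y, f y}) ({p + 1..p + 2 * g} \<union> {p + 2 * g + 1, p + 2 * g + 2})"
    by (rule bij_betw_combine) auto
  moreover have "?B \<union> {y, f y} = B" using y fy by blast
  moreover have "{p + 1..p + 2 * g} \<union> {p + 2 * g + 1, p + 2 * g + 2} = {p + 1..p + 2 * Suc g}" by auto
  moreover have "\<nu>' (f z) = mate p (\<nu>' z)" if z: "z \<in> B" for z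
  proof -
    consider "z = y" | "z = f y" | "z \<in> ?B" using z by blast
    then show ?thesis
    proof cases
      case 3
      then have "f z \<in> ?B" using Suc.prems(3)[of z] fy by auto
      then show ?thesis using ag 3 nu(2) by simp
    qed (use fy in \<open>auto simp: \<nu>'_def mate_def\<close>)
  qed
  ultimately show ?case by metis
qed

text \<open>Slots whose partner lies at a leaf correspond to the leaves and take over their labels.
  The others are closed under \<open>opp\<close>, and as there are \<open>p + 2 * g\<close> slots in
  all, they form \<open>g\<close> pairs.\<close>

lemma slot_labelling_exists:
  assumes T: "trivalent_graph g p G" and pos: "2 * int g - 2 + int p > 0" and sp: "spanning G s D"
  shows "\<exists>\<mu>. slot_labelling g p G (set (s # slots D)) \<mu>"
proof -
  note fin = trivalentD(1)[OF T]
  have ne: "trivalent_verts G \<noteq> {}" using card_trivalent_verts[OF T] pos by auto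
  note ss = spanning_slots[OF sp ne fin]
  define S where "S = set (s # slots D)"
  have cS: "card S = p + 2 * g"
    using ss(1,2) card_trivalent_verts[OF T] pos by (simp only: S_def distinct_card)
  have Sh: "y \<in> halfs G" "origin G y \<in> trivalent_verts G" if "y \<in> S" for y
    using ss(3)[of y] that spanning_set_node_halfs[OF sp] by (auto simp: S_def)
  have So: "origin G (opp G y) \<in> leaves G \<or> opp G y \<in> S" if y: "y \<in> S" for y
  proof -
    have "opp G y \<in> set (node_halfs G D)" if "origin G (opp G y) \<notin> leaves G"
      using that finite_graphD[OF fin] Sh(1)[OF y] trivalent_cases[OF T] spanning_set_node_halfs[OF sp] by blast
    then show ?thesis using ss(5)[of y] y unfolding S_def by blast
  qed
  define A where "A = {y \<in> S. origin G (opp G y) \<in> leaves G}"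
  define B where "B = S - A"
  have labb: "bij_betw (label G) (leaves G) {1..p}" by (rule trivalentD(6)[OF T])
  have "bij_betw (\<lambda>y. origin G (opp G y)) A (leaves G)"
    unfolding bij_betw_def
  proof
    show "inj_on (\<lambda>y. origin G (opp G y)) A"
    proof (rule inj_onI)
      fix y z assume yz: "y \<in> A" "z \<in> A" "origin G (opp G y) = origin G (opp G z)"
      have h: "y \<in> halfs G" "z \<in> halfs G" using yz Sh by (auto simp: A_def)
      have "opp G y = opp G z"
        by (rule leaf_half_unique[of "origin G (opp G y)" G]) (use yz h finite_graphD[OF fin] in \<open>auto simp: A_def\<close>)
      then show "y = z" using h finite_graphD(4)[OF fin] by metis
    qed
    show "(\<lambda>y. origin G (opp G y)) ` A = leaves G"
    proof
      show "(\<lambda>y. origin G (opp G y)) ` A \<subseteq> leaves G" by (auto simp: A_def)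
      show "leaves G \<subseteq> (\<lambda>y. origin G (opp G y)) ` A"
      proof
        fix v assume v: "v \<in> leaves G"
        then obtain k where "star G v = {k}" unfolding leaves_def valence_def by (auto simp: card_1_singleton_iff)
        then have k: "k \<in> halfs G" "origin G k = v" using mem_star[of k G v] by auto
        note ok = finite_graphD[OF fin k(1)]
        \<comment> \<open>An edge between two leaves would be a whole component, hence all of
          \<open>G\<close>, leaving no trivalent vertex.\<close>
        have "origin G (opp G k) \<notin> leaves G"
        proof
          assume w: "origin G (opp G k) \<in> leaves G"
          have "{v, origin G (opp G k)} = verts G"
          proof (rule connected_closed_eq[OF trivalentD(1,2)[OF T]])
            show "{v, origin G (opp G k)} \<subseteq> verts G" using v w by (auto simp: leaves_def)
            fix h assume h: "h \<in> halfs G" "origin G h \<in> {v, origin G (opp G k)}"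
            then have "h = k \<or> h = opp G k"
              using leaf_half_unique[OF v h(1) k(1)] leaf_half_unique[OF w h(1) ok(2)] k by auto
            then show "origin G (opp G h) \<in> {v, origin G (opp G k)}" using ok k by auto
          qed simp
          then have "trivalent_verts G \<subseteq> leaves G" using v w by (auto simp: trivalent_verts_def)
          then show False using ne leaf_not_trivalent[of _ G] by blast
        qed
        then have "opp G k \<in> set (node_halfs G D)"
          using ok spanning_set_node_halfs[OF sp] trivalent_cases[OF T] finite_graphD(1)[OF fin] by blast
        moreover have "opp G (opp G k) \<notin> set (node_halfs G D)"
          using ok k v spanning_set_node_halfs[OF sp] leaf_not_trivalent[of v G] by auto
        ultimately have "opp G k \<in> S" using ss(4) unfolding S_def by blast
        then have "opp G k \<in> A" using ok k v by (simp add: A_def)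
        then show "v \<in> (\<lambda>y. origin G (opp G y)) ` A" using ok k by (intro image_eqI[of _ _ "opp G k"]) auto
      qed
    qed
  qed
  from bij_betw_trans[OF this labb]
  have bA: "bij_betw (\<lambda>y. label G (origin G (opp G y))) A {1..p}" by (simp add: o_def)
  have finS: "finite S" "A \<subseteq> S" by (auto simp: S_def A_def)
  have cB: "card B = 2 * g"
    using bij_betw_same_card[OF bA] cS finS by (simp add: B_def card_Diff_subset finite_subset)
  have Bop: "opp G y \<in> B \<and> opp G y \<noteq> y \<and> opp G (opp G y) = y" if y: "y \<in> B" for y
  proof -
    have yS: "y \<in> S" "opp G y \<in> S" using y So by (auto simp: B_def A_def)
    note oy = finite_graphD[OF fin Sh(1)[OF yS(1)]]
    have "opp G y \<notin> A" using oy(4) Sh(2)[OF yS(1)] leaf_not_trivalent[of _ G] by (auto simp: A_def)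
    then show ?thesis using yS oy by (simp add: B_def)
  qed
  have "finite B" using finS by (simp add: B_def)
  from pair_labelling[of B g "opp G" p, OF this cB Bop] obtain \<nu> where
    nu: "bij_betw \<nu> B {p + 1..p + 2 * g}" "\<forall>y\<in>B. \<nu> (opp G y) = mate p (\<nu> y)" by blast
  define \<mu> where "\<mu> y = (if y \<in> A then label G (origin G (opp G y)) else \<nu> y)" for y
  have "bij_betw \<mu> A {1..p}" using bA by (subst bij_betw_cong[where g = "\<lambda>y. label G (origin G (opp G y))"]) (auto simp: \<mu>_def)
  moreover have bB: "bij_betw \<mu> B {p + 1..p + 2 * g}" using nu(1) by (subst bij_betw_cong[where g = \<nu>]) (auto simp: \<mu>_def B_def)
  ultimately have "bij_betw \<mu> (A \<union> B) ({1..p} \<union> {p + 1..p + 2 * g})" by (rule bij_betw_combine) auto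
  moreover have "A \<union> B = S" "{1..p} \<union> {p + 1..p + 2 * g} = {1..p + 2 * g}" using finS by (auto simp: B_def)
  moreover have "if \<mu> x \<le> p then origin G (opp G x) \<in> leaves G \<and> label G (origin G (opp G x)) = \<mu> x
            else opp G x \<in> S \<and> \<mu> (opp G x) = mate p (\<mu> x)" if x: "x \<in> S" for x
  proof (cases "x \<in> A")
    case True
    then have "origin G (opp G x) \<in> leaves G" by (simp add: A_def)
    moreover from this have "label G (origin G (opp G x)) \<le> p" using labb by (auto simp: bij_betw_def)
    ultimately show ?thesis using True by (simp add: \<mu>_def)
  next
    case False
    then have xB: "x \<in> B" "opp G x \<in> B" using x Bop by (auto simp: B_def)
    then have "p < \<mu> x" using bij_betwE[OF bB] by auto
    then show ?thesis using xB nu(2) by (auto simp: \<mu>_def B_def)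
  qed
  ultimately have "slot_labelling g p G S \<mu>" unfolding slot_labelling_def by metis
  then show ?thesis by (auto simp: S_def)
qed

text \<open>The slot that receives the label 1 need not be the root at first; rerooting there keeps
  the set of slots, hence the labelling.\<close>

lemma presents_exists:
  assumes T: "trivalent_graph g p G" and pos: "2 * int g - 2 + int p > 0"
  shows "\<exists>s D \<mu>. presents g p G s D \<mu>"
proof -
  have ne: "trivalent_verts G \<noteq> {}" using card_trivalent_verts[OF T] pos by auto
  obtain s D where sp: "spanning G s D" using spanning_exists[OF T ne] by blast
  obtain \<mu> where mu: "slot_labelling g p G (set (s # slots D)) \<mu>"
    using slot_labelling_exists[OF T pos sp] by blast
  have "1 \<in> {1..p + 2 * g}" using pos by auto
  then have "1 \<in> \<mu> ` set (s # slots D)" using mu unfolding slot_labelling_def bij_betw_def by blast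
  then obtain y where y: "y \<in> set (s # slots D)" "\<mu> y = 1" by force
  obtain D' where D': "spanning G y D'" "mset (y # slots D') = mset (s # slots D)"
    using spanning_reroot[OF T sp y(1)] by blast
  have "set (y # slots D') = set (s # slots D)" using D'(2) by (metis mset_eq_setD)
  then have "presents g p G y D' \<mu>" using D'(1) mu y(2) unfolding presents_def by metis
  then show ?thesis by blast
qed

subsection \<open>The upper bound\<close>

lemma presents_leaf_list:
  assumes T: "trivalent_graph g p G" and pos: "2 * int g - 2 + int p > 0" and P: "presents g p G s D \<mu>"
  shows "distinct (leaf_list (shape \<mu> D))" "set (leaf_list (shape \<mu> D)) = {2..p + 2 * g}"
    "length (leaf_list (shape \<mu> D)) = p + 2 * g - 1"
proof -
  have ne: "trivalent_verts G \<noteq> {}" using card_trivalent_verts[OF T] pos by auto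
  have sp: "spanning G s D" and mu: "\<mu> s = 1" "bij_betw \<mu> (set (s # slots D)) {1..p + 2 * g}"
    using P by (auto simp: presents_def slot_labelling_def)
  note d = spanning_slots(1)[OF sp ne trivalentD(1)[OF T]]
  have inj: "inj_on \<mu> (set (s # slots D))" using mu by (simp add: bij_betw_def)
  show 1: "distinct (leaf_list (shape \<mu> D))"
    unfolding leaf_list_shape using d inj by (auto simp: distinct_map)
  have im: "insert (\<mu> s) (\<mu> ` set (slots D)) = {1..p + 2 * g}" using mu(2) by (auto simp: bij_betw_def)
  have ns: "\<mu> s \<notin> \<mu> ` set (slots D)" using d inj by (auto simp: inj_on_def)
  have "\<mu> ` set (slots D) = {1..p + 2 * g} - {1}" using im ns mu(1) by (metis Diff_insert_absorb)
  also have "\<dots> = {2..p + 2 * g}" by auto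
  finally show 2: "set (leaf_list (shape \<mu> D)) = {2..p + 2 * g}" by (simp add: leaf_list_shape)
  show "length (leaf_list (shape \<mu> D)) = p + 2 * g - 1" using distinct_card[OF 1] 2 by simp
qed

text \<open>Tree moves alter stars only at trivalent vertices, while \<open>opp\<close>,
  \<open>label\<close>, the root and the multiset of slots stay; so the leaf labels and the pairing
  recorded by \<open>\<mu>\<close> remain correct.\<close>

lemma presents_tree_moves:
  assumes T: "trivalent_graph g p G" and P: "presents g p G s D \<mu>" and m: "tree_moves n (shape \<mu> D) u"
  shows "\<exists>G' D' k. k \<le> n \<and> (whitehead_move ^^ k) G G' \<and> presents g p G' s D' \<mu> \<and> shape \<mu> D' = u"
proof -
  have P': "valid G D" "rt D = opp G s" "s \<in> halfs G" "distinct (node_verts G D)"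
     "set (node_verts G D) = trivalent_verts G"
     "slot_labelling g p G (set (s # slots D)) \<mu>" "\<mu> s = 1" using P by (auto simp: presents_def spanning_def)
  from realizable_tree_moves[OF m T P'(1,4) refl] obtain G' D' k where
    1: "k \<le> n" "(whitehead_move ^^ k) G G'"
     "verts G' = verts G" "halfs G' = halfs G" "opp G' = opp G" "label G' = label G"
     "valid G' D'" "distinct (node_verts G' D')" "set (node_verts G' D') = set (node_verts G D)"
     "rt D' = rt D" "mset (slots D') = mset (slots D)" "shape \<mu> D' = u"
     "\<forall>v. v \<notin> set (node_verts G D) \<longrightarrow> star G' v = star G v"
    unfolding realizable_def by (elim exE conjE) (rule that; assumption)
  have T': "trivalent_graph g p G'" by (rule trivalent_graph_whitehead_relpowp[OF 1(2) T])
  have star: "star G' v = star G v" if "v \<in> leaves G" for v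
    using 1(13) P'(5) leaf_not_trivalent[OF that] by blast
  have lv: "v \<in> leaves G'" if "v \<in> leaves G" for v
    using that star[OF that] 1(3) by (simp add: leaves_def valence_def)
  have "trivalent_verts G \<subseteq> trivalent_verts G'"
  proof
    fix v assume v: "v \<in> trivalent_verts G"
    then have "v \<in> set (node_verts G' D')" using 1(9) P'(5) by simp
    moreover have "valence G' v = 3" if "valid G' d" "v \<in> set (node_verts G' d)" for d
      using that by (induction d) (auto simp: valence_def)
    ultimately have "valence G' v = 3" using 1(7) by blast
    then show "v \<in> trivalent_verts G'" using v 1(3) by (simp add: trivalent_verts_def)
  qed
  moreover have "finite (trivalent_verts G')" "card (trivalent_verts G') = card (trivalent_verts G)"
    using trivalentD(1)[OF T'] card_trivalent_verts[OF T] card_trivalent_verts[OF T']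
    by (auto simp: trivalent_verts_def finite_graph_def)
  ultimately have tv: "trivalent_verts G' = trivalent_verts G" by (metis card_subset_eq)
  have orig: "origin G' x = origin G x" if "x \<in> halfs G" "origin G x \<in> leaves G" for x
  proof -
    have "x \<in> star G (origin G x)" using that by simp
    then have "x \<in> star G' (origin G x)" using star[OF that(2)] by blast
    then show ?thesis by simp
  qed
  have set: "set (s # slots D') = set (s # slots D)" using 1(11) by (metis list.simps(15) mset_eq_setD)
  have sl: "x \<in> halfs G" if "x \<in> set (s # slots D)" for x
  proof -
    have "x \<in> halfs G" if "valid G D" "x \<in> set (slots D)" for D
      using that by (induction D) auto
    then show ?thesis using that P'(1,3) by auto
  qed
  have "slot_labelling g p G' (set (s # slots D')) \<mu>"
    unfolding slot_labelling_def set 1(5,6)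
  proof (intro conjI ballI)
    show "bij_betw \<mu> (set (s # slots D)) {1..p + 2 * g}" using P'(6) by (simp add: slot_labelling_def)
    fix x assume x: "x \<in> set (s # slots D)"
    have ox: "opp G x \<in> halfs G" using finite_graphD(2)[OF trivalentD(1)[OF T]] sl[OF x] by blast
    have "if \<mu> x \<le> p then origin G (opp G x) \<in> leaves G \<and> label G (origin G (opp G x)) = \<mu> x
       else opp G x \<in> set (s # slots D) \<and> \<mu> (opp G x) = mate p (\<mu> x)"
      using P'(6) x unfolding slot_labelling_def by blast
    then show "if \<mu> x \<le> p then origin G' (opp G x) \<in> leaves G' \<and> label G (origin G' (opp G x)) = \<mu> x
       else opp G x \<in> set (s # slots D) \<and> \<mu> (opp G x) = mate p (\<mu> x)"
      using orig[OF ox] lv by (auto split: if_splits)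
  qed
  then have "presents g p G' s D' \<mu>"
    using 1 P' tv by (simp add: presents_def spanning_def)
  then show ?thesis using 1 by blast
qed

text \<open>The tree of \<open>G\<close> is rewritten into the tree of \<open>H\<close>. The
  numberings of the cut edges were chosen independently, yet the result is presented by the same
  labelled tree as \<open>H\<close> and is therefore isomorphic to \<open>H\<close>.\<close>

lemma diam_W_upper:
  assumes pos: "2 * int g - 2 + int p > 0" and j: "p + 2 * g - 1 \<le> 2 ^ j"
  shows "diam_W g p \<le> enat (2 * (j + 1) * 2 ^ j)"
  unfolding diam_W_def
proof (intro SUP_least)
  fix X Y assume XY: "X \<in> Graph g p" "Y \<in> Graph g p"
  obtain G where G: "trivalent_graph g p G" "X = iso_rel g p `` {G}" by (rule GraphE[OF XY(1)])
  obtain H where H: "trivalent_graph g p H" "Y = iso_rel g p `` {H}" "H \<in> Y" by (rule GraphE[OF XY(2)])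
  obtain s D \<mu> where P: "presents g p G s D \<mu>" using presents_exists[OF G(1) pos] by blast
  obtain s' D' \<mu>' where P': "presents g p H s' D' \<mu>'" using presents_exists[OF H(1) pos] by blast
  note ll = presents_leaf_list[OF G(1) pos P] presents_leaf_list[OF H(1) pos P']
  obtain n where n: "n \<le> 2 * (j + 1) * 2 ^ j" "tree_moves n (shape \<mu> D) (shape \<mu>' D')"
    using tree_moves_same_leaves[OF ll(1) ll(4), of j] ll j by auto
  obtain G' D'' k where k: "k \<le> n" "(whitehead_move ^^ k) G G'" "presents g p G' s D'' \<mu>" "shape \<mu> D'' = shape \<mu>' D'"
    using presents_tree_moves[OF G(1) P n(2)] by blast
  have T': "trivalent_graph g p G'" by (rule trivalent_graph_whitehead_relpowp[OF k(2) G(1)])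
  have "isomorphic G' H" by (rule presents_isomorphic[OF T' H(1) pos k(3) P' k(4)])
  then have "(G', H) \<in> iso_rel g p" using T' H(1) by (simp add: iso_rel_def)
  then have "iso_rel g p `` {G'} = Y" unfolding H(2) by (rule equiv_class_eq[OF equiv_iso_rel])
  then have "(X, Y) \<in> moves g p ^^ k"
    using moves_relpow_of_whitehead[OF k(2) G(1)] G(2) by simp
  then show "d_W g p X Y \<le> enat (2 * (j + 1) * 2 ^ j)"
    unfolding d_W_le_iff using k(1) n(1) by (meson le_trans)
qed

subsection \<open>Counting the graphs within a given number of moves\<close>

text \<open>Names a half-edge by its position at its vertex. At trivalent vertices such names come
  from a set of size 3 whatever the size of the graph, and they depend only on the star, so moves
  elsewhere do not change them.\<close>

definition rank_in_star :: "ngraph \<Rightarrow> nat \<Rightarrow> nat" where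
  "rank_in_star G x = card {y \<in> star G (origin G x). y < x}"

lemma rank_in_star_inj:
  assumes "finite_graph G" "x \<in> halfs G" "y \<in> halfs G" "origin G x = origin G y"
    and "rank_in_star G x = rank_in_star G y"
  shows "x = y"
proof -
  have less: "rank_in_star G a < rank_in_star G b"
    if "a < b" "a \<in> halfs G" "origin G a = origin G b" for a b
  proof -
    have "{y \<in> star G (origin G a). y < a} \<subset> {y \<in> star G (origin G b). y < b}"
      using that by auto
    moreover have "finite {y \<in> star G (origin G b). y < b}"
      using finite_star[OF assms(1)] by simp
    ultimately show ?thesis unfolding rank_in_star_def by (simp add: psubset_card_mono)
  qed
  show ?thesis using less[of x y] less[of y x] assms by (cases x y rule: linorder_cases) auto
qed

lemma rank_in_star_less:
  assumes "finite_graph G" "x \<in> halfs G"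
  shows "rank_in_star G x < valence G (origin G x)"
proof -
  have "x \<in> star G (origin G x)" using assms(2) by simp
  then have "{y \<in> star G (origin G x). y < x} \<subset> star G (origin G x)" by blast
  then show ?thesis
    unfolding rank_in_star_def valence_def using finite_star[OF assms(1)] by (simp add: psubset_card_mono)
qed

text \<open>Each move writes one letter at each end of its edge: the local ranks of the half of the
  pivot edge there and of the half-edge that leaves. Earliest letters come first; the relative order
  of letters at different vertices is deliberately not recorded.\<close>

inductive run :: "nat \<Rightarrow> ngraph \<Rightarrow> (nat \<Rightarrow> (nat \<times> nat) list) \<Rightarrow> ngraph \<Rightarrow> bool" where
  run_0: "run 0 G (\<lambda>_. []) G"
| run_Suc: "pivot G h s t \<Longrightarrow> u = origin G h \<Longrightarrow> w = origin G (opp G h) \<Longrightarrow> run n (swap G s t) W G' \<Longrightarrow>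
    W' = W(u := (rank_in_star G h, rank_in_star G s) # W u,
           w := (rank_in_star G (opp G h), rank_in_star G t) # W w) \<Longrightarrow>
    run (Suc n) G W' G'"

lemma star_swap_other:
  assumes "a \<in> halfs G" "b \<in> halfs G" "v \<noteq> origin G a" "v \<noteq> origin G b"
  shows "star (swap G a b) v = star G v"
proof -
  have "transpose a b y = y" if "y \<in> star G v" for y
    using that assms(3,4) by (auto simp: transpose_def)
  then show ?thesis unfolding star_swap[OF assms(1,2)] by auto
qed

text \<open>Moves on edges without a common end see different stars, so each leaves the ranks used
  by the other intact, and the two transpositions, having disjoint supports, commute.\<close>

lemma pivot_swap_other:
  assumes fin: "finite_graph G" and p: "pivot G h s t" and q: "pivot G k a b"
    and dis: "{origin G h, origin G (opp G h)} \<inter> {origin G k, origin G (opp G k)} = {}"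
  shows "pivot (swap G a b) h s t"
    "origin (swap G a b) h = origin G h" "origin (swap G a b) (opp G h) = origin G (opp G h)"
    "x \<in> {h, s, opp G h, t} \<Longrightarrow> rank_in_star (swap G a b) x = rank_in_star G x"
    "swap (swap G a b) s t = swap (swap G s t) a b"
proof -
  note p' = p[unfolded pivot_def] and q' = q[unfolded pivot_def]
  let ?u = "origin G h" and ?w = "origin G (opp G h)"
  have oa: "origin G a = origin G k" "origin G b = origin G (opp G k)" "a \<in> halfs G" "b \<in> halfs G"
    and os: "origin G s = ?u" "origin G t = ?w" "s \<in> halfs G" "t \<in> halfs G"
    using p' q' by auto
  have ne: "x \<noteq> a \<and> x \<noteq> b" if "x \<in> {h, s, opp G h, t}" for x
    using that dis oa os by auto
  then have tr: "transpose a b x = x" if "x \<in> {h, s, opp G h, t}" for x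
    using that by (metis transpose_apply_other)
  then have o: "origin (swap G a b) x = origin G x" if "x \<in> {h, s, opp G h, t}" for x
    using that by simp
  show oh: "origin (swap G a b) h = ?u" "origin (swap G a b) (opp G h) = ?w"
    using o by blast+
  have os': "origin (swap G a b) s = ?u" "origin (swap G a b) t = ?w"
    using o[of s] o[of t] os by auto
  show "pivot (swap G a b) h s t"
    unfolding pivot_def swap_simps(1-4) oh os' valence_swap[OF oa(3,4)] using p' by blast
  have st: "star (swap G a b) v = star G v" if "v \<in> {?u, ?w}" for v
    by (rule star_swap_other[OF oa(3,4)]) (use that dis oa in auto)
  show "rank_in_star (swap G a b) x = rank_in_star G x" if x: "x \<in> {h, s, opp G h, t}" for x
  proof -
    have "origin G x \<in> {?u, ?w}" using x os by auto
    then show ?thesis unfolding rank_in_star_def o[OF x] by (simp only: st)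
  qed
  have "transpose a b (transpose s t x) = transpose s t (transpose a b x)" for x
    using ne[of s] ne[of t] by (auto simp: transpose_def)
  then show "swap (swap G a b) s t = swap (swap G s t) a b"
    by (simp add: swap_def)
qed

lemma pivot_sym:
  assumes "finite_graph G" "pivot G h s t"
  shows "pivot G (opp G h) t s" "swap G t s = swap G s t" "opp G (opp G h) = h"
proof -
  show oo: "opp G (opp G h) = h" using assms finite_graphD[OF assms(1)] by (auto simp: pivot_def)
  show "pivot G (opp G h) t s"
    using assms finite_graphD[OF assms(1)] unfolding pivot_def oo by auto
  show "swap G t s = swap G s t" by (simp add: swap_def transpose_commute)
qed

text \<open>
  A word at a vertex records, in the order of time, which half-edges take part in the moves at
  that vertex. If the words at both ends of an edge start with the same move, then this move
  commutes with all earlier ones, so it can be made first.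
\<close>

lemma run_hoist:
  assumes "run n G W G'" "finite_graph G" "pivot G h s t"
    and "W (origin G h) = (rank_in_star G h, rank_in_star G s) # \<alpha>"
    and "W (origin G (opp G h)) = (rank_in_star G (opp G h), rank_in_star G t) # \<beta>"
  shows "\<exists>m. n = Suc m \<and> run m (swap G s t) (W(origin G h := \<alpha>, origin G (opp G h) := \<beta>)) G'"
  using assms
proof (induction arbitrary: \<alpha> \<beta> rule: run.induct)
  case (run_0 G)
  then show ?case by simp
next
  case (run_Suc G k a b u w n W G' W')
  note fin = run_Suc.prems(1) and p = run_Suc.prems(2) and q = run_Suc.hyps(1)
  note p' = p[unfolded pivot_def] and q' = q[unfolded pivot_def]
  let ?u = "origin G h" and ?w = "origin G (opp G h)"
  have uw: "u \<noteq> w" "?u \<noteq> ?w" using p' q' run_Suc.hyps(2,3) by auto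
  have mem: "h \<in> halfs G" "opp G h \<in> halfs G" "s \<in> halfs G" "t \<in> halfs G"
    "k \<in> halfs G" "opp G k \<in> halfs G" "a \<in> halfs G" "b \<in> halfs G"
    using p' q' finite_graphD[OF fin] by auto
  have W'u: "W' u = (rank_in_star G k, rank_in_star G a) # W u"
    and W'w: "W' w = (rank_in_star G (opp G k), rank_in_star G b) # W w"
    and W'o: "\<And>v. v \<noteq> u \<Longrightarrow> v \<noteq> w \<Longrightarrow> W' v = W v"
    using uw run_Suc.hyps(5) by auto
  have or: "origin G k = u" "origin G (opp G k) = w" "origin G a = u" "origin G b = w"
    "origin G s = ?u" "origin G t = ?w" using p' q' run_Suc.hyps(2,3) by auto
  note inj = rank_in_star_inj[OF fin]
  have fst_eq: "k = h" "a = s" "b = t" if "u = ?u"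
  proof -
    have "W' ?u = (rank_in_star G k, rank_in_star G a) # W u" using W'u that by simp
    then have r: "rank_in_star G k = rank_in_star G h" "rank_in_star G a = rank_in_star G s"
      using run_Suc.prems(3) by auto
    show kh: "k = h" by (rule inj[OF mem(5,1) _ r(1)]) (simp only: or that)
    show "a = s" by (rule inj[OF mem(7,3) _ r(2)]) (simp only: or that)
    have wu: "w = ?w" using kh or(2) by simp
    have "W' ?w = (rank_in_star G (opp G k), rank_in_star G b) # W w" using W'w kh run_Suc.hyps by simp
    then have "rank_in_star G b = rank_in_star G t" using run_Suc.prems(4) by simp
    then show "b = t" by (intro inj[OF mem(8,4)]) (simp_all only: or wu)
  qed
  have snd_eq: "k = opp G h" "a = t" "b = s" if "u = ?w"
  proof -
    have "W' ?w = (rank_in_star G k, rank_in_star G a) # W u" using W'u that by simp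
    then have r: "rank_in_star G k = rank_in_star G (opp G h)" "rank_in_star G a = rank_in_star G t"
      using run_Suc.prems(4) by auto
    show kh: "k = opp G h" by (rule inj[OF mem(5,2) _ r(1)]) (simp only: or that)
    show "a = t" by (rule inj[OF mem(7,4) _ r(2)]) (simp only: or that)
    have oo: "opp G k = h" using kh pivot_sym(3)[OF fin p] by simp
    have wu: "w = ?u" using oo or(2) by simp
    have "W' ?u = (rank_in_star G (opp G k), rank_in_star G b) # W w" using W'w oo run_Suc.hyps by simp
    then have "rank_in_star G b = rank_in_star G s" using run_Suc.prems(3) by simp
    then show "b = s" by (intro inj[OF mem(8,3)]) (simp_all only: or wu)
  qed
  have w_u: "u = ?w" if "w = ?u"
  proof -
    have "W' ?u = (rank_in_star G (opp G k), rank_in_star G b) # W w" using W'w that by simp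
    then have "rank_in_star G (opp G k) = rank_in_star G h" using run_Suc.prems(3) by simp
    then have "opp G k = h" by (intro inj[OF mem(6,1)]) (simp_all only: or that)
    then show ?thesis using pivot_sym(3)[OF fin q] or(1) by simp
  qed
  have w_w: "u = ?u" if "w = ?w"
  proof -
    have "W' ?w = (rank_in_star G (opp G k), rank_in_star G b) # W w" using W'w that by simp
    then have "rank_in_star G (opp G k) = rank_in_star G (opp G h)" using run_Suc.prems(4) by simp
    then have "opp G k = opp G h" by (intro inj[OF mem(6,2)]) (simp_all only: or that)
    then have "opp G (opp G k) = opp G (opp G h)" by simp
    then have "k = h" by (simp only: pivot_sym(3)[OF fin q] pivot_sym(3)[OF fin p])
    then show ?thesis using or(1) by simp
  qed
  \<comment> \<open>If the first move of the run meets an end of the given edge, the letter there is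
    the same for both, and equal ranks at one vertex mean equal half-edges; hence it is the given
    move, possibly seen from its other end (\<open>snd_eq\<close>). Otherwise the edges have no
    common end, and the given move is hoisted past the first one.\<close>
  consider "u = ?u" | "u = ?w" | "{?u, ?w} \<inter> {u, w} = {}" using w_u w_w by blast
  then show ?case
  proof cases
    case 1
    note e = fst_eq[OF 1]
    have "w = ?w" using e or(2) by simp
    then have Weq: "W'(?u := \<alpha>, ?w := \<beta>) = W"
      using W'u W'w W'o run_Suc.prems(3,4) 1 by (intro ext) auto
    have "run n (swap G s t) (W'(?u := \<alpha>, ?w := \<beta>)) G'"
      unfolding Weq using run_Suc.hyps(4) unfolding e .
    then show ?thesis by blast
  next
    case 2
    note e = snd_eq[OF 2]
    have "w = ?u" using e or(2) pivot_sym(3)[OF fin p] by simp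
    then have Weq: "W'(?u := \<alpha>, ?w := \<beta>) = W"
      using W'u W'w W'o run_Suc.prems(3,4) 2 by (intro ext) auto
    have "run n (swap G s t) (W'(?u := \<alpha>, ?w := \<beta>)) G'"
      unfolding Weq using run_Suc.hyps(4) unfolding e pivot_sym(2)[OF fin p] .
    then show ?thesis by blast
  next
    case 3
    have dis: "{?u, ?w} \<inter> {origin G k, origin G (opp G k)} = {}"
      "{origin G k, origin G (opp G k)} \<inter> {?u, ?w} = {}" using 3 run_Suc.hyps(2,3) by auto
    note o1 = pivot_swap_other[OF fin p q dis(1)] and o2 = pivot_swap_other[OF fin q p dis(2)]
    have Wu: "W ?u = W' ?u" "W ?w = W' ?w" using W'o 3 by auto
    have fin': "finite_graph (swap G a b)" using finite_graph_swap[OF fin] mem by blast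
    have IHp: "W ?u = (rank_in_star (swap G a b) h, rank_in_star (swap G a b) s) # \<alpha>"
      "W ?w = (rank_in_star (swap G a b) (opp G h), rank_in_star (swap G a b) t) # \<beta>"
      using o1(4) Wu run_Suc.prems(3,4) by auto
    obtain m where m: "n = Suc m"
      "run m (swap (swap G a b) s t) (W(?u := \<alpha>, ?w := \<beta>)) G'"
      using run_Suc.IH[OF fin' o1(1), of \<alpha> \<beta>] unfolding swap_simps(3) o1(2,3)
      using IHp by blast
    have "run (Suc m) (swap G s t) (W'(?u := \<alpha>, ?w := \<beta>)) G'"
    proof (rule run.run_Suc[OF o2(1), where u = u and w = w])
      show "u = origin (swap G s t) k" "w = origin (swap G s t) (opp (swap G s t) k)"
        unfolding swap_simps(3) o2(2,3) using run_Suc.hyps by auto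
      show "run m (swap (swap G s t) a b) (W(?u := \<alpha>, ?w := \<beta>)) G'" using m(2) o1(5) by simp
      have rk: "rank_in_star (swap G s t) k = rank_in_star G k" "rank_in_star (swap G s t) a = rank_in_star G a"
        "rank_in_star (swap G s t) (opp G k) = rank_in_star G (opp G k)" "rank_in_star (swap G s t) b = rank_in_star G b"
        using o2(4) by auto
      show "W'(?u := \<alpha>, ?w := \<beta>) = (W(?u := \<alpha>, ?w := \<beta>))
        (u := (rank_in_star (swap G s t) k, rank_in_star (swap G s t) a) # (W(?u := \<alpha>, ?w := \<beta>)) u,
         w := (rank_in_star (swap G s t) (opp (swap G s t) k), rank_in_star (swap G s t) b) # (W(?u := \<alpha>, ?w := \<beta>)) w)"
        unfolding swap_simps(3) rk using W'u W'w W'o 3 by (intro ext) auto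
    qed
    then show ?thesis using m(1) by blast
  qed
qed

text \<open>The first move of one run can be hoisted to the front of the other, since its letters
  begin the words at both of its ends. The two remainders then start from the same graph with the
  same words.\<close>

lemma run_unique:
  assumes "run n G W H" "run n' G W H'" "finite_graph G"
  shows "H = H'"
  using assms
proof (induction arbitrary: n' rule: run.induct)
  case (run_0 G)
  from run_0.prems(1) show ?case
  proof cases
    case (run_Suc h s t u w n W)
    \<comment> \<open>All words are empty, whereas a nonempty run would have written a letter at
      \<open>w\<close>.\<close>
    then show ?thesis using fun_cong[OF run_Suc(6), of w] by simp
  qed auto
next
  case (run_Suc G h s t u w n W H W')
  have "u \<noteq> w" using run_Suc.hyps(1-3) by (simp add: pivot_def)
  then have W': "W' u = (rank_in_star G h, rank_in_star G s) # W u"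
    "W' w = (rank_in_star G (opp G h), rank_in_star G t) # W w"
    using run_Suc.hyps(5) by auto
  obtain m where m: "n' = Suc m" "run m (swap G s t) (W'(u := W u, w := W w)) H'"
    using run_hoist[OF run_Suc.prems run_Suc.hyps(1)] W' run_Suc.hyps(2,3) by blast
  have "W'(u := W u, w := W w) = W" using run_Suc.hyps(5) by auto
  moreover have "finite_graph (swap G s t)"
    using finite_graph_swap[OF run_Suc.prems(2)] run_Suc.hyps(1) by (auto simp: pivot_def)
  ultimately show ?case using run_Suc.IH m(2) by auto
qed

lemma run_exists:
  assumes "(whitehead_move ^^ n) G G'" "finite_graph G"
  shows "\<exists>W. run n G W G'"
  using assms
proof (induction n arbitrary: G)
  case 0
  then show ?case using run_0 by auto
next
  case (Suc n)
  from relpowp_Suc_D2[OF Suc.prems(1)] obtain H where H: "whitehead_move G H" "(whitehead_move ^^ n) H G'"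
    by blast
  then obtain h s t where p: "pivot G h s t" "H = swap G s t"
    using whitehead_move_iff[OF Suc.prems(2)] by blast
  have "finite_graph H"
    using finite_graph_swap[OF Suc.prems(2)] p by (auto simp: pivot_def)
  then obtain W where "run n H W G'" using Suc.IH[OF H(2)] by blast
  then show ?case using run_Suc[OF p(1) refl refl _ refl] p(2) by blast
qed

section \<open>Counting families of words\<close>

definition words :: "'v set \<Rightarrow> 'a set \<Rightarrow> nat \<Rightarrow> ('v \<Rightarrow> 'a list) set" where
  "words V A m = {W. (\<forall>v. v \<notin> V \<longrightarrow> W v = []) \<and> (\<forall>v\<in>V. set (W v) \<subseteq> A) \<and> (\<Sum>v\<in>V. length (W v)) = m}"

lemma run_words:
  assumes "run n G W G'" "finite_graph G"
  shows "W \<in> words (verts G) ({..<3} \<times> {..<3}) (2 * n)"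
  using assms
proof (induction rule: run.induct)
  case (run_0 G)
  then show ?case by (simp add: words_def)
next
  case (run_Suc G h s t u w n W G' W')
  note p' = run_Suc.hyps(1)[unfolded pivot_def] and fin = run_Suc.prems
  have "finite_graph (swap G s t)" using finite_graph_swap[OF fin] p' by blast
  then have IH: "W \<in> words (verts G) ({..<3} \<times> {..<3}) (2 * n)" using run_Suc.IH by simp
  have mem: "h \<in> halfs G" "opp G h \<in> halfs G" "s \<in> halfs G" "t \<in> halfs G"
    and V: "u \<in> verts G" "w \<in> verts G" and uw: "u \<noteq> w"
    using p' finite_graphD[OF fin] run_Suc.hyps(2,3) by auto
  have rk: "rank_in_star G x < 3" if "x \<in> {h, opp G h, s, t}" for x
    using rank_in_star_less[OF fin, of x] that mem p' by auto
  have W': "W' v = (if v = u then (rank_in_star G h, rank_in_star G s) # W u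
      else if v = w then (rank_in_star G (opp G h), rank_in_star G t) # W w else W v)" for v
    using run_Suc.hyps(5) uw by auto
  have finV: "finite (verts G)" using fin by (simp add: finite_graph_def)
  have "(\<Sum>v\<in>verts G. length (W' v)) = (\<Sum>v\<in>verts G. length (W v) + (if v = u then 1 else 0) + (if v = w then 1 else 0))"
    using uw by (intro sum.cong) (auto simp: W')
  also have "\<dots> = (\<Sum>v\<in>verts G. length (W v)) + 2"
    using finV V by (simp add: sum.distrib)
  also have "\<dots> = 2 * Suc n" using IH by (simp add: words_def)
  finally show ?case
    using IH V rk by (auto simp: words_def W' split: if_splits)
qed

text \<open>\<open>None\<close> terminates the word of each vertex, so families of words of total
  length \<open>m\<close> become strings of fixed length \<open>card V + m\<close> over
  \<open>card A + 1\<close> symbols.\<close>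

fun encode_words :: "'v list \<Rightarrow> ('v \<Rightarrow> 'a list) \<Rightarrow> 'a option list" where
  "encode_words [] W = []"
| "encode_words (v # vs) W = map Some (W v) @ None # encode_words vs W"

lemma map_Some_append_None_inj:
  "map Some xs @ None # r = map Some ys @ None # r' \<Longrightarrow> xs = ys \<and> r = r'"
proof (induction xs arbitrary: ys)
  case Nil
  then show ?case by (cases ys) auto
next
  case (Cons x xs)
  then show ?case by (cases ys) auto
qed

lemma encode_words_inj:
  "encode_words vs W = encode_words vs W' \<Longrightarrow> v \<in> set vs \<Longrightarrow> W v = W' v"
  by (induction vs) (auto dest: map_Some_append_None_inj)

lemma length_encode_words:
  "length (encode_words vs W) = length vs + (\<Sum>v\<leftarrow>vs. length (W v))"
  by (induction vs) auto

lemma set_encode_words: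
  "(\<And>v. v \<in> set vs \<Longrightarrow> set (W v) \<subseteq> A) \<Longrightarrow> set (encode_words vs W) \<subseteq> insert None (Some ` A)"
  by (induction vs) auto

lemma card_words:
  assumes "finite V" "finite A"
  shows "finite (words V A m)" "card (words V A m) \<le> (card A + 1) ^ (card V + m)"
proof -
  obtain vs where vs: "set vs = V" "distinct vs" using finite_distinct_list[OF assms(1)] by blast
  let ?L = "{xs. set xs \<subseteq> insert None (Some ` A) \<and> length xs = card V + m}"
  have inj: "inj_on (encode_words vs) (words V A m)"
  proof (rule inj_onI, rule ext)
    fix W W' v assume W: "W \<in> words V A m" "W' \<in> words V A m" "encode_words vs W = encode_words vs W'"
    show "W v = W' v"
      using W encode_words_inj[OF W(3), of v] vs(1) by (cases "v \<in> V") (auto simp: words_def)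
  qed
  have sub: "encode_words vs ` words V A m \<subseteq> ?L"
  proof
    fix xs assume "xs \<in> encode_words vs ` words V A m"
    then obtain W where W: "W \<in> words V A m" "xs = encode_words vs W" by blast
    have "(\<Sum>v\<leftarrow>vs. length (W v)) = m"
      using W(1) vs by (simp add: words_def sum_list_distinct_conv_sum_set)
    then show "xs \<in> ?L"
      using W vs set_encode_words[of vs W A] distinct_card[OF vs(2)]
      by (auto simp: words_def length_encode_words)
  qed
  have finL: "finite ?L" using finite_lists_length_eq[of "insert None (Some ` A)"] assms by simp
  show "finite (words V A m)" using inj sub finL by (meson finite_imageD finite_subset)
  have "card (words V A m) \<le> card ?L" using card_inj_on_le[OF inj sub finL] .
  also have "\<dots> = (card A + 1) ^ (card V + m)"
    using card_lists_length_eq[of "insert None (Some ` A)" "card V + m"] assms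
    by (simp add: card_image)
  finally show "card (words V A m) \<le> (card A + 1) ^ (card V + m)" .
qed

text \<open>The local words decide the final graph, so it suffices to count them:
  \<open>10 = 3 * 3 + 1\<close> symbols including the terminator, and \<open>2 * n\<close> letters
  from \<open>n\<close> moves. The base does not grow with the graph, which is what saves the
  logarithm in the lower bound.\<close>

lemma card_reachable:
  fixes G :: ngraph
  assumes "finite_graph G"
  shows "finite {G'. (whitehead_move ^^ n) G G'}"
    "card {G'. (whitehead_move ^^ n) G G'} \<le> 10 ^ (card (verts G) + 2 * n)"
proof -
  let ?Q = "{G'. (whitehead_move ^^ n) G G'}"
  let ?W = "words (verts G) ({..<3::nat} \<times> {..<3::nat}) (2 * n)"
  have finV: "finite (verts G)" using assms by (simp add: finite_graph_def)
  note cw = card_words[OF finV, of "{..<3::nat} \<times> {..<3::nat}" "2 * n"]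
  obtain w where w: "\<And>G'. G' \<in> ?Q \<Longrightarrow> run n G (w G') G'"
    using run_exists[OF _ assms] by (metis mem_Collect_eq)
  have inj: "inj_on w ?Q" using w run_unique[OF _ _ assms] by (intro inj_onI) metis
  have sub: "w ` ?Q \<subseteq> ?W" using w run_words[OF _ assms] by blast
  have fW: "finite ?W" using cw(1) by simp
  show "finite ?Q" using inj sub fW by (meson finite_imageD finite_subset)
  have "card ?Q \<le> card ?W" by (rule card_inj_on_le[OF inj sub fW])
  also have "\<dots> \<le> 10 ^ (card (verts G) + 2 * n)" using cw(2) by (simp add: card_cartesian_product)
  finally show "card ?Q \<le> 10 ^ (card (verts G) + 2 * n)" .
qed

subsection \<open>Combs\<close>

fun is_comb :: "'h dtree \<Rightarrow> bool" where
  "is_comb (Lf h) = True"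
| "is_comb (Nd h (Lf b) D) = is_comb D"
| "is_comb (Nd h (Nd k l r) D) = False"

fun comb_bits :: "nat dtree \<Rightarrow> bool list" where
  "comb_bits (Lf h) = []"
| "comb_bits (Nd h l r) = (rt l < rt r) # comb_bits r"

lemma is_comb_of_shape: "shape \<mu> D = comb ys \<Longrightarrow> ys \<noteq> [] \<Longrightarrow> is_comb D"
proof (induction ys arbitrary: D rule: comb.induct)
  case (2 x)
  then show ?case by (cases D) auto
next
  case (3 x y zs)
  then obtain h l r where D: "D = Nd h l r" by (cases D) auto
  then show ?case using 3 by (cases l) auto
qed simp

lemma length_comb_bits: "is_comb D \<Longrightarrow> Suc (length (comb_bits D)) = length (slots D)"
  by (induction D rule: is_comb.induct) auto

text \<open>Starting at the root, the next vertex and its star are forced; of its two other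
  half-edges one is a tooth and one continues the spine. The bit compares their names and so tells
  which is which.\<close>

lemma comb_determined:
  assumes "is_comb D" "is_comb D'" "valid G D" "valid G D'" "rt D = rt D'" "comb_bits D = comb_bits D'"
  shows "D = D'"
  using assms
proof (induction D arbitrary: D' rule: is_comb.induct)
  case (1 h)
  then show ?case by (cases D') auto
next
  case (2 h b D)
  then obtain h' l' E where D': "D' = Nd h' l' E" by (cases D') auto
  then obtain b' where b': "l' = Lf b'" using 2 by (cases l') auto
  have h: "h' = h" using 2 D' by simp
  have st: "{opp G h, b, rt D} = {opp G h, b', rt E}" "distinct [opp G h, b, rt D]" "distinct [opp G h, b', rt E]"
    and bits: "b < rt D \<longleftrightarrow> b' < rt E" "comb_bits D = comb_bits E"
    using 2 D' b' h by auto
  have e: "{opp G h, b, rt D} - {opp G h} = {b, rt D}" "{opp G h, b', rt E} - {opp G h} = {b', rt E}"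
    using st(2,3) by auto
  have "{b, rt D} = {opp G h, b, rt D} - {opp G h}" by (rule e(1)[symmetric])
  also have "\<dots> = {opp G h, b', rt E} - {opp G h}" by (rule arg_cong[OF st(1)])
  also have "\<dots> = {b', rt E}" by (rule e(2))
  finally have "{b, rt D} = {b', rt E}" .
  then have "(b = b' \<and> rt D = rt E) \<or> (b = rt E \<and> rt D = b')" by (auto simp: doubleton_eq_iff)
  then have "b = b' \<and> rt D = rt E" using bits(1) st(2,3) by auto
  moreover have "D = E" using 2 D' b' bits calculation by auto
  ultimately show ?case using D' b' h by simp
qed simp

text \<open>For a fixed graph and tree, labels at most \<open>p\<close> are read off from the
  leaves. The common prefix \<open>pre\<close> fixes the slots of all first halves of cut edges, and
  \<open>mate\<close> then gives the second halves.\<close>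

lemma presents_labels_determined:
  assumes T: "trivalent_graph g p G" and pos: "2 * int g - 2 + int p > 0"
    and P: "presents g p G s D \<mu>" "presents g p G s D \<mu>'"
    and ys: "map \<mu> (slots D) = pre @ zs" "map \<mu>' (slots D) = pre @ zs'"
    and pre: "set pre = {y \<in> {2..p + 2 * g}. y > p \<and> odd (y - p)}"
  shows "zs = zs'"
proof -
  note fin = trivalentD(1)[OF T]
  have ne: "trivalent_verts G \<noteq> {}" using card_trivalent_verts[OF T] pos by auto
  define S where "S = set (s # slots D)"
  have sp: "spanning G s D" and mu1: "\<mu> s = 1" "\<mu>' s = 1"
    and bij: "bij_betw \<mu> S {1..p + 2 * g}" "bij_betw \<mu>' S {1..p + 2 * g}"
    and r: "\<And>x. x \<in> S \<Longrightarrow> if \<mu> x \<le> p then origin G (opp G x) \<in> leaves G \<and> label G (origin G (opp G x)) = \<mu> x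
            else opp G x \<in> S \<and> \<mu> (opp G x) = mate p (\<mu> x)"
    and r': "\<And>x. x \<in> S \<Longrightarrow> if \<mu>' x \<le> p then origin G (opp G x) \<in> leaves G \<and> label G (origin G (opp G x)) = \<mu>' x
            else opp G x \<in> S \<and> \<mu>' (opp G x) = mate p (\<mu>' x)"
    using P by (auto simp: presents_def slot_labelling_def S_def)
  have Sh: "y \<in> halfs G" "origin G y \<in> trivalent_verts G" if "y \<in> S" for y
    using spanning_slots(3)[OF sp ne fin, of y] that spanning_set_node_halfs[OF sp] by (auto simp: S_def)
  \<comment> \<open>Whether the partner of a slot lies at a leaf or is a slot is a property of the
    graph, so both labellings agree on it.\<close>
  have le: "\<mu> x \<le> p \<longleftrightarrow> \<mu>' x \<le> p" if x: "x \<in> S" for x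
  proof -
    have "opp G x \<in> S \<Longrightarrow> origin G (opp G x) \<notin> leaves G"
      using Sh(2)[of "opp G x"] leaf_not_trivalent[of "origin G (opp G x)" G] by blast
    then show ?thesis using r[OF x] r'[OF x] by (auto split: if_splits)
  qed
  have dis: "distinct (pre @ zs)"
    using presents_leaf_list(1)[OF T pos P(1)] ys(1) by (simp only: leaf_list_shape)
  \<comment> \<open>For \<open>p = 0\<close> the label 1 is itself the first half of a pair; it is
    absent from \<open>pre\<close> and is pinned by the root instead.\<close>
  have odd_case: "\<mu> x = \<mu>' x" if x: "x \<in> S" "\<mu> x > p" "odd (\<mu> x - p)" for x
  proof (cases "\<mu> x = 1")
    case True
    have "s \<in> S" by (simp add: S_def)
    then have "x = s" using True mu1 x bij(1) by (auto simp: bij_betw_def inj_on_def)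
    then show ?thesis using mu1 by simp
  next
    case False
    then have "x \<noteq> s" using mu1 by auto
    then have "x \<in> set (slots D)" using x by (simp add: S_def)
    then obtain i where i: "i < length (slots D)" "slots D ! i = x" by (auto simp: in_set_conv_nth)
    have len: "length (slots D) = length (pre @ zs)" "length (slots D) = length (pre @ zs')"
      using ys by (metis length_map)+
    have mx: "\<mu> x = (pre @ zs) ! i" "\<mu>' x = (pre @ zs') ! i"
      using i ys by (metis nth_map)+
    have "\<mu> x \<in> {1..p + 2 * g}" using bij_betwE[OF bij(1)] x(1) by blast
    then have "\<mu> x \<in> set pre" using pre x False by auto
    then obtain j where j: "j < length pre" "pre ! j = \<mu> x" by (auto simp: in_set_conv_nth)
    then have "(pre @ zs) ! j = (pre @ zs) ! i" using mx by (simp add: nth_append)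
    then have "j = i" using dis i(1) j(1) len by (simp add: nth_eq_iff_index_eq)
    then show ?thesis using mx j(1) by (simp add: nth_append)
  qed
  have "\<mu> x = \<mu>' x" if x: "x \<in> S" for x
  proof -
    consider "\<mu> x \<le> p" | "\<mu> x > p" "odd (\<mu> x - p)" | "\<mu> x > p" "even (\<mu> x - p)" by linarith
    then show ?thesis
    proof cases
      case 1
      then have "\<mu>' x \<le> p" using le[OF x] by blast
      then have "label G (origin G (opp G x)) = \<mu>' x" using r'[OF x] by simp
      moreover have "label G (origin G (opp G x)) = \<mu> x" using r[OF x] 1 by simp
      ultimately show ?thesis by simp
    next
      case 2
      then show ?thesis using odd_case[OF x] by blast
    next
      case 3
      then have ox: "opp G x \<in> S" "\<mu> (opp G x) = \<mu> x - 1" using r[OF x] by (auto simp: mate_def)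
      have m: "\<mu> (opp G x) > p" "odd (\<mu> (opp G x) - p)" using 3 ox(2) by presburger+
      then have e: "\<mu>' (opp G x) = \<mu> x - 1" using odd_case[OF ox(1)] ox(2) by simp
      have "\<mu>' (opp G (opp G x)) = mate p (\<mu>' (opp G x))" using r'[OF ox(1)] m e ox(2) by simp
      also have "\<dots> = \<mu> x" using e m ox(2) 3 by (simp add: mate_def)
      finally show ?thesis using finite_graphD(4)[OF fin Sh(1)[OF x]] by simp
    qed
  qed
  then have "map \<mu> (slots D) = map \<mu>' (slots D)" by (simp add: S_def)
  then show ?thesis using ys by simp
qed

section \<open>Transport of presentations along isomorphisms\<close>

lemma valid_iso:
  assumes fin: "finite_graph G" and i: "iso_by f \<phi> G G'" and "valid G D"
  shows "valid G' (map_dtree \<phi> D) \<and> node_verts G' (map_dtree \<phi> D) = map f (node_verts G D) \<and>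
    rt (map_dtree \<phi> D) = \<phi> (rt D) \<and> slots (map_dtree \<phi> D) = map \<phi> (slots D)"
  using assms(3)
proof (induction D)
  case (Lf h)
  then show ?case using i by (auto simp: iso_by_def bij_betw_def)
next
  case (Nd h l r)
  let ?v = "origin G (opp G h)"
  have h: "h \<in> halfs G" using Nd.prems by simp
  note oh = finite_graphD[OF fin h]
  have i': "bij_betw \<phi> (halfs G) (halfs G')" "\<And>x. x \<in> halfs G \<Longrightarrow> origin G' (\<phi> x) = f (origin G x)"
    "\<And>x. x \<in> halfs G \<Longrightarrow> opp G' (\<phi> x) = \<phi> (opp G x)" using i by (auto simp: iso_by_def)
  have o: "opp G' (\<phi> h) = \<phi> (opp G h)" "origin G' (opp G' (\<phi> h)) = f ?v" using i' h oh by auto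
  have v: "?v \<in> verts G" using finite_graphD(1)[OF fin oh(2)] .
  have "star G' (f ?v) = \<phi> ` star G ?v" by (rule iso_by_star[OF fin i v])
  also have "\<dots> = {\<phi> (opp G h), \<phi> (rt l), \<phi> (rt r)}" using Nd.prems by simp
  finally have st: "star G' (f ?v) = {\<phi> (opp G h), \<phi> (rt l), \<phi> (rt r)}" .
  have "rt l \<in> halfs G" "rt r \<in> halfs G" using Nd.prems valid_rt by auto
  then have "distinct [\<phi> (opp G h), \<phi> (rt l), \<phi> (rt r)]"
    using Nd.prems oh i'(1) by (auto simp: bij_betw_def inj_on_def)
  moreover have "\<phi> h \<in> halfs G'" using h i'(1) by (auto simp: bij_betw_def)
  ultimately show ?case using Nd st o by simp
qed

lemma valid_slots_halfs: "valid G D \<Longrightarrow> set (slots D) \<subseteq> halfs G"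
  by (induction D) auto

text \<open>Lifting a sequence of moves between classes ends at an isomorphic copy of the intended
  graph, so the comb presented by the latter has to be carried over; \<open>\<mu>'\<close> is
  \<open>\<mu>\<close> composed with the inverse isomorphism.\<close>

lemma presents_iso:
  assumes T: "trivalent_graph g p G" "trivalent_graph g p G'" and P: "presents g p G s D \<mu>"
    and iso: "isomorphic G G'"
  shows "\<exists>s' D' \<mu>'. presents g p G' s' D' \<mu>' \<and> shape \<mu>' D' = shape \<mu> D"
proof -
  note fin = trivalentD(1)[OF T(1)]
  obtain f \<phi> where i: "iso_by f \<phi> G G'" using iso by (auto simp: isomorphic_iff)
  have bp: "bij_betw \<phi> (halfs G) (halfs G')" and bf: "bij_betw f (verts G) (verts G')"
    and o: "\<And>x. x \<in> halfs G \<Longrightarrow> origin G' (\<phi> x) = f (origin G x)"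
    "\<And>x. x \<in> halfs G \<Longrightarrow> opp G' (\<phi> x) = \<phi> (opp G x)"
    and lab: "\<And>v. v \<in> leaves G \<Longrightarrow> label G' (f v) = label G v"
    using i by (auto simp: iso_by_def)
  have P': "valid G D" "rt D = opp G s" "s \<in> halfs G" "distinct (node_verts G D)"
     "set (node_verts G D) = trivalent_verts G"
     "slot_labelling g p G (set (s # slots D)) \<mu>" "\<mu> s = 1" using P by (auto simp: presents_def spanning_def)
  define \<mu>' where "\<mu>' y = \<mu> (inv_into (halfs G) \<phi> y)" for y
  have mu': "\<mu>' (\<phi> x) = \<mu> x" if "x \<in> halfs G" for x
    using that bp by (simp add: \<mu>'_def bij_betw_inv_into_left)
  note vi = valid_iso[OF fin i P'(1)]
  have Sh: "set (s # slots D) \<subseteq> halfs G" using valid_slots_halfs[OF P'(1)] P'(3) by simp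
  have sh: "shape \<mu>' (map_dtree \<phi> E) = shape \<mu> E" if "set (slots E) \<subseteq> halfs G" for E
    using that by (induction E) (auto simp: mu')
  have tv: "trivalent_verts G' = f ` trivalent_verts G"
  proof -
    have "f ` verts G = verts G'" using bf by (simp add: bij_betw_def)
    then show ?thesis using iso_by_valence[OF fin i] unfolding trivalent_verts_def by force
  qed
  have subv: "trivalent_verts G \<subseteq> verts G" by (auto simp: trivalent_verts_def)
  have "spanning G' (\<phi> s) (map_dtree \<phi> D)"
    unfolding spanning_def using vi P' o(2)[OF P'(3)] tv bp bf subv
    by (auto simp: distinct_map bij_betw_def inj_on_def subset_iff)
  moreover have "slot_labelling g p G' (set (\<phi> s # slots (map_dtree \<phi> D))) \<mu>'"
    unfolding slot_labelling_def
  proof (intro conjI ballI)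
    have S': "set (\<phi> s # slots (map_dtree \<phi> D)) = \<phi> ` set (s # slots D)" using vi by simp
    have injS: "inj_on \<phi> (set (s # slots D))"
      using bp Sh by (meson bij_betw_def inj_on_subset)
    have b: "bij_betw \<mu> (set (s # slots D)) {1..p + 2 * g}" using P'(6) by (simp add: slot_labelling_def)
    have "inj_on \<mu>' (\<phi> ` set (s # slots D))"
    proof (rule inj_onI)
      fix x y assume xy: "x \<in> \<phi> ` set (s # slots D)" "y \<in> \<phi> ` set (s # slots D)" "\<mu>' x = \<mu>' y"
      then obtain a c where ac: "a \<in> set (s # slots D)" "c \<in> set (s # slots D)" "x = \<phi> a" "y = \<phi> c" by blast
      then have "\<mu> a = \<mu> c" using xy(3) mu' Sh by (metis subsetD)
      then show "x = y" using ac b by (metis bij_betw_def inj_on_def)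
    qed
    moreover have "\<mu>' ` \<phi> ` set (s # slots D) = \<mu> ` set (s # slots D)"
      unfolding image_image by (rule image_cong[OF refl]) (use mu' Sh in blast)
    ultimately show "bij_betw \<mu>' (set (\<phi> s # slots (map_dtree \<phi> D))) {1..p + 2 * g}"
      using b unfolding S' bij_betw_def by metis
    fix x assume "x \<in> set (\<phi> s # slots (map_dtree \<phi> D))"
    then obtain a where a: "a \<in> set (s # slots D)" "x = \<phi> a" unfolding S' by blast
    have ah: "a \<in> halfs G" using a Sh by blast
    note oa = finite_graphD[OF fin ah]
    have V: "origin G (opp G a) \<in> verts G" using finite_graphD(1)[OF fin oa(2)] .
    have "if \<mu> a \<le> p then origin G (opp G a) \<in> leaves G \<and> label G (origin G (opp G a)) = \<mu> a
            else opp G a \<in> set (s # slots D) \<and> \<mu> (opp G a) = mate p (\<mu> a)"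
      using P'(6) a(1) unfolding slot_labelling_def by blast
    then show "if \<mu>' x \<le> p then origin G' (opp G' x) \<in> leaves G' \<and> label G' (origin G' (opp G' x)) = \<mu>' x
            else opp G' x \<in> set (\<phi> s # slots (map_dtree \<phi> D)) \<and> \<mu>' (opp G' x) = mate p (\<mu>' x)"
      unfolding S' a(2) mu'[OF ah] o(2)[OF ah] o(1)[OF oa(2)] mu'[OF oa(2)]
      using iso_by_leaves[OF fin i V] lab by (auto split: if_splits)
  qed
  moreover have "\<mu>' (\<phi> s) = 1" using mu' P' by simp
  ultimately have "presents g p G' (\<phi> s) (map_dtree \<phi> D) \<mu>'" by (simp add: presents_def)
  then show ?thesis using sh Sh by auto
qed

subsection \<open>The lower bound\<close>

lemma card_halfs_le:
  assumes T: "trivalent_graph g p G"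
  shows "card (halfs G) \<le> 3 * card (verts G)"
proof -
  have fin: "finite (verts G)" using trivalentD(1)[OF T] by (simp add: finite_graph_def)
  have "halfs G = (\<Union>v\<in>verts G. star G v)"
    using finite_graphD(1)[OF trivalentD(1)[OF T]] by auto
  then have "card (halfs G) \<le> (\<Sum>v\<in>verts G. card (star G v))" using card_UN_le[OF fin] by metis
  also have "\<dots> \<le> (\<Sum>v\<in>verts G. 3)"
  proof (rule sum_mono)
    fix v assume "v \<in> verts G"
    then have "valence G v = 1 \<or> valence G v = 3" by (rule trivalentD(4)[OF T])
    then show "card (star G v) \<le> 3" unfolding valence_def by linarith
  qed
  finally show ?thesis by simp
qed

lemma halfs_whitehead_relpowp:
  assumes "(whitehead_move ^^ n) G G'" "trivalent_graph g p G"
  shows "halfs G' = halfs G"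
  using assms(1)
proof (induction n arbitrary: G')
  case (Suc n)
  then obtain H where H: "(whitehead_move ^^ n) G H" "whitehead_move H G'" by auto
  have "finite_graph H" using trivalent_graph_whitehead_relpowp[OF H(1) assms(2)] by (rule trivalentD(1))
  then have "halfs G' = halfs H" using H(2) whitehead_move_iff by (metis swap_simps(2))
  then show ?case using Suc.IH[OF H(1)] by simp
qed simp

text \<open>Every permutation \<open>zs\<close> of the free labels gives a comb, presented by some
  graph \<open>H\<close> within \<open>k\<close> moves of \<open>G\<close>, and the triple of
  \<open>H\<close>, the root slot and the bits of the comb recovers \<open>zs\<close>. The right
  side counts such triples: graphs reached by at most \<open>k\<close> moves, half-edges, and bit
  lists of length \<open>p + 2 * g - 2\<close>.\<close>

lemma fact_le_of_diam_W:
  fixes G :: ngraph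
  assumes T: "trivalent_graph g p G" and pos: "2 * int g - 2 + int p > 0" and diam: "diam_W g p \<le> enat k"
  shows "fact (p + g - 1) \<le>
    (k + 1) * 10 ^ (card (verts G) + 2 * k) * (3 * card (verts G)) * (2 ^ (p + 2 * g - 2) :: nat)"
proof -
  note fin = trivalentD(1)[OF T]
  define pre where "pre = filter (\<lambda>y. y > p \<and> odd (y - p)) [2..<p + 2 * g + 1]"
  have pre: "set pre = {y \<in> {2..p + 2 * g}. y > p \<and> odd (y - p)}" "distinct pre"
    by (auto simp: pre_def)
  define R where "R = {2..p + 2 * g} - set pre"
  have finR: "finite R" by (simp add: R_def)
  have "set pre \<subseteq> (\<lambda>i. p + 2 * i + 1) ` {..<g}"
  proof
    fix y assume "y \<in> set pre"
    then have y: "y \<le> p + 2 * g" "y > p" "odd (y - p)" using pre by auto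
    obtain i where "y - p = 2 * i + 1" using y(3) by (rule oddE)
    then show "y \<in> (\<lambda>i. p + 2 * i + 1) ` {..<g}" using y by (intro image_eqI[of _ _ i]) auto
  qed
  \<comment> \<open>For \<open>p = 0\<close> there is one entry fewer than \<open>g\<close>, since
    the label 1 belongs to the root.\<close>
  then have "card (set pre) \<le> g" using surj_card_le[of "{..<g}" "set pre"] by simp
  moreover have "card R = card {2..p + 2 * g} - card (set pre)"
    unfolding R_def by (rule card_Diff_subset) (auto simp: pre)
  ultimately have cR: "p + g - 1 \<le> card R" by simp
  define P where "P = permutations_of_set R"
  have cP: "card P = fact (card R)" unfolding P_def using finR by simp
  have subpre: "set pre \<subseteq> {2..p + 2 * g}" using pre(1) by blast
  have perm: "distinct (pre @ zs)" "set (pre @ zs) = {2..p + 2 * g}" "pre @ zs \<noteq> []" if "zs \<in> P" for zs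
  proof -
    have zs: "distinct zs" "set zs = R" using that by (auto simp: P_def permutations_of_set_def)
    show "distinct (pre @ zs)" using zs pre(2) by (auto simp: R_def)
    show set: "set (pre @ zs) = {2..p + 2 * g}" using zs(2) subpre by (auto simp: R_def)
    have "{2..p + 2 * g} \<noteq> {}" using pos by auto
    then show "pre @ zs \<noteq> []" using set by (metis list.set(1))
  qed
  have ex: "\<exists>r \<le> k. \<exists>H s D \<mu>. (whitehead_move ^^ r) G H \<and> presents g p H s D \<mu> \<and>
      shape \<mu> D = comb (pre @ zs)" if zs: "zs \<in> P" for zs
  proof -
    note ys = perm[OF zs] and ne = perm(3)[OF zs]
    obtain s D \<mu> where Pr: "presents g p G s D \<mu>" using presents_exists[OF T pos] by blast
    note ll = presents_leaf_list[OF T pos Pr]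
    have lc: "leaf_list (comb (pre @ zs)) = pre @ zs" by (rule leaf_list_comb[OF ne])
    \<comment> \<open>Any exponent will do: this sequence of moves only shows that a graph with the
      comb exists; the number of moves is bounded afterwards by the diameter.\<close>
    have "length (leaf_list (shape \<mu> D)) \<le> 2 ^ length (leaf_list (shape \<mu> D))"
      using less_exp by (rule less_imp_le)
    then obtain n where "tree_moves n (shape \<mu> D) (comb (pre @ zs))"
      using tree_moves_same_leaves[of "shape \<mu> D" "comb (pre @ zs)"] ll ys unfolding lc by metis
    from presents_tree_moves[OF T Pr this] obtain G' D' m where
      G': "(whitehead_move ^^ m) G G'" "presents g p G' s D' \<mu>" "shape \<mu> D' = comb (pre @ zs)" by blast
    have T': "trivalent_graph g p G'" by (rule trivalent_graph_whitehead_relpowp[OF G'(1) T])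
    let ?X = "iso_rel g p `` {G}" and ?Y = "iso_rel g p `` {G'}"
    have XY: "?X \<in> Graph g p" "?Y \<in> Graph g p" "G \<in> ?X" "G' \<in> ?Y"
      using T T' equiv_class_self[OF equiv_iso_rel, of G g p] equiv_class_self[OF equiv_iso_rel, of G' g p]
      unfolding Graph_eq by (auto intro!: quotientI)
    have "d_W g p ?X ?Y \<le> diam_W g p"
      unfolding diam_W_def by (intro SUP_upper2[OF XY(1)] SUP_upper XY(2))
    then have "d_W g p ?X ?Y \<le> enat k" using diam by (rule order_trans)
    then obtain r where r: "r \<le> k" "(?X, ?Y) \<in> moves g p ^^ r" unfolding d_W_le_iff by blast
    \<comment> \<open>Lifting from the given \<open>G\<close> makes all the graphs \<open>H\<close>
      share its half-edges, so that the count of reachable graphs applies to them.\<close>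
    from moves_relpow_lift[OF r(2) XY(3,1)] obtain H where
      H: "H \<in> ?Y" "(whitehead_move ^^ r) G H" by blast
    have TH: "trivalent_graph g p H" and "isomorphic G' H" using H(1) by (auto simp: iso_rel_def)
    from presents_iso[OF T' TH G'(2) this(2)] obtain s' D'' \<mu>' where
      "presents g p H s' D'' \<mu>'" "shape \<mu>' D'' = shape \<mu> D'" by blast
    then show ?thesis using r(1) H(2) unfolding G'(3) by blast
  qed
  then obtain rf Hf sf Df \<mu>f where f: "\<And>zs. zs \<in> P \<Longrightarrow> rf zs \<le> k \<and>
      (whitehead_move ^^ rf zs) G (Hf zs) \<and> presents g p (Hf zs) (sf zs) (Df zs) (\<mu>f zs) \<and>
      shape (\<mu>f zs) (Df zs) = comb (pre @ zs)"
    by metis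
  have TH: "trivalent_graph g p (Hf zs)" if "zs \<in> P" for zs
    using trivalent_graph_whitehead_relpowp[OF _ T] f[OF that] by blast
  have mp: "map (\<mu>f zs) (slots (Df zs)) = pre @ zs" if "zs \<in> P" for zs
  proof -
    have "leaf_list (shape (\<mu>f zs) (Df zs)) = pre @ zs"
      using f[OF that] leaf_list_comb[OF perm(3)[OF that]] by simp
    then show ?thesis by (simp only: leaf_list_shape)
  qed
  have ic: "is_comb (Df zs)" if "zs \<in> P" for zs
    using is_comb_of_shape[OF _ perm(3)[OF that]] f[OF that] by blast
  define F where "F zs = (Hf zs, sf zs, comb_bits (Df zs))" for zs
  have inj: "inj_on F P"
  proof (rule inj_onI)
    fix zs zs' assume z: "zs \<in> P" "zs' \<in> P" "F zs = F zs'"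
    have e: "Hf zs' = Hf zs" "sf zs' = sf zs" "comb_bits (Df zs) = comb_bits (Df zs')"
      using z(3) by (auto simp: F_def)
    have p1: "presents g p (Hf zs) (sf zs) (Df zs) (\<mu>f zs)" using f[OF z(1)] by blast
    have p2: "presents g p (Hf zs) (sf zs) (Df zs') (\<mu>f zs')" using f[OF z(2)] unfolding e(1,2) by blast
    have "valid (Hf zs) (Df zs)" "valid (Hf zs) (Df zs')" "rt (Df zs) = rt (Df zs')"
      using p1 p2 by (auto simp: presents_def spanning_def)
    then have D: "Df zs' = Df zs" using comb_determined[OF ic[OF z(1)] ic[OF z(2)]] e(3) by metis
    show "zs = zs'"
      by (rule presents_labels_determined[OF TH[OF z(1)] pos p1 p2[unfolded D] mp[OF z(1)] mp[OF z(2), unfolded D] pre(1)])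
  qed
  define Q where "Q = (\<Union>r\<in>{..k}. {H. (whitehead_move ^^ r) G H})"
  define B where "B = {bs :: bool list. set bs \<subseteq> UNIV \<and> length bs = p + 2 * g - 2}"
  have sub: "F ` P \<subseteq> Q \<times> halfs G \<times> B"
  proof
    fix x assume "x \<in> F ` P"
    then obtain zs where zs: "zs \<in> P" "x = F zs" by blast
    note fz = f[OF zs(1)]
    have "Hf zs \<in> Q" using fz by (auto simp: Q_def)
    moreover have "sf zs \<in> halfs G"
      using fz halfs_whitehead_relpowp[OF _ T, of "rf zs" "Hf zs"] by (auto simp: presents_def spanning_def)
    moreover have "comb_bits (Df zs) \<in> B"
    proof -
      have pr: "presents g p (Hf zs) (sf zs) (Df zs) (\<mu>f zs)" using fz by blast
      have "length (slots (Df zs)) = p + 2 * g - 1"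
        using presents_leaf_list(3)[OF TH[OF zs(1)] pos pr] by (simp add: leaf_list_shape)
      then show ?thesis using length_comb_bits[OF ic[OF zs(1)]] by (simp add: B_def)
    qed
    ultimately show "x \<in> Q \<times> halfs G \<times> B" by (simp add: zs(2) F_def)
  qed
  have finQ: "finite Q" unfolding Q_def using card_reachable(1)[OF fin] by blast
  have finh: "finite (halfs G)" using fin by (simp add: finite_graph_def)
  have cB: "card B = 2 ^ (p + 2 * g - 2)" "finite B"
    unfolding B_def using card_lists_length_eq[of "UNIV :: bool set"] finite_lists_length_eq[of "UNIV :: bool set"] by auto
  have "card Q \<le> (\<Sum>r\<in>{..k}. card {H. (whitehead_move ^^ r) G H})"
    unfolding Q_def by (rule card_UN_le) simp
  also have "\<dots> \<le> (\<Sum>r\<in>{..k}. 10 ^ (card (verts G) + 2 * k))"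
  proof (rule sum_mono)
    fix r assume "r \<in> {..k}"
    then have "(10::nat) ^ (card (verts G) + 2 * r) \<le> 10 ^ (card (verts G) + 2 * k)" by (intro power_increasing) auto
    then show "card {H. (whitehead_move ^^ r) G H} \<le> 10 ^ (card (verts G) + 2 * k)"
      using card_reachable(2)[OF fin, of r] by (rule order_trans[rotated])
  qed
  also have "\<dots> = (k + 1) * 10 ^ (card (verts G) + 2 * k)" by simp
  finally have cQ: "card Q \<le> (k + 1) * 10 ^ (card (verts G) + 2 * k)" .
  have "fact (p + g - 1) \<le> (fact (card R) :: nat)" by (rule fact_mono_nat[OF cR])
  also have "\<dots> = card P" by (simp only: cP)
  also have "\<dots> \<le> card (Q \<times> halfs G \<times> B)"
    by (rule card_inj_on_le[OF inj sub]) (use finQ finh cB in simp)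
  also have "\<dots> = card Q * card (halfs G) * 2 ^ (p + 2 * g - 2)"
    by (simp only: card_cartesian_product cB mult.assoc)
  also have "\<dots> \<le> (k + 1) * 10 ^ (card (verts G) + 2 * k) * (3 * card (verts G)) * 2 ^ (p + 2 * g - 2)"
    by (intro mult_le_mono cQ card_halfs_le[OF T] order_refl)
  finally show ?thesis .
qed

section \<open>Caterpillars as base points\<close>

lemma card_edges: "finite_graph G \<Longrightarrow> 2 * card (edges G) = card (halfs G)"
proof -
  assume fin: "finite_graph G"
  have un: "\<Union>(edges G) = halfs G" using finite_graphD(2)[OF fin] by (auto simp: edges_def)
  have finh: "finite (halfs G)" using fin by (simp add: finite_graph_def)
  have "2 * card (edges G) = card (\<Union>(edges G))"
  proof (rule card_partition)
    show "finite (edges G)" using finh by (simp add: edges_def Setcompr_eq_image)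
    show "finite (\<Union>(edges G))" using un finh by simp
    show "card c = 2" if c: "c \<in> edges G" for c
    proof -
      obtain h where h: "h \<in> halfs G" "c = {h, opp G h}" using c by (auto simp: edges_def)
      then show ?thesis using finite_graphD(3)[OF fin h(1)] by simp
    qed
    have key: "c = {x, opp G x}" if c: "c \<in> edges G" and x: "x \<in> c" for c x
    proof -
      obtain h where h: "h \<in> halfs G" "c = {h, opp G h}" using c by (auto simp: edges_def)
      then show ?thesis using x finite_graphD(4)[OF fin h(1)] by auto
    qed
    show "c1 \<inter> c2 = {}" if "c1 \<in> edges G" "c2 \<in> edges G" "c1 \<noteq> c2" for c1 c2
      using key[OF that(1)] key[OF that(2)] that(3) by (metis disjoint_iff)
  qed
  then show ?thesis using un by simp
qed

text \<open>
  The caterpillar with \<open>n\<close> trivalent vertices: vertex \<open>v\<close> carries the half-edges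
  \<open>3 v, 3 v + 1, 3 v + 2\<close>, consecutive vertices are joined by \<open>{3 v + 2, 3 v + 3}\<close>, the remaining
  \<open>n + 2\<close> half-edges are enumerated by \<open>cat_slot\<close>. The first \<open>2 g\<close> of these are joined in
  consecutive pairs, the others lead to the leaves.
\<close>

definition cat_slot :: "nat \<Rightarrow> nat \<Rightarrow> nat" where
  "cat_slot n j = (if j = 0 then 0 else if j \<le> n then 3 * j - 2 else 3 * n - 1)"

text \<open>Inverse of \<open>cat_slot n\<close> on \<open>j < n + 2\<close>; adding 2 turns
  \<open>3 * j - 2\<close> into a multiple of 3.\<close>

definition cat_index :: "nat \<Rightarrow> nat \<Rightarrow> nat" where
  "cat_index n h = (if h = 0 then 0 else if h = 3 * n - 1 then n + 1 else (h + 2) div 3)"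

definition cat_opp :: "nat \<Rightarrow> nat \<Rightarrow> nat \<Rightarrow> nat" where
  "cat_opp n g h = (if h \<ge> 3 * n then cat_slot n (2 * g + (h - 3 * n))
     else if h = 0 \<or> h = 3 * n - 1 \<or> h mod 3 = 1 then
       (let j = cat_index n h in
        if j < 2 * g then cat_slot n (if even j then j + 1 else j - 1) else 3 * n + (j - 2 * g))
     else if h mod 3 = 2 then h + 1 else h - 1)"

text \<open>Leaf number \<open>l\<close> is the vertex \<open>n + l\<close> with the half-edge
  \<open>3 * n + l\<close>, whence \<open>h - 2 * n\<close>; its label is
  \<open>l + 1\<close>.\<close>

definition caterpillar :: "nat \<Rightarrow> nat \<Rightarrow> nat \<Rightarrow> ngraph" where
  "caterpillar n g p = \<lparr>verts = {..<n + p}, halfs = {..<3 * n + p},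
     origin = (\<lambda>h. if h < 3 * n then h div 3 else h - 2 * n), opp = cat_opp n g, label = (\<lambda>v. v + 1 - n)\<rparr>"

lemma cat_slot_props:
  assumes "n > 0" "j < n + 2"
  shows "cat_slot n j < 3 * n" "cat_index n (cat_slot n j) = j"
    "cat_slot n j = 0 \<or> cat_slot n j = 3 * n - 1 \<or> cat_slot n j mod 3 = 1"
proof -
  show "cat_slot n j < 3 * n" using assms by (auto simp: cat_slot_def)
  consider "j = 0" | "0 < j" "j \<le> n" | "j = n + 1" using assms by linarith
  then have "cat_index n (cat_slot n j) = j \<and>
    (cat_slot n j = 0 \<or> cat_slot n j = 3 * n - 1 \<or> cat_slot n j mod 3 = 1)"
  proof cases
    case 2
    then obtain i where i: "j = Suc i" by (cases j) auto
    have "cat_slot n j = 3 * i + 1" using 2 i by (simp add: cat_slot_def)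
    moreover have "3 * i + 1 \<noteq> 3 * n - 1" using 2 by presburger
    ultimately show ?thesis using i by (simp add: cat_index_def)
  qed (use assms in \<open>auto simp: cat_slot_def cat_index_def\<close>)
  then show "cat_index n (cat_slot n j) = j" "cat_slot n j = 0 \<or> cat_slot n j = 3 * n - 1 \<or> cat_slot n j mod 3 = 1"
    by auto
qed

lemma cat_index_props:
  assumes "n > 0" "h < 3 * n" "h = 0 \<or> h = 3 * n - 1 \<or> h mod 3 = 1"
  shows "cat_index n h < n + 2" "cat_slot n (cat_index n h) = h"
proof -
  consider "h = 0" | "h = 3 * n - 1" "h \<noteq> 0" | i where "h = 3 * i + 1" "h \<noteq> 3 * n - 1"
    using assms(3) by (metis div_mult_mod_eq mult.commute)
  then have "cat_index n h < n + 2 \<and> cat_slot n (cat_index n h) = h"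
    using assms(1,2) by cases (auto simp: cat_slot_def cat_index_def)
  then show "cat_index n h < n + 2" "cat_slot n (cat_index n h) = h" by auto
qed

lemma cat_opp_slot:
  assumes "n > 0" "j < n + 2"
  shows "cat_opp n g (cat_slot n j) =
    (if j < 2 * g then cat_slot n (if even j then j + 1 else j - 1) else 3 * n + (j - 2 * g))"
  using cat_slot_props[OF assms] unfolding cat_opp_def Let_def by auto

lemma cat_opp_leaf: "cat_opp n g (3 * n + l) = cat_slot n (2 * g + l)"
  by (simp add: cat_opp_def)

lemma cat_opp_edge:
  assumes "Suc i < n"
  shows "cat_opp n g (3 * i + 2) = 3 * i + 3" "cat_opp n g (3 * i + 3) = 3 * i + 2"
proof -
  have "3 * i + 2 \<noteq> 3 * n - 1" "3 * i + 3 \<noteq> 3 * n - 1" "3 * i + 3 < 3 * n" using assms by presburger+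
  moreover have "(3 * i + 2) mod 3 = 2" "(3 * i + 3) mod 3 = (0::nat)" by presburger+
  ultimately show "cat_opp n g (3 * i + 2) = 3 * i + 3" "cat_opp n g (3 * i + 3) = 3 * i + 2"
    by (simp_all add: cat_opp_def)
qed

lemma cat_half_cases:
  assumes "n > 0" "h < 3 * n + p"
  obtains (slot) j where "j < n + 2" "h = cat_slot n j"
    | (leaf) l where "l < p" "h = 3 * n + l"
    | (right) i where "Suc i < n" "h = 3 * i + 2"
    | (left) i where "Suc i < n" "h = 3 * i + 3"
proof (cases "h < 3 * n")
  case False
  then show ?thesis using leaf[of "h - 3 * n"] assms by simp
next
  case True
  show ?thesis
  proof (cases "h = 0 \<or> h = 3 * n - 1 \<or> h mod 3 = 1")
    case True
    then show ?thesis using slot[of "cat_index n h"] cat_index_props[OF assms(1) \<open>h < 3 * n\<close> True] by simp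
  next
    case False
    then consider "h mod 3 = 2" | "h mod 3 = 0" by linarith
    then show ?thesis
    proof cases
      case 1
      then have "h = 3 * (h div 3) + 2" "Suc (h div 3) < n" using True False by presburger+
      then show ?thesis using right by blast
    next
      case 2
      then have "h = 3 * (h div 3 - 1) + 3" "Suc (h div 3 - 1) < n" using True False by presburger+
      then show ?thesis using left by blast
    qed
  qed
qed

lemma caterpillar_simps [simp]:
  "verts (caterpillar n g p) = {..<n + p}" "halfs (caterpillar n g p) = {..<3 * n + p}"
  "origin (caterpillar n g p) h = (if h < 3 * n then h div 3 else h - 2 * n)"
  "opp (caterpillar n g p) = cat_opp n g" "label (caterpillar n g p) v = v + 1 - n"
  by (simp_all add: caterpillar_def)

lemma caterpillar_star:
  shows "v < n \<Longrightarrow> star (caterpillar n g p) v = {3 * v, 3 * v + 1, 3 * v + 2}"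
    "l < p \<Longrightarrow> star (caterpillar n g p) (n + l) = {3 * n + l}"
proof -
  show "star (caterpillar n g p) v = {3 * v, 3 * v + 1, 3 * v + 2}" if "v < n"
    using that unfolding star_def by (auto split: if_splits)
  show "star (caterpillar n g p) (n + l) = {3 * n + l}" if "l < p"
    using that unfolding star_def by (auto split: if_splits)
qed

lemma caterpillar_leaves: "leaves (caterpillar n g p) = {n..<n + p}"
proof -
  have "valence (caterpillar n g p) v = 1 \<longleftrightarrow> n \<le> v" if "v < n + p" for v
  proof (cases "v < n")
    case True
    then show ?thesis by (simp add: valence_def caterpillar_star)
  next
    case False
    define l where "l = v - n"
    have "v = n + l" "l < p" using False that by (auto simp: l_def)
    then show ?thesis by (simp add: valence_def caterpillar_star)
  qed
  then show ?thesis by (auto simp: leaves_def)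
qed

text \<open>The rank comes from counting: \<open>3 * n + p\<close> half-edges, \<open>n + p\<close>
  vertices and \<open>n + 2 = 2 * g + p\<close> give \<open>(n - p) / 2 + 1 = g\<close>.
  Connectedness goes through the spine, from which each leaf is one step away.\<close>

lemma trivalent_caterpillar:
  assumes n: "n + 2 = 2 * g + p" "n > 0"
  shows "trivalent_graph g p (caterpillar n g p)"
proof -
  let ?G = "caterpillar n g p"
  have opp: "cat_opp n g h < 3 * n + p \<and> cat_opp n g h \<noteq> h \<and> cat_opp n g (cat_opp n g h) = h"
    if "h < 3 * n + p" for h
    using n(2) that
  proof (cases rule: cat_half_cases)
    case (slot j)
    show ?thesis
    proof (cases "j < 2 * g")
      case True
      define j' where "j' = (if even j then j + 1 else j - 1)"
      have j': "j' < 2 * g" "j' \<noteq> j" "(if even j' then j' + 1 else j' - 1) = j"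
        using True unfolding j'_def by presburger+
      have j'n: "j' < n + 2" using j'(1) n by simp
      have "cat_opp n g h = cat_slot n j'" using cat_opp_slot[OF n(2) slot(1), of g] True slot(2) by (simp add: j'_def)
      moreover have "cat_opp n g (cat_slot n j') = h"
        using cat_opp_slot[OF n(2) j'n, of g] j' slot(2) by simp
      moreover have "cat_slot n j' \<noteq> h" using cat_slot_props(2)[OF n(2) j'n] cat_slot_props(2)[OF n(2) slot(1)] j'(2) slot(2) by metis
      ultimately show ?thesis using cat_slot_props(1)[OF n(2) j'n] by simp
    next
      case False
      then have "cat_opp n g h = 3 * n + (j - 2 * g)" using cat_opp_slot[OF n(2) slot(1), of g] slot(2) by simp
      then show ?thesis using cat_opp_leaf[of n g "j - 2 * g"] cat_slot_props(1)[OF n(2) slot(1)] slot n False by auto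
    qed
  next
    case (leaf l)
    have j: "2 * g + l < n + 2" using leaf n by simp
    show ?thesis using cat_opp_slot[OF n(2) j, of g] cat_slot_props(1)[OF n(2) j] leaf by (simp add: cat_opp_leaf)
  next
    case (right i)
    then show ?thesis using cat_opp_edge[of i n g] by simp
  next
    case (left i)
    then show ?thesis using cat_opp_edge[of i n g] by simp
  qed
  have fin: "finite_graph ?G"
    unfolding finite_graph_def
  proof (intro conjI ballI)
    fix h assume "h \<in> halfs ?G"
    then have h: "h < 3 * n + p" by simp
    show "origin ?G h \<in> verts ?G" using h by auto
    show "opp ?G h \<in> halfs ?G" "opp ?G h \<noteq> h" "opp ?G (opp ?G h) = h" using opp[OF h] by simp_all
  qed simp_all
  define R where "R = {(origin ?G h, origin ?G (opp ?G h)) | h. h \<in> halfs ?G}"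
  have step: "(origin ?G h, origin ?G (opp ?G h)) \<in> R" if "h \<in> halfs ?G" for h
    using that unfolding R_def by blast
  have spine: "(0, v) \<in> R\<^sup>* \<and> (v, 0) \<in> R\<^sup>*" if "v < n" for v
    using that
  proof (induction v)
    case (Suc v)
    have e: "cat_opp n g (3 * v + 2) = 3 * v + 3" "cat_opp n g (3 * v + 3) = 3 * v + 2"
      using cat_opp_edge[OF Suc.prems] by blast+
    have h: "3 * v + 2 \<in> halfs ?G" "3 * v + 3 \<in> halfs ?G" using Suc.prems by auto
    have d: "(3 * v + 2) div 3 = v" "(3 * v + 3) div 3 = Suc v" by auto
    have "(v, Suc v) \<in> R" using step[OF h(1)] Suc.prems unfolding caterpillar_simps e d by simp
    moreover have "(Suc v, v) \<in> R" using step[OF h(2)] Suc.prems unfolding caterpillar_simps e d by simp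
    ultimately show ?case using Suc by (meson Suc_lessD rtrancl.rtrancl_into_rtrancl converse_rtrancl_into_rtrancl)
  qed simp
  have all: "(0, v) \<in> R\<^sup>* \<and> (v, 0) \<in> R\<^sup>*" if v: "v \<in> verts ?G" for v
  proof (cases "v < n")
    case False
    define l where "l = v - n"
    have l: "v = n + l" "l < p" using False v by (auto simp: l_def)
    have j: "2 * g + l < n + 2" using l n by simp
    define h where "h = cat_slot n (2 * g + l)"
    have h: "h < 3 * n" "cat_opp n g h = 3 * n + l" "cat_opp n g (3 * n + l) = h"
      using cat_slot_props(1)[OF n(2) j] cat_opp_slot[OF n(2) j, of g] cat_opp_leaf by (auto simp: h_def)
    have hh: "h \<in> halfs ?G" "3 * n + l \<in> halfs ?G" using h l by auto
    have "(h div 3, v) \<in> R" using step[OF hh(1)] h l by simp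
    moreover have "(v, h div 3) \<in> R" using step[OF hh(2)] h l by simp
    moreover have "h div 3 < n" using h by auto
    ultimately show ?thesis using spine by (meson rtrancl.rtrancl_into_rtrancl converse_rtrancl_into_rtrancl)
  qed (use spine in blast)
  have con: "connected_graph ?G"
  proof -
    have "(u, v) \<in> R\<^sup>*" if "u \<in> verts ?G" "v \<in> verts ?G" for u v
      using all[OF that(1)] all[OF that(2)] by (meson rtrancl_trans)
    moreover have "verts ?G \<noteq> {}" using n(2) by auto
    ultimately show ?thesis unfolding connected_graph_def reach_def R_def by blast
  qed
  have val: "valence ?G v = (if v < n then 3 else 1)" if "v < n + p" for v
  proof (cases "v < n")
    case True
    then show ?thesis by (simp add: valence_def caterpillar_star)
  next
    case False
    then have "v \<in> leaves ?G" using that by (simp add: caterpillar_leaves)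
    then show ?thesis using False by (simp add: leaves_def)
  qed
  have tri: "{v \<in> verts ?G. valence ?G v = 3} = {..<n}" using val by (auto split: if_splits)
  have "betti ?G = int g"
    using betti_connected[OF con] card_edges[OF fin] n by simp
  moreover have "bij_betw (label ?G) (leaves ?G) {1..p}"
    unfolding caterpillar_leaves
    by (rule bij_betw_byWitness[where f' = "\<lambda>i. i + n - 1"]) auto
  moreover have "int (card {v \<in> verts ?G. valence ?G v = 3}) = 2 * int g - 2 + int p"
    unfolding tri using n by simp
  ultimately show ?thesis
    unfolding trivalent_graph_def using fin con val by (auto split: if_splits)
qed

section \<open>Two non-isomorphic graphs, so that the diameter is positive\<close>

lemma iso_by_card_loops:
  assumes fin: "finite_graph G" and i: "iso_by f \<phi> G G'"
  shows "card {h \<in> halfs G'. origin G' h = origin G' (opp G' h)} =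
    card {h \<in> halfs G. origin G h = origin G (opp G h)}"
proof -
  have bp: "bij_betw \<phi> (halfs G) (halfs G')" and bf: "inj_on f (verts G)"
    and o: "\<And>h. h \<in> halfs G \<Longrightarrow> origin G' (\<phi> h) = f (origin G h)"
      "\<And>h. h \<in> halfs G \<Longrightarrow> opp G' (\<phi> h) = \<phi> (opp G h)"
    using i by (auto simp: iso_by_def bij_betw_def)
  have iff: "origin G' (\<phi> h) = origin G' (opp G' (\<phi> h)) \<longleftrightarrow> origin G h = origin G (opp G h)"
    if h: "h \<in> halfs G" for h
  proof -
    have oh: "opp G h \<in> halfs G" using finite_graphD(2)[OF fin h] .
    show ?thesis unfolding o(2)[OF h] o(1)[OF h] o(1)[OF oh]
      using inj_on_eq_iff[OF bf finite_graphD(1)[OF fin h] finite_graphD(1)[OF fin oh]] .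
  qed
  have "bij_betw \<phi> {h \<in> halfs G. origin G h = origin G (opp G h)} {h \<in> halfs G'. origin G' h = origin G' (opp G' h)}"
    by (rule bij_betw_Collect[OF bp]) (rule iff)
  then show ?thesis by (rule bij_betw_same_card[symmetric])
qed

text \<open>Taking the half \<open>s\<close> of the loop \<open>{s, a}\<close> away from
  \<open>origin G h\<close> opens this loop. No new loop appears: the incoming \<open>t\<close>
  meets only \<open>h\<close> and \<open>a\<close> there, whose partners are \<open>opp G h\<close>
  and \<open>s\<close>, while the outgoing \<open>s\<close> leaves its partner behind.\<close>

lemma loops_swap_psubset:
  assumes fin: "finite_graph G" and piv: "pivot G h s t" and a: "opp G s = a" "a \<noteq> h"
    and star: "star G (origin G h) = {h, s, a}"
  shows "{x \<in> halfs (swap G s t). origin (swap G s t) x = origin (swap G s t) (opp (swap G s t) x)}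
    \<subset> {x \<in> halfs G. origin G x = origin G (opp G x)}"
proof -
  let ?u = "origin G h" and ?w = "origin G (opp G h)"
  note p = piv[unfolded pivot_def]
  have "a \<in> star G ?u" unfolding star by simp
  then have am: "a \<in> halfs G" "origin G a = ?u" by simp_all
  define o' where "o' = origin (swap G s t)"
  have o': "o' x = (if x = s then ?w else if x = t then ?u else origin G x)" for x
    unfolding o'_def by (rule pivot_swap[OF piv])
  have uw: "?u \<noteq> ?w" and st: "s \<noteq> t" "a \<noteq> t" "a \<noteq> s"
    using p am finite_graphD(3)[OF fin, of s] a(1) by auto
  have opa: "opp G a = s" using finite_graphD(4)[OF fin, of s] p a by auto
  have inv: "opp G (opp G x) = x" if "x \<in> halfs G" for x by (rule finite_graphD(4)[OF fin that])
  have os: "o' s \<noteq> o' a" using uw st am unfolding o' by auto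
  have ot: "o' (opp G t) \<noteq> ?u"
  proof
    assume y: "o' (opp G t) = ?u"
    have th: "t \<in> halfs G" "opp G t \<noteq> t" "opp G t \<in> halfs G" using p finite_graphD[OF fin] by auto
    have "opp G t \<noteq> s" "origin G (opp G t) = ?u" using y uw th(2) unfolding o' by (auto split: if_splits)
    then have "opp G t \<in> star G ?u" "opp G t \<noteq> s" using th by auto
    then have "opp G t = h \<or> opp G t = a" unfolding star by blast
    then have "t = opp G h \<or> t = s" using inv[OF th(1)] opa by auto
    then show False using p st by blast
  qed
  have o't: "o' t = ?u" using st unfolding o' by simp
  have "x \<in> halfs G \<and> origin G x = origin G (opp G x)" if x: "x \<in> halfs G" "o' x = o' (opp G x)" for x
  proof -
    have "x \<noteq> s" "x \<noteq> t" using x(2) os a(1) ot o't by auto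
    moreover have "opp G x \<noteq> s" "opp G x \<noteq> t" using inv[OF x(1)] x(2) os a(1) ot o't by auto
    ultimately show ?thesis using x unfolding o' by simp
  qed
  moreover have "a \<in> halfs G" "origin G a = origin G (opp G a)" using am opa p by auto
  moreover have "o' a \<noteq> o' (opp G a)" using os opa by simp
  ultimately show ?thesis unfolding o'_def swap_simps(2,3) by blast
qed

text \<open>One move at the first spine edge of the caterpillar is detected by an invariant. For
  \<open>g > 0\<close> the first vertex carries a loop, and the move reduces the number of loops.
  For \<open>g = 0\<close> the leaves labelled 1 and 2 share a neighbour before the move but not
  after it.\<close>

lemma non_isomorphic_exist:
  assumes n: "n + 2 = 2 * g + p" "n \<ge> 2"
  shows "\<exists>(G :: ngraph) (G' :: ngraph). trivalent_graph g p G \<and> trivalent_graph g p G' \<and> \<not> isomorphic G G'"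
proof -
  let ?G = "caterpillar n g p"
  let ?G' = "swap ?G (1::nat) (4::nat)"
  have T: "trivalent_graph g p ?G" using trivalent_caterpillar[OF n(1)] n(2) by simp
  note fin = trivalentD(1)[OF T]
  have e: "cat_opp n g 2 = 3" "cat_opp n g 3 = 2" using cat_opp_edge[of 0 n g] n(2) by (auto simp: numeral_eq_Suc)
  have v: "valence ?G 0 = 3" "valence ?G (Suc 0) = 3"
    using n(2) by (auto simp: valence_def caterpillar_star)
  have piv: "pivot ?G 2 1 4"
    using e v n(2) by (simp add: pivot_def)
  have T': "trivalent_graph g p ?G'" by (rule trivalent_graph_swap[OF T piv])
  have o': "origin ?G' x = (if x = 1 then 1 else if x = 4 then 0 else origin ?G x)" for x
    unfolding pivot_swap[OF piv] using e n(2) by simp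
  have sl: "cat_slot n 0 = 0" "cat_slot n 1 = 1" using n(2) by (auto simp: cat_slot_def)
  have "\<not> isomorphic ?G ?G'"
  proof (cases "g = 0")
    case False
    then have o1: "cat_opp n g 0 = 1" "cat_opp n g 1 = 0"
      using cat_opp_slot[of n 0 g] cat_opp_slot[of n 1 g] sl n(2) by auto
    let ?L = "\<lambda>G :: ngraph. {h \<in> halfs G. origin G h = origin G (opp G h)}"
    have o2: "origin ?G 2 = 0" using n(2) by simp
    have "star ?G 0 = {3 * 0, 3 * 0 + 1, 3 * 0 + 2}" using n(2) by (intro caterpillar_star) simp
    also have "\<dots> = {2, 1, 0}" by auto
    finally have st: "star ?G (origin ?G 2) = {2, 1, 0}" unfolding o2 .
    have op: "opp ?G 1 = 0" by (simp only: caterpillar_simps o1)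
    have "?L ?G' \<subset> ?L ?G"
      by (rule loops_swap_psubset[OF fin piv op _ st]) simp
    then have "card (?L ?G') < card (?L ?G)" by (intro psubset_card_mono) simp_all
    then show ?thesis using iso_by_card_loops[OF fin, of _ _ ?G'] unfolding isomorphic_iff by (metis (no_types, lifting) less_irrefl)
  next
    case True
    then have p: "p = n + 2" using n(1) by simp
    have o1: "cat_opp n g 0 = 3 * n" "cat_opp n g 1 = 3 * n + 1"
      using cat_opp_slot[of n 0 g] cat_opp_slot[of n 1 g] sl n(2) True by auto
    have o2: "cat_opp n g (3 * n) = 0" "cat_opp n g (3 * n + 1) = 1"
      using cat_opp_leaf[of n g 0] cat_opp_leaf[of n g 1] sl True by auto
    show ?thesis
    proof
      assume "isomorphic ?G ?G'"
      then obtain f \<phi> where i: "iso_by f \<phi> ?G ?G'" unfolding isomorphic_iff by blast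
      have H: "0 \<in> halfs ?G" "1 \<in> halfs ?G" "3 * n \<in> halfs ?G" "3 * n + 1 \<in> halfs ?G"
        using n(2) p by auto
      have bp: "\<And>h. h \<in> halfs ?G \<Longrightarrow> \<phi> h \<in> halfs ?G" and bf: "\<And>v. v \<in> verts ?G \<Longrightarrow> f v \<in> verts ?G"
        and o: "\<And>h. h \<in> halfs ?G \<Longrightarrow> origin ?G' (\<phi> h) = f (origin ?G h)"
          "\<And>h. h \<in> halfs ?G \<Longrightarrow> opp ?G (\<phi> h) = \<phi> (opp ?G h)"
        and lab: "\<And>v. v \<in> leaves ?G \<Longrightarrow> label ?G (f v) = label ?G v"
        using i unfolding iso_by_def bij_betw_def by auto
      have lv: "n \<in> leaves ?G" "n + 1 \<in> leaves ?G" using p by (auto simp: caterpillar_leaves)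
      have st: "valence ?G' v = valence ?G v" for v
        by (rule valence_swap) (use piv in \<open>auto simp: pivot_def\<close>)
      have fl: "f v \<in> leaves ?G" if "v \<in> leaves ?G" for v
      proof -
        have "v \<in> verts ?G" using that by (simp add: leaves_def)
        then have "f v \<in> leaves ?G'" using iso_by_leaves[OF fin i] that by blast
        then show ?thesis by (simp only: leaves_def st swap_simps(1))
      qed
      have "f n = n" "f (n + 1) = n + 1"
        using fl[OF lv(1)] fl[OF lv(2)] lab[OF lv(1)] lab[OF lv(2)] by (auto simp: caterpillar_leaves)
      then have of: "origin ?G' (\<phi> (3 * n)) = n" "origin ?G' (\<phi> (3 * n + 1)) = n + 1"
        using o(1)[OF H(3)] o(1)[OF H(4)] by auto
      have le: "x = 3 * n + l" if "x \<in> halfs ?G" "origin ?G' x = n + l" for x l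
        using that n(2) unfolding o' by (auto split: if_splits)
      have ph: "\<phi> (3 * n) = 3 * n" "\<phi> (3 * n + 1) = 3 * n + 1"
        using le[OF bp[OF H(3)], of 0] le[OF bp[OF H(4)], of 1] of by auto
      have "\<phi> 0 = 0" "\<phi> 1 = 1"
        using o(2)[OF H(3)] o(2)[OF H(4)] unfolding ph caterpillar_simps o2 by auto
      then show False using o(1)[OF H(1)] o(1)[OF H(2)] n(2) unfolding o' by auto
    qed
  qed
  then show ?thesis using T T' by blast
qed

lemma diam_W_pos:
  assumes "\<exists>(G :: ngraph) (G' :: ngraph). trivalent_graph g p G \<and> trivalent_graph g p G' \<and> \<not> isomorphic G G'"
  shows "\<not> diam_W g p \<le> enat 0"
proof
  assume diam: "diam_W g p \<le> enat 0"
  obtain G :: ngraph and G' :: ngraph where T: "trivalent_graph g p G" "trivalent_graph g p G'" "\<not> isomorphic G G'"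
    using assms by blast
  let ?X = "iso_rel g p `` {G}" and ?Y = "iso_rel g p `` {G'}"
  have XY: "?X \<in> Graph g p" "?Y \<in> Graph g p" using T unfolding Graph_eq by (auto intro!: quotientI)
  have "d_W g p ?X ?Y \<le> diam_W g p"
    unfolding diam_W_def by (intro SUP_upper2[OF XY(1)] SUP_upper XY(2))
  then have "d_W g p ?X ?Y \<le> enat 0" using diam by (rule order_trans)
  then have "?X = ?Y" unfolding d_W_le_iff by auto
  then have "(G, G') \<in> iso_rel g p"
    using eq_equiv_class[OF _ equiv_iso_rel] T(2) by blast
  then show False using T(3) by (simp add: iso_rel_def)
qed

lemma power_self_le_exp_fact: "real n ^ n \<le> exp (real n) * fact n"
proof -
  have sm: "(\<lambda>k. real n ^ k /\<^sub>R fact k) sums exp (real n)" by (rule exp_converges)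
  \<comment> \<open>The left side is a single term of the exponential series.\<close>
  have "(\<Sum>k\<in>{n}. real n ^ k /\<^sub>R fact k) \<le> exp (real n)"
    unfolding sums_unique[OF sm] by (rule sum_le_suminf[OF sums_summable[OF sm]]) simp_all
  then have "real n ^ n / fact n \<le> exp (real n)" by (simp add: field_simps)
  then show ?thesis by (simp add: field_simps)
qed

lemma ln_10_le: "ln (10::real) \<le> 4"
proof -
  have "ln (10::real) \<le> ln (2 ^ 4)" by (subst ln_le_cancel_iff) auto
  also have "\<dots> = 4 * ln 2" by (subst ln_realpow) auto
  also have "\<dots> \<le> 4" using ln_2_less_1 by simp
  finally show ?thesis .
qed

lemma power_of_two_sandwich:
  assumes "m \<ge> (1::nat)"
  shows "\<exists>j. m \<le> 2 ^ j \<and> 2 ^ j \<le> 2 * m"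
  using assms
proof (induction m rule: nat_induct_at_least)
  case base
  then show ?case by (intro exI[of _ 0]) simp
next
  case (Suc m)
  then obtain j where j: "m \<le> 2 ^ j" "2 ^ j \<le> 2 * m" by blast
  show ?case
  proof (cases "Suc m \<le> 2 ^ j")
    case True
    then show ?thesis using j by (intro exI[of _ j]) simp
  next
    case False
    then have "m = 2 ^ j" using j by simp
    then show ?thesis by (intro exI[of _ "Suc j"]) simp
  qed
qed

lemma diam_W_upper_real:
  assumes pos: "2 * int g - 2 + int p > 0"
  shows "\<exists>k. diam_W g p = enat k \<and> real k \<le> 64 * (real (g + p) * ln (real (g + p)))"
proof -
  define n where "n = g + p"
  have n2: "n \<ge> 2" using pos by (simp add: n_def)
  define m where "m = p + 2 * g - 1"
  have m: "m \<ge> 1" "m \<le> 2 * n" using pos by (auto simp: m_def n_def)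
  obtain j where j: "m \<le> 2 ^ j" "2 ^ j \<le> 2 * m" using power_of_two_sandwich[OF m(1)] by blast
  have "diam_W g p \<le> enat (2 * (j + 1) * 2 ^ j)" using diam_W_upper[OF pos] j(1) by (simp add: m_def)
  then obtain k where k: "diam_W g p = enat k" "k \<le> 2 * (j + 1) * 2 ^ j"
    by (cases "diam_W g p") auto
  have "(2::nat) ^ j \<le> 4 * n" using j m by linarith
  then have "real (2 ^ j) \<le> real (4 * n)" by (simp only: of_nat_le_iff)
  then have j4: "(2::real) ^ j \<le> 4 * real n" by simp
  have ln4: "ln (4::real) = 2 * ln 2"
  proof -
    have "ln (4::real) = ln (2 ^ 2)" by simp
    also have "\<dots> = 2 * ln 2" by (subst ln_realpow) auto
    finally show ?thesis .
  qed
  \<comment> \<open>Since \<open>exp 1 \<le> 3\<close>; halving \<open>ln 4\<close> then bounds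
    \<open>ln 2\<close> from below.\<close>
  have "1 \<le> ln (4::real)" using exp_le by (subst ln_ge_iff) auto
  then have ln2: "ln 2 \<ge> (1/2::real)" using ln4 by simp
  have lnn: "ln 2 \<le> ln (real n)" using n2 by (subst ln_le_cancel_iff) auto
  have "real j * ln 2 = ln (2 ^ j)" by (simp add: ln_realpow)
  also have "\<dots> \<le> ln (4 * real n)" using j4 n2 by (subst ln_le_cancel_iff) auto
  also have "\<dots> = 2 * ln 2 + ln (real n)" using n2 by (simp add: ln_mult ln4)
  also have "\<dots> \<le> 3 * ln (real n)" using lnn by simp
  finally have "real j * ln 2 \<le> 3 * ln (real n)" .
  moreover have "real j * (1/2) \<le> real j * ln 2" using ln2 by (intro mult_left_mono) auto
  ultimately have jn: "real j \<le> 6 * ln (real n)" by simp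
  have "real k \<le> real (2 * (j + 1) * 2 ^ j)" using k(2) by (simp only: of_nat_le_iff)
  also have "\<dots> = 2 * (real j + 1) * 2 ^ j" by (simp add: algebra_simps)
  \<comment> \<open>From \<open>j \<le> 6 * ln n\<close> and \<open>1 \<le> 2 * ln n\<close> follows
    \<open>j + 1 \<le> 8 * ln n\<close>; with \<open>2 ^ j \<le> 4 * n\<close> the constant is
    \<open>64 = 2 * 8 * 4\<close>.\<close>
  also have "\<dots> \<le> 2 * (8 * ln (real n)) * (4 * real n)"
    using jn lnn ln2 j4 by (intro mult_mono) auto
  finally have "real k \<le> 64 * (real n * ln (real n))" by (simp add: mult.commute)
  then show ?thesis using k(1) unfolding n_def by blast
qed

text \<open>Logarithms of the counting inequality give \<open>m * ln m \<le> 24 * m + 12 * k\<close>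
  for \<open>m = g + p\<close>. The left side absorbs the linear term when \<open>ln m\<close> is
  large; otherwise the left side is bounded, and \<open>k \<ge> 1\<close> suffices.\<close>

lemma diam_W_lower_real:
  assumes n: "n + 2 = 2 * g + p" "n \<ge> 2" and k: "diam_W g p = enat k"
  shows "real (g + p) * ln (real (g + p)) \<le> (24 + 48 * exp 48) * real k"
proof -
  have pos: "2 * int g - 2 + int p > 0" using n by simp
  define m where "m = g + p"
  have m2: "m \<ge> 2" using n by (simp add: m_def)
  have "\<not> enat k \<le> enat 0" using diam_W_pos[OF non_isomorphic_exist[OF n]] unfolding k .
  then have k1: "k \<ge> 1" by simp
  let ?G = "caterpillar n g p"
  have T: "trivalent_graph g p ?G" using trivalent_caterpillar[OF n(1)] n(2) by simp
  have V: "card (verts ?G) \<le> 2 * m" "n + p > 0" using n by (auto simp: m_def)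
  have six: "6 * m \<le> 10 ^ m" if "m \<ge> 1" for m :: nat
    using that by (induction m rule: nat_induct_at_least) auto
  have "fact (m - 1) \<le> (k + 1) * 10 ^ (card (verts ?G) + 2 * k) * (3 * card (verts ?G)) * (2 ^ (p + 2 * g - 2) :: nat)"
    using fact_le_of_diam_W[OF T pos] k by (simp add: m_def add.commute)
  \<comment> \<open>All factors become powers of 10: exponent \<open>k\<close> for
    \<open>k + 1\<close>, \<open>2 * m + 2 * k\<close> for the words, \<open>m\<close> each for root
    and bits, in total \<open>4 * m + 3 * k\<close>.\<close>
  also have "\<dots> \<le> 10 ^ k * 10 ^ (2 * m + 2 * k) * 10 ^ m * 10 ^ m"
  proof (intro mult_le_mono)
    show "k + 1 \<le> 10 ^ k" by (induction k) auto
    show "(10::nat) ^ (card (verts ?G) + 2 * k) \<le> 10 ^ (2 * m + 2 * k)" using V by (intro power_increasing) auto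
    show "3 * card (verts ?G) \<le> 10 ^ m" using V(1) six[of m] m2 by linarith
    have "(2::nat) ^ (p + 2 * g - 2) \<le> 2 ^ (2 * m)" by (intro power_increasing) (auto simp: m_def)
    also have "\<dots> = 4 ^ m" by (simp add: power_mult)
    also have "\<dots> \<le> 10 ^ m" by (intro power_mono) auto
    finally show "(2::nat) ^ (p + 2 * g - 2) \<le> 10 ^ m" .
  qed
  also have "\<dots> = 10 ^ (4 * m + 3 * k)" by (simp flip: power_add)
  finally have f1: "fact (m - 1) \<le> (10::nat) ^ (4 * m + 3 * k)" .
  have "fact m = m * (fact (m - 1) :: nat)" using m2 by (simp add: fact_reduce)
  also have "\<dots> \<le> 10 ^ m * 10 ^ (4 * m + 3 * k)"
    using six[of m] m2 by (intro mult_le_mono f1) linarith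
  also have "\<dots> = 10 ^ (5 * m + 3 * k)" by (simp flip: power_add)
  finally have f2: "fact m \<le> (10::nat) ^ (5 * m + 3 * k)" .
  have "real (fact m) \<le> real (10 ^ (5 * m + 3 * k))" using f2 by (simp only: of_nat_le_iff)
  then have f3: "fact m \<le> (10::real) ^ (5 * m + 3 * k)" by simp
  have e10: "exp (real m) \<le> 10 ^ m"
  proof -
    have "exp (real m) = exp 1 ^ m" by (simp flip: exp_of_nat_mult)
    also have "\<dots> \<le> 10 ^ m" using exp_le by (intro power_mono) auto
    finally show ?thesis .
  qed
  \<comment> \<open>Passing from \<open>fact (m - 1)\<close> to \<open>fact m\<close> cost one
    further \<open>10 ^ m\<close>, and the factor \<open>exp m\<close> costs another, hence the
    exponent \<open>6 * m\<close>.\<close>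
  have "real m ^ m \<le> exp (real m) * fact m" by (rule power_self_le_exp_fact)
  also have "\<dots> \<le> 10 ^ m * 10 ^ (5 * m + 3 * k)" using e10 f3 by (intro mult_mono) auto
  also have "\<dots> = 10 ^ (6 * m + 3 * k)" by (simp flip: power_add)
  finally have "real m ^ m \<le> 10 ^ (6 * m + 3 * k)" .
  then have "ln (real m ^ m) \<le> ln (10 ^ (6 * m + 3 * k))" using m2 by (subst ln_le_cancel_iff) auto
  then have "real m * ln (real m) \<le> real (6 * m + 3 * k) * ln 10" using m2 by (simp add: ln_realpow)
  also have "\<dots> \<le> real (6 * m + 3 * k) * 4" using ln_10_le by (intro mult_left_mono) auto
  finally have main: "real m * ln (real m) \<le> 24 * real m + 12 * real k" by simp
  \<comment> \<open>The threshold 48 is twice the coefficient of \<open>m\<close>, so beyond it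
    \<open>24 * m\<close> is at most half of the left side. Below it
    \<open>m \<le> exp 48\<close>.\<close>
  have "real m * ln (real m) \<le> (24 + 48 * exp 48) * real k"
  proof (cases "ln (real m) \<ge> 48")
    case True
    then have "real m * 48 \<le> real m * ln (real m)" by (intro mult_left_mono) auto
    then have "real m * ln (real m) \<le> 24 * real k" using main by linarith
    also have "\<dots> \<le> (24 + 48 * exp 48) * real k" by (intro mult_right_mono) auto
    finally show ?thesis .
  next
    case False
    then have "exp (ln (real m)) \<le> exp 48" by (subst exp_le_cancel_iff) simp
    then have me: "real m \<le> exp 48" using m2 by simp
    have "real m * ln (real m) \<le> exp 48 * 48" using me False m2 by (intro mult_mono) auto
    also have "\<dots> \<le> (24 + 48 * exp 48) * 1" by simp
    also have "\<dots> \<le> (24 + 48 * exp 48) * real k" using k1 by (intro mult_left_mono) (auto intro: add_nonneg_nonneg)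
    finally show ?thesis .
  qed
  then show ?thesis by (simp only: m_def)
qed

theorem theoremA1:
  shows "\<exists>K::real. K > 0 \<and> (\<forall>(g::nat) (p::nat). 2 * int g - 2 + int p > 0 \<longrightarrow>
    ereal_of_enat (diam_W g p) \<le> ereal (K * (real (g + p) * ln (real (g + p)))) \<and>
    ((g, p) \<notin> {(0, 3), (1, 1)} \<longrightarrow>
      ereal ((1 / K) * (real (g + p) * ln (real (g + p)))) \<le> ereal_of_enat (diam_W g p)))"
proof -
  \<comment> \<open>Dominates both \<open>64\<close>, for the upper bound, and
    \<open>24 + 48 * exp 48\<close>, for the lower one.\<close>
  define K :: real where "K = 64 + 48 * exp 48"
  have K: "K > 0" "64 \<le> K" "24 + 48 * exp 48 \<le> K" by (auto simp: K_def intro: add_pos_pos)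
  have main: "ereal_of_enat (diam_W g p) \<le> ereal (K * (real (g + p) * ln (real (g + p)))) \<and>
    ((g, p) \<notin> {(0, 3), (1, 1)} \<longrightarrow>
      ereal ((1 / K) * (real (g + p) * ln (real (g + p)))) \<le> ereal_of_enat (diam_W g p))"
    if pos: "2 * int g - 2 + int p > 0" for g p
  proof -
    define L where "L = real (g + p) * ln (real (g + p))"
    have "real (g + p) \<ge> 1" using pos by linarith
    then have L: "L \<ge> 0" unfolding L_def by (intro mult_nonneg_nonneg ln_ge_zero) auto
    obtain k where k: "diam_W g p = enat k" "real k \<le> 64 * L"
      using diam_W_upper_real[OF pos] unfolding L_def by blast
    have "64 * L \<le> K * L" using K L by (intro mult_right_mono) auto
    then have up: "real k \<le> K * L" using k(2) by linarith
    have "(1 / K) * L \<le> real k" if ex: "(g, p) \<notin> {(0, 3), (1, 1)}"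
    proof -
      define n where "n = 2 * g + p - 2"
      have n: "n + 2 = 2 * g + p" "n \<ge> 2"
      proof -
        show "n + 2 = 2 * g + p" using pos by (simp add: n_def)
        \<comment> \<open>The solutions of \<open>2 * g + p = 3\<close> are just the two excluded
          pairs, so there are at least two trivalent vertices and a move can change the
          graph.\<close>
        have "2 * g + p \<noteq> 3"
        proof
          assume a: "2 * g + p = 3"
          then have "g = 0 \<or> g = 1" by arith
          then show False using a ex by auto
        qed
        then show "n \<ge> 2" using pos by (simp add: n_def)
      qed
      have "L \<le> (24 + 48 * exp 48) * real k"
        using diam_W_lower_real[OF n k(1)] unfolding L_def .
      also have "\<dots> \<le> K * real k" using K by (intro mult_right_mono) auto
      finally show ?thesis using K(1) by (simp add: field_simps)
    qed
    then show ?thesis using up unfolding k(1) L_def[symmetric] by simp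
  qed
  show ?thesis using K(1) main by blast
qed

end
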